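(* Let $k$ be a field, let $\Lambda$ be a finite-dimensional quadratic monomial $k$-algebra and let $\Lambda^!$ be its quadratic dual. Let $M$ be a finitely copresented (respectively, finitely presented) graded $\Lambda^!$-module. Then the Hilbert series $$H_M(t)=\sum_{i\in\mathbb Z}(\dim_kM_i)\,t^i$$ is a rational function.
   Context: A finite-dimensional quadratic monomial algebra is $\Lambda=kQ/I$ with $Q$ a finite quiver (vertex set $Q_0$) and $I$ an admissible ideal generated by paths of length $2$. Paths compose like functions: for $\alpha\colon x\to y$, $\beta\colon y\to z$, the path $\beta\alpha$ goes from $x$ to $z$. The quadratic (Koszul) dual is $\Lambda^!=kQ^{\mathrm{op}}/I^!$, with $I^!$ generated by the paths $\alpha^{\mathrm{op}}\beta^{\mathrm{op}}$ for all composable $\alpha,\beta$ with $\beta\alpha\notin I$; it is graded by path length and possibly infinite-dimensional. Graded $\Lambda^!$-modules are $\mathbb Z$-graded left modules with finite-dimensional homogeneous components (arrows raise the degree by $1$); $M\langle i\rangle_n=M_{n-i}$. $P^!_x=\Lambda^!e_x$, and $I_x^!$ is the graded injective with $I_x^!(y)=\operatorname{Hom}_k(\Lambda^!(y,x),k)$, where $\Lambda^!(y,x)$ is the span of nonzero paths from $y$ to $x$ and the dual of a path of length $n$ has degree $-n$. Finitely presented: there is an exact sequence $P^1\to P^0\to M\to0$ with $P^0,P^1$ finite direct sums of modules $P^!_x\langle i\rangle$; such $M$ vanishes in sufficiently small degrees, so $H_M(t)$ is a formal Laurent series in $t$. Finitely copresented: there is an exact sequence $0\to M\to I^0\to I^1$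 with $I^0,I^1$ finite direct sums of modules $I^!_x\langle i\rangle$; such $M$ vanishes in sufficiently large degrees, so $H_M(t)$ is a formal Laurent series in $t^{-1}$. Rationality means that this Laurent series is the expansion of a rational function. *)

theory Defs
  imports
    "Graph_Theory.Arc_Walk"
    "HOL-Computational_Algebra.Formal_Laurent_Series"
    "HOL-Algebra.Ideal_Product"
    "HOL-Algebra.QuotRing"
    "Jordan_Normal_Form.VS_Connect"
begin

section \<open>Path algebras\<close>

text \<open>
  A finite quiver is a \<^locale>\<open>fin_digraph\<close>, with loops and multiple arcs allowed. A path is a
  pair \<open>(u, as)\<close> of its start vertex and the list of its arcs \<^emph>\<open>in the order of traversal\<close>; the
  start vertex distinguishes the trivial paths \<open>(u, [])\<close>. So the path that is written \<open>\<beta>\<alpha>\<close> when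
  paths compose like functions is \<open>(tail Q \<alpha>, [\<alpha>, \<beta>])\<close>.
\<close>

type_synonym ('v, 'a) path = "'v \<times> 'a list"

definition paths :: "('v, 'a) pre_digraph \<Rightarrow> ('v, 'a) path set" where
  "paths Q = {(u, as). \<exists>v. pre_digraph.awalk Q u as v}"

text \<open>
  Elements of the path algebra are finitely supported functions on paths. Paths compose like
  functions: the product \<open>q p\<close> of paths is ``first \<open>p\<close>, then \<open>q\<close>'' if \<open>q\<close> starts where \<open>p\<close> ends and
  \<open>0\<close> otherwise. Hence the coefficient of \<open>f g\<close> at a path is the sum over all ways of cutting that
  path into an initial part (fed to \<open>g\<close>) and a final part (fed to \<open>f\<close>).
\<close>

definition path_algebra :: "('v, 'a) pre_digraph \<Rightarrow> (('v, 'a) path \<Rightarrow> 'k::field) ring" where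
  "path_algebra Q =
    \<lparr>carrier = {f. finite {p. f p \<noteq> 0} \<and> {p. f p \<noteq> 0} \<subseteq> paths Q},
     mult = (\<lambda>f g (u, as).
       \<Sum>i\<le>length as. f (pre_digraph.awlast Q u (take i as), drop i as) * g (u, take i as)),
     one = (\<lambda>(u, as). if u \<in> verts Q \<and> as = [] then 1 else 0),
     zero = (\<lambda>_. 0),
     add = (\<lambda>f g p. f p + g p)\<rparr>"

definition path_vec :: "('v, 'a) path \<Rightarrow> ('v, 'a) path \<Rightarrow> 'k::field" where
  "path_vec p = (\<lambda>q. if q = p then 1 else 0)"

definition arrow_ideal :: "('v, 'a) pre_digraph \<Rightarrow> (('v, 'a) path \<Rightarrow> 'k::field) set" where
  "arrow_ideal Q = genideal (path_algebra Q) ((\<lambda>\<alpha>. path_vec (tail Q \<alpha>, [\<alpha>])) ` arcs Q)"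

text \<open>\<open>J [^]\<^bsub>ideals_set R\<^esub> N\<close> is the \<open>N\<close>-th power of the ideal \<open>J\<close> of \<open>R\<close>.\<close>

definition admissible_ideal ::
    "('v, 'a) pre_digraph \<Rightarrow> (('v, 'a) path \<Rightarrow> 'k::field) set \<Rightarrow> bool" where
  "admissible_ideal Q I \<longleftrightarrow>
    ideal I (path_algebra Q) \<and>
    (\<exists>N::nat. N \<ge> 2 \<and> arrow_ideal Q [^]\<^bsub>ideals_set (path_algebra Q)\<^esub> N \<subseteq> I) \<and>
    I \<subseteq> arrow_ideal Q [^]\<^bsub>ideals_set (path_algebra Q)\<^esub> (2::nat)"

definition quadratic_monomial_ideal ::
    "('v, 'a) pre_digraph \<Rightarrow> (('v, 'a) path \<Rightarrow> 'k::field) set \<Rightarrow> bool" where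
  "quadratic_monomial_ideal Q I \<longleftrightarrow>
    (\<exists>S. S \<subseteq> {p \<in> paths Q. length (snd p) = 2} \<and> I = genideal (path_algebra Q) (path_vec ` S))"


section \<open>Graded algebras and the quadratic dual\<close>

text \<open>
  The field \<open>scalar\<close> is the structure map \<open>c \<mapsto> c \<cdot> 1\<close> from the ground field, \<open>acomp\<close> the grading.
\<close>

record ('a, 'k) graded_algebra = "'a ring" +
  scalar :: "'k \<Rightarrow> 'a"
  acomp :: "int \<Rightarrow> 'a set"

text \<open>The quotient of a path algebra by an ideal, graded by path length.\<close>

definition bound_quiver_algebra ::
    "('v, 'a) pre_digraph \<Rightarrow> (('v, 'a) path \<Rightarrow> 'k::field) set \<Rightarrow>
     ((('v, 'a) path \<Rightarrow> 'k) set, 'k) graded_algebra" where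
  "bound_quiver_algebra Q I =
    (let R = path_algebra Q in
    \<lparr>carrier = carrier (R Quot I), mult = mult (R Quot I), one = one (R Quot I),
     zero = zero (R Quot I), add = add (R Quot I),
     scalar = (\<lambda>c. I +>\<^bsub>R\<^esub> (\<lambda>p. c * \<one>\<^bsub>R\<^esub> p)),
     acomp = (\<lambda>n. {I +>\<^bsub>R\<^esub> f | f. f \<in> carrier R \<and> (\<forall>p. f p \<noteq> 0 \<longrightarrow> int (length (snd p)) = n)})\<rparr>)"

definition opposite_quiver :: "('v, 'a) pre_digraph \<Rightarrow> ('v, 'a) pre_digraph" where
  "opposite_quiver Q = \<lparr>verts = verts Q, arcs = arcs Q, tail = head Q, head = tail Q\<rparr>"

text \<open>
  For composable \<open>\<alpha>\<close>, \<open>\<beta>\<close> the path \<open>\<alpha>\<^sup>o\<^sup>p \<beta>\<^sup>o\<^sup>p\<close> of the opposite quiver starts at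
  \<open>head Q \<beta>\<close> and traverses first \<open>\<beta>\<close>, then \<open>\<alpha>\<close>.
\<close>

definition quadratic_dual_ideal ::
    "('v, 'a) pre_digraph \<Rightarrow> (('v, 'a) path \<Rightarrow> 'k::field) set \<Rightarrow> (('v, 'a) path \<Rightarrow> 'k) set" where
  "quadratic_dual_ideal Q I =
    genideal (path_algebra (opposite_quiver Q))
      {path_vec (head Q \<beta>, [\<beta>, \<alpha>]) | \<alpha> \<beta>.
        \<alpha> \<in> arcs Q \<and> \<beta> \<in> arcs Q \<and> head Q \<alpha> = tail Q \<beta> \<and> path_vec (tail Q \<alpha>, [\<alpha>, \<beta>]) \<notin> I}"

definition quadratic_dual ::
    "('v, 'a) pre_digraph \<Rightarrow> (('v, 'a) path \<Rightarrow> 'k::field) set \<Rightarrow>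
     ((('v, 'a) path \<Rightarrow> 'k) set, 'k) graded_algebra" where
  "quadratic_dual Q I = bound_quiver_algebra (opposite_quiver Q) (quadratic_dual_ideal Q I)"

definition dual_idem ::
    "('v, 'a) pre_digraph \<Rightarrow> (('v, 'a) path \<Rightarrow> 'k::field) set \<Rightarrow> 'v \<Rightarrow> (('v, 'a) path \<Rightarrow> 'k) set" where
  "dual_idem Q I x = quadratic_dual_ideal Q I +>\<^bsub>path_algebra (opposite_quiver Q)\<^esub> path_vec (x, [])"


section \<open>Graded left modules\<close>

text \<open>
  The library locale \<^locale>\<open>module\<close> is restricted to commutative rings. In the record type
  \<open>module\<close> only the additive structure and the action \<open>smult\<close> matter; the fields \<open>mult\<close> and \<open>one\<close>
  carry no information.
\<close>

locale left_module = R?: ring R + M?: abelian_group M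
  for R :: "('a, 'r) ring_scheme" (structure) and M :: "('a, 'b, 'm) module_scheme" (structure) +
  assumes smult_closed:
      "\<lbrakk>a \<in> carrier R; x \<in> carrier M\<rbrakk> \<Longrightarrow> a \<odot>\<^bsub>M\<^esub> x \<in> carrier M"
    and smult_l_distr:
      "\<lbrakk>a \<in> carrier R; b \<in> carrier R; x \<in> carrier M\<rbrakk> \<Longrightarrow>
       (a \<oplus>\<^bsub>R\<^esub> b) \<odot>\<^bsub>M\<^esub> x = a \<odot>\<^bsub>M\<^esub> x \<oplus>\<^bsub>M\<^esub> b \<odot>\<^bsub>M\<^esub> x"
    and smult_r_distr:
      "\<lbrakk>a \<in> carrier R; x \<in> carrier M; y \<in> carrier M\<rbrakk> \<Longrightarrow>
       a \<odot>\<^bsub>M\<^esub> (x \<oplus>\<^bsub>M\<^esub> y) = a \<odot>\<^bsub>M\<^esub> x \<oplus>\<^bsub>M\<^esub> a \<odot>\<^bsub>M\<^esub> y"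
    and smult_assoc:
      "\<lbrakk>a \<in> carrier R; b \<in> carrier R; x \<in> carrier M\<rbrakk> \<Longrightarrow>
       (a \<otimes>\<^bsub>R\<^esub> b) \<odot>\<^bsub>M\<^esub> x = a \<odot>\<^bsub>M\<^esub> (b \<odot>\<^bsub>M\<^esub> x)"
    and smult_one:
      "x \<in> carrier M \<Longrightarrow> \<one>\<^bsub>R\<^esub> \<odot>\<^bsub>M\<^esub> x = x"

record ('a, 'b) graded_module = "('a, 'b) module" +
  mcomp :: "int \<Rightarrow> 'b set"

text \<open>The degree \<open>n\<close> component as a vector space over the ground field.\<close>

definition comp_space ::
    "('a, 'k) graded_algebra \<Rightarrow> ('a, 'b) graded_module \<Rightarrow> int \<Rightarrow> ('k, 'b) module" where
  "comp_space A M n =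
    \<lparr>carrier = mcomp M n, mult = mult M, one = one M, zero = zero M, add = add M,
     smult = (\<lambda>c x. scalar A c \<odot>\<^bsub>M\<^esub> x)\<rparr>"

definition comp_dim ::
    "('a, 'k::field) graded_algebra \<Rightarrow> ('a, 'b) graded_module \<Rightarrow> int \<Rightarrow> nat" where
  "comp_dim A M n = vectorspace.dim class_ring (comp_space A M n)"

text \<open>
  Graded modules are \<open>\<int>\<close>-graded (the module is the internal direct sum of its components) and have
  finite-dimensional homogeneous components.
\<close>

locale graded_left_module = left_module A M
  for A :: "('a, 'k::field) graded_algebra" (structure)
    and M :: "('a, 'b) graded_module" (structure) +
  assumes comp_subgroup: "\<And>n. additive_subgroup (mcomp M n) M"
    and comp_smult:
      "\<And>i n a x. \<lbrakk>a \<in> acomp A i; x \<in> mcomp M n\<rbrakk> \<Longrightarrow> a \<odot>\<^bsub>M\<^esub> x \<in> mcomp M (i + n)"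
    and comp_direct_sum:
      "\<And>x. x \<in> carrier M \<Longrightarrow>
        \<exists>!c. (\<forall>n. c n \<in> mcomp M n) \<and> finite {n. c n \<noteq> \<zero>\<^bsub>M\<^esub>} \<and>
             x = (\<Oplus>\<^bsub>M\<^esub>n\<in>{n. c n \<noteq> \<zero>\<^bsub>M\<^esub>}. c n)"
    and comp_fin_dim: "\<And>n. vectorspace.fin_dim (class_ring :: 'k ring) (comp_space A M n)"

text \<open>Morphisms of graded modules are homogeneous of degree \<open>0\<close>.\<close>

definition graded_hom ::
    "('a, 'k) graded_algebra \<Rightarrow> ('a, 'b) graded_module \<Rightarrow> ('a, 'c) graded_module \<Rightarrow>
     ('b \<Rightarrow> 'c) set" where
  "graded_hom A M N =
    {f \<in> carrier M \<rightarrow> carrier N.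
      (\<forall>x\<in>carrier M. \<forall>y\<in>carrier M. f (x \<oplus>\<^bsub>M\<^esub> y) = f x \<oplus>\<^bsub>N\<^esub> f y) \<and>
      (\<forall>a\<in>carrier A. \<forall>x\<in>carrier M. f (a \<odot>\<^bsub>M\<^esub> x) = a \<odot>\<^bsub>N\<^esub> f x) \<and>
      (\<forall>n. f ` mcomp M n \<subseteq> mcomp N n)}"

text \<open>\<open>shift i M\<close> is \<open>M\<langle>i\<rangle>\<close>, so \<open>M\<langle>i\<rangle>\<^sub>n = M\<^sub>n\<^sub>-\<^sub>i\<close>.\<close>

definition shift :: "int \<Rightarrow> ('a, 'b) graded_module \<Rightarrow> ('a, 'b) graded_module" where
  "shift i M = M\<lparr>mcomp := (\<lambda>n. mcomp M (n - i))\<rparr>"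

definition direct_sum ::
    "('a, 'b) graded_module list \<Rightarrow> ('a, nat \<Rightarrow> 'b) graded_module" where
  "direct_sum Ms =
    (let J = {..<length Ms} in
    \<lparr>carrier = (\<Pi>\<^sub>E j\<in>J. carrier (Ms ! j)), mult = undefined, one = undefined,
     zero = (\<lambda>j\<in>J. \<zero>\<^bsub>Ms ! j\<^esub>),
     add = (\<lambda>f g. \<lambda>j\<in>J. f j \<oplus>\<^bsub>Ms ! j\<^esub> g j),
     smult = (\<lambda>a f. \<lambda>j\<in>J. a \<odot>\<^bsub>Ms ! j\<^esub> f j),
     mcomp = (\<lambda>n. \<Pi>\<^sub>E j\<in>J. mcomp (Ms ! j) n)\<rparr>)"

text \<open>The left ideal \<open>A e\<close> and the right ideal \<open>e A\<close> of an idempotent \<open>e\<close>.\<close>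

definition left_ideal :: "('a, 'k) graded_algebra \<Rightarrow> 'a \<Rightarrow> 'a set" where
  "left_ideal A e = {a \<otimes>\<^bsub>A\<^esub> e | a. a \<in> carrier A}"

definition right_ideal :: "('a, 'k) graded_algebra \<Rightarrow> 'a \<Rightarrow> 'a set" where
  "right_ideal A e = {e \<otimes>\<^bsub>A\<^esub> a | a. a \<in> carrier A}"

definition graded_projective ::
    "('a, 'k) graded_algebra \<Rightarrow> 'a \<Rightarrow> ('a, 'a) graded_module" where
  "graded_projective A e =
    \<lparr>carrier = left_ideal A e, mult = mult A, one = one A, zero = zero A, add = add A,
     smult = mult A, mcomp = (\<lambda>n. left_ideal A e \<inter> acomp A n)\<rparr>"

text \<open>
  The graded dual of the right module \<open>e A\<close>: linear functionals on \<open>e A\<close> that vanish on all but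
  finitely many homogeneous components, with the left action \<open>(a \<phi>)(u) = \<phi>(u a)\<close>. A functional
  supported on the component of degree \<open>m\<close> is homogeneous of degree \<open>-m\<close>. For \<open>e = e\<^sub>x\<close> in a bound
  quiver algebra, the part of \<open>e A\<close> at a vertex \<open>y\<close> is \<open>e\<^sub>x A e\<^sub>y\<close>, the span of the nonzero paths
  from \<open>y\<close> to \<open>x\<close>, and \<open>I\<^sub>x(y) = e\<^sub>y I\<^sub>x\<close> is its graded dual.
\<close>

definition graded_injective ::
    "('a, 'k::field) graded_algebra \<Rightarrow> 'a \<Rightarrow> ('a, 'a \<Rightarrow> 'k) graded_module" where
  "graded_injective A e =
    (let D = right_ideal A e;
         C = {\<phi> \<in> extensional D.
           (\<forall>u\<in>D. \<forall>v\<in>D. \<phi> (u \<oplus>\<^bsub>A\<^esub> v) = \<phi> u + \<phi> v) \<and>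
           (\<forall>c. \<forall>u\<in>D. \<phi> (scalar A c \<otimes>\<^bsub>A\<^esub> u) = c * \<phi> u) \<and>
           finite {m. \<exists>u \<in> D \<inter> acomp A m. \<phi> u \<noteq> 0}}
    in
    \<lparr>carrier = C, mult = undefined, one = undefined,
     zero = (\<lambda>u\<in>D. 0),
     add = (\<lambda>\<phi> \<psi>. \<lambda>u\<in>D. \<phi> u + \<psi> u),
     smult = (\<lambda>a \<phi>. \<lambda>u\<in>D. \<phi> (u \<otimes>\<^bsub>A\<^esub> a)),
     mcomp = (\<lambda>n. {\<phi> \<in> C. \<forall>m. m \<noteq> - n \<longrightarrow> (\<forall>u \<in> D \<inter> acomp A m. \<phi> u = 0)})\<rparr>)"


section \<open>Finitely presented and finitely copresented modules over the quadratic dual\<close>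

text \<open>\<open>dual_proj_sum Q I xs\<close> is the direct sum of the modules \<open>P\<^sup>!\<^sub>x\<langle>i\<rangle>\<close> over the list of pairs
  \<open>(x, i)\<close> in \<open>xs\<close>, and \<open>dual_inj_sum Q I xs\<close> that of the modules \<open>I\<^sup>!\<^sub>x\<langle>i\<rangle>\<close>.\<close>

definition dual_proj_sum ::
    "('v, 'a) pre_digraph \<Rightarrow> (('v, 'a) path \<Rightarrow> 'k::field) set \<Rightarrow> ('v \<times> int) list \<Rightarrow>
     ((('v, 'a) path \<Rightarrow> 'k) set, nat \<Rightarrow> (('v, 'a) path \<Rightarrow> 'k) set) graded_module" where
  "dual_proj_sum Q I xs =
    direct_sum (map (\<lambda>(x, i). shift i (graded_projective (quadratic_dual Q I) (dual_idem Q I x))) xs)"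

definition dual_inj_sum ::
    "('v, 'a) pre_digraph \<Rightarrow> (('v, 'a) path \<Rightarrow> 'k::field) set \<Rightarrow> ('v \<times> int) list \<Rightarrow>
     ((('v, 'a) path \<Rightarrow> 'k) set, nat \<Rightarrow> (('v, 'a) path \<Rightarrow> 'k) set \<Rightarrow> 'k) graded_module" where
  "dual_inj_sum Q I xs =
    direct_sum (map (\<lambda>(x, i). shift i (graded_injective (quadratic_dual Q I) (dual_idem Q I x))) xs)"

definition finitely_presented ::
    "('v, 'a) pre_digraph \<Rightarrow> (('v, 'a) path \<Rightarrow> 'k::field) set \<Rightarrow>
     ((('v, 'a) path \<Rightarrow> 'k) set, 'b) graded_module \<Rightarrow> bool" where
  "finitely_presented Q I M \<longleftrightarrow>
    (\<exists>xs ys d \<epsilon>.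
      set (map fst xs) \<subseteq> verts Q \<and> set (map fst ys) \<subseteq> verts Q \<and>
      d \<in> graded_hom (quadratic_dual Q I) (dual_proj_sum Q I xs) (dual_proj_sum Q I ys) \<and>
      \<epsilon> \<in> graded_hom (quadratic_dual Q I) (dual_proj_sum Q I ys) M \<and>
      d ` carrier (dual_proj_sum Q I xs) = {p \<in> carrier (dual_proj_sum Q I ys). \<epsilon> p = \<zero>\<^bsub>M\<^esub>} \<and>
      \<epsilon> ` carrier (dual_proj_sum Q I ys) = carrier M)"

definition finitely_copresented ::
    "('v, 'a) pre_digraph \<Rightarrow> (('v, 'a) path \<Rightarrow> 'k::field) set \<Rightarrow>
     ((('v, 'a) path \<Rightarrow> 'k) set, 'b) graded_module \<Rightarrow> bool" where
  "finitely_copresented Q I M \<longleftrightarrow>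
    (\<exists>xs ys \<iota> d.
      set (map fst xs) \<subseteq> verts Q \<and> set (map fst ys) \<subseteq> verts Q \<and>
      \<iota> \<in> graded_hom (quadratic_dual Q I) M (dual_inj_sum Q I xs) \<and>
      d \<in> graded_hom (quadratic_dual Q I) (dual_inj_sum Q I xs) (dual_inj_sum Q I ys) \<and>
      inj_on \<iota> (carrier M) \<and>
      \<iota> ` carrier M =
        {p \<in> carrier (dual_inj_sum Q I xs). d p = \<zero>\<^bsub>dual_inj_sum Q I ys\<^esub>})"


section \<open>Rational formal series\<close>

definition eval_fls :: "rat poly \<Rightarrow> rat fls \<Rightarrow> rat fls" where
  "eval_fls p T = poly (map_poly fls_const p) T"

text \<open>
  The series \<open>\<Sum>\<^sub>n h(n) t\<^sup>n\<close> is a formal Laurent series in \<open>t\<close> (in particular \<open>h\<close> vanishes in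
  sufficiently small degrees) and the expansion of a rational function \<open>p(t) / q(t)\<close>.
\<close>

definition rational_in_t :: "(int \<Rightarrow> nat) \<Rightarrow> bool" where
  "rational_in_t h \<longleftrightarrow>
    (\<exists>F p q. (\<forall>n. fls_nth F n = of_nat (h n)) \<and> q \<noteq> 0 \<and> F = eval_fls p fls_X / eval_fls q fls_X)"

text \<open>
  The series \<open>\<Sum>\<^sub>n h(n) t\<^sup>n\<close> is a formal Laurent series in \<open>s = t\<^sup>-\<^sup>1\<close> (in particular \<open>h\<close> vanishes in
  sufficiently large degrees) and the expansion of a rational function \<open>p(t) / q(t)\<close>. Here the
  library's indeterminate \<open>fls_X\<close> plays the role of \<open>s\<close>, so that \<open>t\<close> is \<open>fls_X_inv\<close> and the
  coefficient of \<open>s\<^sup>n\<close> is \<open>h(-n)\<close>.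
\<close>

definition rational_in_t_inverse :: "(int \<Rightarrow> nat) \<Rightarrow> bool" where
  "rational_in_t_inverse h \<longleftrightarrow>
    (\<exists>F p q. (\<forall>n. fls_nth F n = of_nat (h (- n))) \<and> q \<noteq> 0 \<and>
             F = eval_fls p fls_X_inv / eval_fls q fls_X_inv)"

end

theory Submission
  imports Defs "HOL-Library.Function_Algebras"
begin

text \<open>
  Write \<open>A\<close> for the quadratic dual. It is the path algebra of a finite quiver modulo paths of length
  two, the relations, so the good paths, those without a relation as a subpath, form a basis. Whether
  a nontrivial good path can be prolonged by an arc at one of its ends depends only on the arc at that
  end. This locality makes Hilbert functions satisfy a linear recurrence with constant coefficients.

  Let \<open>P\<^sup>1 \<rightarrow> P\<^sup>0 \<rightarrow> M \<rightarrow> 0\<close> be a presentation and \<open>N\<close> the image of \<open>P\<^sup>1\<close>. Beyond the degrees of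
  the generators, \<open>N\<close> in degree \<open>m + 1\<close> is the sum of the spaces \<open>b N\<^sub>m\<close> over all arcs \<open>b\<close>. The sum is
  direct, because \<open>b N\<^sub>m\<close> lives on the paths with last arc \<open>b\<close>; hence \<open>N\<close> splits in high degrees
  according to the last arc. Multiplication by \<open>b\<close> kills the parts for the last arcs \<open>c\<close> that
  \<open>b\<close> cannot follow and is injective on the sum of the other parts. So the dimensions \<open>D m b\<close> of the
  parts satisfy \<open>D (m + 1) b = (\<Sum>c. D m c)\<close>, summed over the arcs \<open>c\<close> that \<open>b\<close> can follow. The same
  holds for \<open>P\<^sup>0\<close>, and the Hilbert function of \<open>M\<close> is the difference.

  Let \<open>0 \<rightarrow> M \<rightarrow> I\<^sup>0 \<rightarrow> I\<^sup>1\<close> be a copresentation. In degrees so low that only nontrivial paths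
  contribute, an element of \<open>I\<^sup>0\<close> or \<open>I\<^sup>1\<close> is zero as soon as all arcs kill it. So an element of \<open>I\<^sup>0\<close>
  lies in \<open>M\<close> if and only if all its multiples by arcs do. This splits \<open>M\<close> according to the first arc,
  and gives the same recurrence in the direction of decreasing degrees.

  In coordinates with respect to the basis of paths both arguments concern subspaces \<open>V l\<close> of functions
  on words, each determined by the previous one through \<open>f \<in> V (Suc l)\<close> if and only if all functions
  \<open>w \<mapsto> f (b # w)\<close> are in \<open>V l\<close>; the first letter of a word is the arc at the end at which the
  action takes place. The recurrence for such subspaces is \<open>shift_recurrence\<close>, and
  \<open>image_recurrence\<close> and \<open>kernel_recurrence\<close> reduce the two cases to it. A first-order recurrence for
  vectors of fixed finite length implies a scalar linear recurrence (\<open>linear_recurrence_exists\<close>),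
  hence a rational generating series. The remaining parts provide the coordinates:
  the dual ideal consists of the functions that vanish on good paths
  (\<open>genideal_quadratic_monomials\<close>), and \<open>coordinates_projective\<close> and \<open>coordinates_injective\<close> identify
  the modules \<open>P\<^sup>!\<^sub>x\<close> and \<open>I\<^sup>!\<^sub>x\<close> with spaces of functions on words.
\<close>


section \<open>Spaces of finitely supported functions\<close>

definition fscale :: "'k::field \<Rightarrow> ('x \<Rightarrow> 'k) \<Rightarrow> 'x \<Rightarrow> 'k" where
  "fscale c f = (\<lambda>x. c * f x)"

interpretation fvs: vector_space "fscale :: 'k::field \<Rightarrow> ('x \<Rightarrow> 'k) \<Rightarrow> 'x \<Rightarrow> 'k"
  by unfold_locales (auto simp: fscale_def fun_eq_iff algebra_simps)

lemma fscale_apply [simp]: "fscale c f x = c * f x"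
  by (simp add: fscale_def)

definition finfuns :: "'x set \<Rightarrow> ('x \<Rightarrow> 'k::zero) set" where
  "finfuns X = {f. finite {x. f x \<noteq> 0} \<and> {x. f x \<noteq> 0} \<subseteq> X}"

definition unit_fun :: "'x \<Rightarrow> 'x \<Rightarrow> 'k::zero_neq_one" where
  "unit_fun x = (\<lambda>y. if y = x then 1 else 0)"

lemma sum_fun_apply: "(\<Sum>i\<in>A. f i) x = (\<Sum>i\<in>A. f i x)"
  for f :: "'i \<Rightarrow> 'x \<Rightarrow> 'k::comm_monoid_add"
  by (induct A rule: infinite_finite_induct) auto

lemma finfuns_zero: "0 \<in> finfuns X"
  by (auto simp: finfuns_def)

lemma finfuns_outside: "f \<in> finfuns X \<Longrightarrow> x \<notin> X \<Longrightarrow> f x = 0"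
  by (auto simp: finfuns_def)

lemma finfuns_add: "f \<in> finfuns X \<Longrightarrow> g \<in> finfuns X \<Longrightarrow> f + g \<in> finfuns X"
  for f g :: "'x \<Rightarrow> 'k::monoid_add"
proof -
  assume "f \<in> finfuns X" "g \<in> finfuns X"
  moreover have "{x. (f + g) x \<noteq> 0} \<subseteq> {x. f x \<noteq> 0} \<union> {x. g x \<noteq> 0}"
    by auto
  ultimately show ?thesis
    unfolding finfuns_def by (blast intro: finite_subset)
qed

lemma finfuns_fscale: "f \<in> finfuns X \<Longrightarrow> fscale c f \<in> finfuns X"
  unfolding finfuns_def by (auto intro: finite_subset[of _ "{x. f x \<noteq> 0}"])

lemma subspace_finfuns: "fvs.subspace (finfuns X)"
  by (auto intro!: fvs.subspaceI finfuns_zero finfuns_add finfuns_fscale)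

lemma finfuns_mono: "X \<subseteq> Y \<Longrightarrow> finfuns X \<subseteq> finfuns Y"
  by (auto simp: finfuns_def)

lemma finfuns_sum: "(\<And>i. i \<in> I \<Longrightarrow> f i \<in> finfuns X) \<Longrightarrow> (\<Sum>i\<in>I. f i) \<in> finfuns X"
  for f :: "'i \<Rightarrow> 'x \<Rightarrow> 'k::field"
  by (rule fvs.subspace_sum[OF subspace_finfuns])

lemma finfuns_eq_sum:
  assumes "f \<in> finfuns X"
  shows "f = (\<Sum>x\<in>{x. f x \<noteq> 0}. fscale (f x) (unit_fun x))"
proof
  fix y
  have fin: "finite {x. f x \<noteq> 0}"
    using assms by (simp add: finfuns_def)
  have "(\<Sum>x\<in>{x. f x \<noteq> 0}. fscale (f x) (unit_fun x)) y =
      (\<Sum>x\<in>{x. f x \<noteq> 0}. if x = y then f y else 0)"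
    unfolding sum_fun_apply by (rule sum.cong) (auto simp: unit_fun_def)
  also have "\<dots> = f y"
    using fin by (simp add: sum.delta)
  finally show "f y = (\<Sum>x\<in>{x. f x \<noteq> 0}. fscale (f x) (unit_fun x)) y" ..
qed

lemma finfuns_subset_span:
  fixes X :: "'x set"
  shows "finfuns X \<subseteq> (fvs.span (unit_fun ` X) :: ('x \<Rightarrow> 'k::field) set)"
proof
  fix f :: "'x \<Rightarrow> 'k"
  assume f: "f \<in> finfuns X"
  have "(\<Sum>x\<in>{x. f x \<noteq> 0}. fscale (f x) (unit_fun x)) \<in> fvs.span (unit_fun ` X)"
    using f by (intro fvs.span_sum fvs.span_scale fvs.span_base) (auto simp: finfuns_def)
  with finfuns_eq_sum[OF f] show "f \<in> fvs.span (unit_fun ` X)"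
    by simp
qed

lemma dim_eq_0: "S \<subseteq> {0} \<Longrightarrow> fvs.dim S = 0"
  using fvs.dim_le_card[of S "{}"] by simp

lemma finite_independent_finfuns:
  assumes "finite X" "B \<subseteq> finfuns X" "fvs.independent B"
  shows "finite B"
  using fvs.independent_span_bound[of "unit_fun ` X" B] finfuns_subset_span[of X] assms by auto

definition keep :: "('x \<Rightarrow> bool) \<Rightarrow> ('x \<Rightarrow> 'k::zero) \<Rightarrow> 'x \<Rightarrow> 'k" where
  "keep P f = (\<lambda>x. if P x then f x else 0)"

lemma keep_apply [simp]: "keep P f x = (if P x then f x else 0)"
  by (simp add: keep_def)

lemma keep_zero: "keep P 0 = 0"
  by (simp add: keep_def fun_eq_iff)

lemma keep_add: "keep P (f + g) = keep P f + keep P g" for f g :: "'x \<Rightarrow> 'k::monoid_add"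
  by (auto simp: keep_def fun_eq_iff)

lemma keep_fscale: "keep P (fscale c f) = fscale c (keep P f)"
  by (auto simp: keep_def fun_eq_iff)

lemma keep_sum: "keep P (\<Sum>i\<in>A. f i) = (\<Sum>i\<in>A. keep P (f i))"
  for f :: "'i \<Rightarrow> 'x \<Rightarrow> 'k::comm_monoid_add"
  by (rule ext) (simp add: sum_fun_apply)

lemma keep_finfuns: "f \<in> finfuns X \<Longrightarrow> keep P f \<in> finfuns {x \<in> X. P x}"
  by (auto simp: finfuns_def intro: finite_subset[of _ "{x. f x \<noteq> 0}"])

lemma finfuns_keep: "f \<in> finfuns X \<Longrightarrow> keep P f \<in> finfuns X"
  by (auto simp: finfuns_def split: if_splits intro: finite_subset[of _ "{x. f x \<noteq> 0}"])

lemma sum_keep_partition: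
  fixes f :: "'x \<Rightarrow> 'k::comm_monoid_add"
  assumes "finite B" and "\<And>x. f x \<noteq> 0 \<Longrightarrow> c x \<in> B"
  shows "(\<Sum>b\<in>B. keep (\<lambda>x. c x = b) f) = f"
proof
  fix x
  show "(\<Sum>b\<in>B. keep (\<lambda>x. c x = b) f) x = f x"
    using assms by (cases "f x = 0") (auto simp: sum_fun_apply keep_def)
qed

lemma subspace_keep_part:
  assumes "fvs.subspace V"
  shows "fvs.subspace {f \<in> V. keep P f = f}"
proof (rule fvs.subspaceI)
  show "0 \<in> {f \<in> V. keep P f = f}"
    using fvs.subspace_0[OF assms] by (auto simp: fun_eq_iff)
qed (auto simp: keep_add keep_fscale fvs.subspace_add[OF assms] fvs.subspace_scale[OF assms])

text \<open>
  Restriction to the classes of a finite partition of the domain preserves \<open>V\<close>, so \<open>V\<close> is the direct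
  sum of its parts. Bases of the parts are disjoint because their members have disjoint supports.
\<close>

lemma dim_partition:
  assumes X: "finite X" and B: "finite B" and V: "fvs.subspace V" "V \<subseteq> finfuns X"
    and c: "\<And>x. x \<in> X \<Longrightarrow> c x \<in> B"
    and keep_V: "\<And>f b. f \<in> V \<Longrightarrow> b \<in> B \<Longrightarrow> keep (\<lambda>x. c x = b) f \<in> V"
  shows "fvs.dim V = (\<Sum>b\<in>B. fvs.dim {f \<in> V. keep (\<lambda>x. c x = b) f = f})"
proof -
  define W where "W b = {f \<in> V. keep (\<lambda>x. c x = b) f = f}" for b
  define S where "S b = (SOME S. S \<subseteq> W b \<and> fvs.independent S \<and> W b \<subseteq> fvs.span S \<and>
      card S = fvs.dim (W b))" for b
  have S': "S b \<subseteq> W b \<and> fvs.independent (S b) \<and> W b \<subseteq> fvs.span (S b) \<and>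
      card (S b) = fvs.dim (W b)" for b
    unfolding S_def by (rule someI_ex, rule fvs.basis_exists[of "W b"]) blast
  then have S: "\<And>b. S b \<subseteq> W b" "\<And>b. fvs.independent (S b)" "\<And>b. W b \<subseteq> fvs.span (S b)"
      "\<And>b. card (S b) = fvs.dim (W b)"
    by simp_all
  have fin: "finite (S b)" for b
  proof (rule finite_independent_finfuns[OF X _ S(2)])
    show "S b \<subseteq> finfuns X"
      using S(1)[of b] V(2) unfolding W_def by blast
  qed
  have keep_W: "keep (\<lambda>x. c x = b') v = (if b = b' then v else 0)" if "v \<in> W b" for v b b'
  proof -
    have v: "keep (\<lambda>x. c x = b) v = v"
      using that by (simp add: W_def)
    have "keep (\<lambda>x. c x = b') (keep (\<lambda>x. c x = b) v) = (if b = b' then keep (\<lambda>x. c x = b) v else 0)"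
      by (auto simp: fun_eq_iff)
    then show ?thesis
      by (simp only: v)
  qed
  have nz: "v \<noteq> 0" if "v \<in> S b" for v b
    using that S(2)[of b] fvs.dependent_zero[of "S b"] by (metis (no_types))
  have disj: "S b \<inter> S b' = {}" if "b \<noteq> b'" for b b'
  proof (rule equals0I)
    fix v assume "v \<in> S b \<inter> S b'"
    then have "v \<in> W b" "v \<in> W b'" "v \<noteq> 0"
      using S(1) nz by blast+
    then show False
      using keep_W[of v b b'] keep_W[of v b' b'] that by simp
  qed
  have indep: "fvs.independent (\<Union>b\<in>B. S b)"
  proof (rule fvs.independent_if_scalars_zero)
    show "finite (\<Union>b\<in>B. S b)"
      using B fin by auto
    fix u v
    assume sum0: "(\<Sum>v\<in>(\<Union>b\<in>B. S b). fscale (u v) v) = 0" and v: "v \<in> (\<Union>b\<in>B. S b)"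
    from v obtain b where b: "b \<in> B" "v \<in> S b"
      by blast
    have "(\<Sum>b'\<in>B. \<Sum>w\<in>S b'. fscale (u w) w) = 0"
      using sum0 sum.UNION_disjoint[of B S "\<lambda>v. fscale (u v) v"] B fin disj by simp
    then have "0 = keep (\<lambda>x. c x = b) (\<Sum>b'\<in>B. \<Sum>w\<in>S b'. fscale (u w) w)"
      by (simp only: keep_zero)
    also have "\<dots> = (\<Sum>b'\<in>B. \<Sum>w\<in>S b'. fscale (u w) (keep (\<lambda>x. c x = b) w))"
      by (simp add: keep_sum keep_fscale)
    also have "\<dots> = (\<Sum>b'\<in>B. if b' = b then \<Sum>w\<in>S b. fscale (u w) w else 0)"
    proof (rule sum.cong[OF refl])
      fix b'
      have "(\<Sum>w\<in>S b'. fscale (u w) (keep (\<lambda>x. c x = b) w)) =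
          (\<Sum>w\<in>S b'. if b' = b then fscale (u w) w else 0)"
      proof (rule sum.cong[OF refl])
        fix w assume "w \<in> S b'"
        then have "w \<in> W b'"
          using S(1) by blast
        then show "fscale (u w) (keep (\<lambda>x. c x = b) w) = (if b' = b then fscale (u w) w else 0)"
          by (simp only: keep_W[of w b' b]) simp
      qed
      then show "(\<Sum>w\<in>S b'. fscale (u w) (keep (\<lambda>x. c x = b) w)) =
          (if b' = b then \<Sum>w\<in>S b. fscale (u w) w else 0)"
        by auto
    qed
    also have "\<dots> = (\<Sum>w\<in>S b. fscale (u w) w)"
      using B b by simp
    finally have "(\<Sum>w\<in>S b. fscale (u w) w) = 0" ..
    with S(2)[of b] fin[of b] b(2) show "u v = 0"
      unfolding fvs.independent_explicit_finite_subsets by blast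
  qed
  have span: "V \<subseteq> fvs.span (\<Union>b\<in>B. S b)"
  proof
    fix f assume f: "f \<in> V"
    have "keep (\<lambda>x. c x = b) f \<in> fvs.span (\<Union>b\<in>B. S b)" if "b \<in> B" for b
    proof -
      have "keep (\<lambda>x. c x = b) f \<in> W b"
        using keep_V[OF f that] by (auto simp: W_def keep_def fun_eq_iff)
      with S(3) have "keep (\<lambda>x. c x = b) f \<in> fvs.span (S b)"
        by blast
      then show ?thesis
        using fvs.span_mono[of "S b" "\<Union>b\<in>B. S b"] that by blast
    qed
    then have "(\<Sum>b\<in>B. keep (\<lambda>x. c x = b) f) \<in> fvs.span (\<Union>b\<in>B. S b)"
      by (rule fvs.span_sum)
    moreover have "(\<Sum>b\<in>B. keep (\<lambda>x. c x = b) f) = f"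
    proof (rule sum_keep_partition[OF B])
      fix x assume "f x \<noteq> 0"
      then have "x \<in> X"
        using f V(2) unfolding finfuns_def by blast
      then show "c x \<in> B"
        by (rule c)
    qed
    ultimately show "f \<in> fvs.span (\<Union>b\<in>B. S b)"
      by simp
  qed
  have "fvs.dim V = card (\<Union>b\<in>B. S b)"
  proof (rule fvs.dim_unique[OF _ span indep refl])
    show "(\<Union>b\<in>B. S b) \<subseteq> V"
      using S(1) unfolding W_def by blast
  qed
  also have "\<dots> = (\<Sum>b\<in>B. card (S b))"
    using B fin disj by (intro card_UN_disjoint) auto
  finally show ?thesis
    by (simp add: S(4) W_def)
qed

lemma dim_image_eq_inj:
  assumes T: "Vector_Spaces.linear fscale fscale T" and inj: "inj_on T V" and V: "fvs.subspace V"
  shows "fvs.dim (T ` V) = fvs.dim V"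
proof -
  interpret T: Vector_Spaces.linear fscale fscale T by (rule T)
  obtain B where B: "B \<subseteq> V" "fvs.independent B" "V \<subseteq> fvs.span B" "card B = fvs.dim V"
    using fvs.basis_exists[of V] by blast
  have sB: "fvs.span B = V"
    using B V by (simp add: fvs.span_subspace)
  have "fvs.independent (T ` B)"
    using T.independent_injective_image[OF B(2)] inj sB by simp
  moreover have "T ` V \<subseteq> fvs.span (T ` B)"
    using T.span_image[of B] sB by simp
  moreover have "card (T ` B) = fvs.dim V"
    using B(1,4) inj by (metis card_image inj_on_subset)
  ultimately show ?thesis
    using B(1) by (intro fvs.dim_unique) auto
qed

definition fun_space :: "('x \<Rightarrow> 'k::field) set \<Rightarrow> ('k, 'x \<Rightarrow> 'k) module" where
  "fun_space S = \<lparr>carrier = S, mult = undefined, one = undefined, zero = 0, add = (+), smult = fscale\<rparr>"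

lemma vectorspace_fun_space:
  assumes "fvs.subspace S"
  shows "vectorspace class_ring (fun_space S)"
proof (rule vs_criteria)
  show "\<forall>v\<in>carrier (fun_space S). \<exists>neg_v\<in>carrier (fun_space S).
      v \<oplus>\<^bsub>fun_space S\<^esub> neg_v = \<zero>\<^bsub>fun_space S\<^esub>"
    using fvs.subspace_neg[OF assms] by (auto simp: fun_space_def intro!: bexI[of _ "- _"])
qed (auto simp: fun_space_def class_field fvs.subspace_0[OF assms] fvs.subspace_add[OF assms]
      fvs.subspace_scale[OF assms] add_ac fvs.scale_right_distrib fvs.scale_left_distrib)

text \<open>
  The dimension used for components of graded modules is defined on records with a carrier, whereas
  subspaces of function spaces are sets in a type with global operations. A basis in the second sense is
  one in the first.
\<close>

lemma dim_fun_space: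
  assumes S: "fvs.subspace S" and X: "finite X" "S \<subseteq> finfuns X"
  shows "vectorspace.dim class_ring (fun_space S) = fvs.dim S"
    and "vectorspace.fin_dim class_ring (fun_space S)"
proof -
  interpret V: vectorspace class_ring "fun_space S"
    by (rule vectorspace_fun_space[OF S])
  obtain B where B: "B \<subseteq> S" "fvs.independent B" "S \<subseteq> fvs.span B" "card B = fvs.dim S"
    using fvs.basis_exists[of S] by blast
  have fin: "finite B"
    using finite_independent_finfuns[OF X(1) _ B(2)] B(1) X(2) by auto
  have carr: "carrier (fun_space S) = S"
    by (simp add: fun_space_def)
  have finsum: "finsum (fun_space S) g A = sum g A" if "finite A" "g \<in> A \<rightarrow> S" for g and A :: "('x \<Rightarrow> 'k) set"
    using that
  proof (induct A rule: finite_induct)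
    case (insert a A)
    then have "finsum (fun_space S) g (insert a A) = g a \<oplus>\<^bsub>fun_space S\<^esub> finsum (fun_space S) g A"
      by (intro V.finsum_insert) (auto simp: carr)
    with insert show ?case
      by (simp add: fun_space_def)
  next
    case empty
    show ?case
      by (subst V.finsum_empty) (simp add: fun_space_def)
  qed
  have lincomb: "V.lincomb a B = (\<Sum>v\<in>B. fscale (a v) v)" for a
    unfolding V.lincomb_def using B(1) fvs.subspace_scale[OF S] fin
    by (subst finsum) (auto simp: fun_space_def)
  have "V.gen_set B"
  proof
    show "V.span B \<subseteq> carrier (fun_space S)"
      using B(1) V.span_is_subset2[of B] carr by auto
    show "carrier (fun_space S) \<subseteq> V.span B"
    proof
      fix f assume "f \<in> carrier (fun_space S)"
      then have "f \<in> fvs.span B"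
        using B(3) carr by auto
      then obtain a where "f = (\<Sum>v\<in>B. fscale (a v) v)"
        using fvs.span_finite[OF fin] by auto
      then show "f \<in> V.span B"
        using V.finite_span[OF fin] B(1) carr lincomb by auto
    qed
  qed
  moreover have "V.lin_indpt B"
  proof (rule V.finite_lin_indpt2[OF fin])
    show "B \<subseteq> carrier (fun_space S)"
      using B(1) carr by simp
    fix a assume "V.lincomb a B = \<zero>\<^bsub>fun_space S\<^esub>"
    then have "(\<Sum>v\<in>B. fscale (a v) v) = 0"
      by (simp add: lincomb) (simp add: fun_space_def)
    moreover have "\<forall>u. (\<Sum>v\<in>B. fscale (u v) v) = 0 \<longrightarrow> (\<forall>v\<in>B. u v = 0)"
      using B(2) fin unfolding fvs.independent_explicit_finite_subsets by blast
    ultimately show "\<forall>v\<in>B. a v = \<zero>\<^bsub>class_ring\<^esub>"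
      by simp
  qed
  ultimately have "V.basis B"
    using B(1) carr by (auto simp: V.basis_def)
  then show "V.dim = fvs.dim S" "V.fin_dim"
    using V.dim_basis[OF fin] B(4) fin by (auto simp: V.basis_def V.fin_dim_def)
qed

text \<open>
  The rank-nullity theorem, in the form that computes the dimension of a quotient of a function
  space. All dimensions of components of \<open>M\<close> are obtained from it.
\<close>

lemma dim_surj_fun_space:
  assumes V: "vectorspace class_ring V"
    and S: "fvs.subspace S" and X: "finite X" "S \<subseteq> finfuns X"
    and im: "e ` S = carrier V"
    and add: "\<And>f g. f \<in> S \<Longrightarrow> g \<in> S \<Longrightarrow> e (f + g) = e f \<oplus>\<^bsub>V\<^esub> e g"
    and smult: "\<And>c f. f \<in> S \<Longrightarrow> e (fscale c f) = c \<odot>\<^bsub>V\<^esub> e f"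
  shows "vectorspace.dim class_ring V + fvs.dim {f \<in> S. e f = \<zero>\<^bsub>V\<^esub>} = fvs.dim S"
proof -
  interpret S: vectorspace class_ring "fun_space S"
    by (rule vectorspace_fun_space[OF S])
  interpret V: vectorspace class_ring V
    by (rule V)
  interpret e: linear_map class_ring "fun_space S" V e
  proof unfold_locales
    show "e \<in> LinearCombinations.module_hom class_ring (fun_space S) V"
      using im add smult by (auto simp: LinearCombinations.module_hom_def fun_space_def)
  qed
  have im': "e.im = carrier V"
    using im unfolding e.im_def by (simp add: fun_space_def)
  have ker: "e.ker = {f \<in> S. e f = \<zero>\<^bsub>V\<^esub>}"
    unfolding e.ker_def by (simp add: fun_space_def)
  have eq: "(fun_space S)\<lparr>carrier := e.ker\<rparr> = fun_space e.ker"
    by (simp add: fun_space_def)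
  have sub: "fvs.subspace e.ker"
  proof (rule fvs.subspaceI)
    show "0 \<in> e.ker"
      using e.f0_is_0 S.M.zero_closed unfolding e.ker_def by (simp add: fun_space_def)
    show "x + y \<in> e.ker" if "x \<in> e.ker" "y \<in> e.ker" for x y
      using that add unfolding ker by (auto simp: fvs.subspace_add[OF S])
    show "fscale c x \<in> e.ker" if "x \<in> e.ker" for c x
      using that smult unfolding ker by (auto simp: fvs.subspace_scale[OF S])
  qed
  have "vectorspace.dim class_ring (V\<lparr>carrier := e.im\<rparr>) +
      vectorspace.dim class_ring ((fun_space S)\<lparr>carrier := e.ker\<rparr>) = S.dim"
    by (rule e.rank_nullity) (rule dim_fun_space(2)[OF S X])
  moreover have "V\<lparr>carrier := e.im\<rparr> = V"
    by (simp add: im')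
  moreover have "vectorspace.dim class_ring (fun_space e.ker) = fvs.dim e.ker"
    using X(2) ker by (intro dim_fun_space(1)[OF sub X(1)]) auto
  ultimately show ?thesis
    using dim_fun_space(1)[OF S X] eq ker by simp
qed

section \<open>Words and the shift recurrence\<close>

text \<open>
  Functions on words are indexed by pairs of the number of a summand and a word.
\<close>

definition after :: "'a \<Rightarrow> (nat \<times> 'a list \<Rightarrow> 'k) \<Rightarrow> nat \<times> 'a list \<Rightarrow> 'k" where
  "after b f = (\<lambda>(j, w). f (j, b # w))"

lemma after_apply [simp]: "after b f (j, w) = f (j, b # w)"
  by (simp add: after_def)

lemma after_add: "after b (f + g) = after b f + after b g"
  for f g :: "nat \<times> 'a list \<Rightarrow> 'k::monoid_add"
  by (auto simp: fun_eq_iff)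

lemma after_fscale: "after b (fscale c f) = fscale c (after b f)"
  by (auto simp: fun_eq_iff)

lemma linear_after: "Vector_Spaces.linear fscale fscale (after b)"
  by unfold_locales (auto simp: after_add after_fscale)

text \<open>
  The words stand for the good paths in the \<open>j\<close>-th summand of a module, with the arc at which arcs act
  as first letter. \<open>G b c\<close> expresses that \<open>b\<close> can be put before \<open>c\<close>.
\<close>

locale word_system =
  fixes B :: "'a set" and G :: "'a \<Rightarrow> 'a \<Rightarrow> bool" and J :: nat and X :: "nat \<Rightarrow> 'a list set"
  assumes finite_letters: "finite B"
    and letters: "\<And>j w. j < J \<Longrightarrow> w \<in> X j \<Longrightarrow> set w \<subseteq> B"
    and Cons_Cons_iff: "\<And>j b c w. j < J \<Longrightarrow> b # c # w \<in> X j \<longleftrightarrow> G b c \<and> c # w \<in> X j"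
    and tail_closed: "\<And>j b w. j < J \<Longrightarrow> b # w \<in> X j \<Longrightarrow> w \<in> X j"
begin

definition total :: "(nat \<times> 'a list) set" where
  "total = {(j, w). j < J \<and> w \<in> X j}"

definition slice :: "(nat \<Rightarrow> nat) \<Rightarrow> nat \<Rightarrow> (nat \<times> 'a list) set" where
  "slice s l = {(j, w) \<in> total. length w = l + s j}"

lemma finite_layer: "finite {(j, w) \<in> total. length w = g j}"
proof -
  have "{(j, w) \<in> total. length w = g j} \<subseteq> (SIGMA j:{..<J}. {w. set w \<subseteq> B \<and> length w = g j})"
    using letters by (auto simp: total_def)
  moreover have "finite (SIGMA j:{..<J}. {w. set w \<subseteq> B \<and> length w = g j})"
    by (intro finite_SigmaI finite_lists_length_eq finite_letters) simp
  ultimately show ?thesis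
    by (rule finite_subset)
qed

lemma finite_slice: "finite (slice s l)"
  unfolding slice_def by (rule finite_layer)

text \<open>
  The part of \<open>V (Suc l)\<close> supported on words with first letter \<open>b\<close> is mapped by \<open>after b\<close> bijectively
  onto the subspace of functions in \<open>V l\<close> supported on words whose first letter \<open>c\<close> satisfies
  \<open>G b c\<close>. Decomposing both sides by first letters gives the recurrence for the
  dimensions. The condition on \<open>s\<close> excludes the empty word, which has no first letter.
\<close>

lemma shift_recurrence:
  fixes V :: "nat \<Rightarrow> (nat \<times> 'a list \<Rightarrow> 'k::field) set"
  assumes s: "\<And>j. j < J \<Longrightarrow> s j \<ge> 1"
    and V: "\<And>l. fvs.subspace (V l)" "\<And>l. V l \<subseteq> finfuns (slice s l)"
    and V_Suc: "\<And>l f. f \<in> finfuns (slice s (Suc l)) \<Longrightarrow>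
      f \<in> V (Suc l) \<longleftrightarrow> (\<forall>b\<in>B. after b f \<in> V l)"
    and V_0: "\<And>f b. f \<in> V 0 \<Longrightarrow> b \<in> B \<Longrightarrow> keep (\<lambda>x. hd (snd x) = b) f \<in> V 0"
  shows "\<exists>D::nat \<Rightarrow> 'a \<Rightarrow> nat. \<forall>l. fvs.dim (V l) = (\<Sum>b\<in>B. D l b) \<and>
    (\<forall>b\<in>B. D (Suc l) b = (\<Sum>c\<in>B. if G b c then D l c else 0))"
proof -
  let ?first = "\<lambda>b. \<lambda>x::nat \<times> 'a list. hd (snd x) = b"
  have V_support: "x \<in> slice s l" if "f \<in> V l" "f x \<noteq> 0" for f x l
    using V(2)[of l] that unfolding finfuns_def by blast
  have slice_Cons: "\<exists>b w'. w = b # w' \<and> b \<in> B \<and> j < J" if "(j, w) \<in> slice s l" for j w l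
    using that s[of j] letters[of j w] by (cases w) (auto simp: slice_def total_def)
  have keep_V: "keep (?first b) f \<in> V l" if "f \<in> V l" "b \<in> B" for f b l
  proof (cases l)
    case 0
    with that V_0 show ?thesis by simp
  next
    case (Suc m)
    have f: "f \<in> finfuns (slice s (Suc m))"
      using that(1) V(2)[of l] Suc by blast
    have "after c (keep (?first b) f) \<in> V m" if "c \<in> B" for c
    proof -
      have "after c (keep (?first b) f) = (if c = b then after c f else 0)"
        by (auto simp: fun_eq_iff)
      moreover have "after c f \<in> V m"
        using V_Suc[OF f] \<open>f \<in> V l\<close> Suc that by blast
      ultimately show ?thesis
        using fvs.subspace_0[OF V(1)[of m]] by presburger
    qed
    moreover have "keep (?first b) f \<in> finfuns (slice s (Suc m))"
      using keep_finfuns[OF f, of "?first b"] finfuns_mono[of "{x \<in> slice s (Suc m). ?first b x}"] by blast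
    ultimately show ?thesis
      using V_Suc Suc by blast
  qed
  define D where "D l b = fvs.dim {f \<in> V l. keep (?first b) f = f}" for l b
  have "fvs.dim (V l) = (\<Sum>b\<in>B. D l b)" for l
    unfolding D_def
  proof (rule dim_partition[OF finite_slice finite_letters V(1) V(2)])
    show "hd (snd x) \<in> B" if "x \<in> slice s l" for x
      using that slice_Cons[of "fst x" "snd x" l] by auto
  qed (rule keep_V)
  moreover have "D (Suc l) b = (\<Sum>c\<in>B. if G b c then D l c else 0)" if b: "b \<in> B" for l b
  proof -
    define U where "U = {g \<in> V l. keep (\<lambda>x. G b (hd (snd x))) g = g}"
    have G_U: "G b (hd (snd x))" if "g \<in> U" "g x \<noteq> 0" for g x
      using that keep_apply[of "\<lambda>x. G b (hd (snd x))" g x] unfolding U_def by (metis (mono_tags, lifting) mem_Collect_eq)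
    have W_support: "hd w = b" if "keep (?first b) f = f" "f (j, w) \<noteq> 0" for f :: "nat \<times> 'a list \<Rightarrow> 'k" and j w
      using that keep_apply[of "?first b" f "(j, w)"] by (metis snd_conv)
    have "after b ` {f \<in> V (Suc l). keep (?first b) f = f} = U"
    proof (intro equalityI subsetI)
      fix g assume "g \<in> after b ` {f \<in> V (Suc l). keep (?first b) f = f}"
      then obtain f where f: "f \<in> V (Suc l)" "g = after b f"
        by blast
      have "g \<in> V l"
        using V_Suc f b V(2) by blast
      moreover have "keep (\<lambda>x. G b (hd (snd x))) g = g"
      proof
        fix x :: "nat \<times> 'a list"
        obtain j w where x: "x = (j, w)" by (cases x)
        have "G b (hd w)" if "g x \<noteq> 0"
        proof -
          have "(j, b # w) \<in> slice s (Suc l)" "(j, w) \<in> slice s l"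
            using V_support[of f "Suc l" "(j, b # w)"] V_support[of g l "(j, w)"] that f \<open>g \<in> V l\<close> x by auto
          then show ?thesis
            using slice_Cons[of j w l] Cons_Cons_iff[of j b] by (auto simp: slice_def total_def)
        qed
        then show "keep (\<lambda>x. G b (hd (snd x))) g x = g x"
          by (auto simp: x)
      qed
      ultimately show "g \<in> U"
        by (simp add: U_def)
    next
      fix g assume g: "g \<in> U"
      \<comment> \<open>the preimage of \<open>g\<close>: prefix all words by \<open>b\<close>\<close>
      define f where "f = (\<lambda>(j, w). if w \<noteq> [] \<and> hd w = b then g (j, tl w) else 0)"
      have supp: "{x. f x \<noteq> 0} \<subseteq> slice s (Suc l)"
      proof clarify
        fix j w assume nz: "f (j, w) \<noteq> 0"
        then obtain w' where w: "w = b # w'" "g (j, w') \<noteq> 0"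
          by (cases w) (auto simp: f_def split: if_splits)
        with g have "(j, w') \<in> slice s l" "G b (hd w')"
          using V_support[of g l "(j, w')"] G_U[of g "(j, w')"] by (auto simp: U_def)
        then show "(j, w) \<in> slice s (Suc l)"
          using slice_Cons[of j w' l] Cons_Cons_iff[of j b "hd w'" "tl w'"] w by (auto simp: slice_def total_def)
      qed
      then have "f \<in> finfuns (slice s (Suc l))"
        using finite_subset[OF supp finite_slice] by (simp add: finfuns_def)
      moreover have after_f: "after c f = (if c = b then g else 0)" for c
        by (auto simp: f_def fun_eq_iff)
      moreover have "g \<in> V l" "0 \<in> V l"
        using g fvs.subspace_0[OF V(1)] by (auto simp: U_def)
      ultimately have "f \<in> V (Suc l)"
        using V_Suc[of f l] by presburger
      moreover have "keep (?first b) f = f"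
        by (auto simp: f_def fun_eq_iff)
      ultimately show "g \<in> after b ` {f \<in> V (Suc l). keep (?first b) f = f}"
        using after_f[of b] by force
    qed
    moreover have "inj_on (after b) {f \<in> V (Suc l). keep (?first b) f = f}"
    proof (rule inj_onI, rule ext)
      fix f f' :: "nat \<times> 'a list \<Rightarrow> 'k" and x :: "nat \<times> 'a list"
      assume f: "f \<in> {f \<in> V (Suc l). keep (?first b) f = f}" and f': "f' \<in> {f \<in> V (Suc l). keep (?first b) f = f}"
        and eq: "after b f = after b f'"
      obtain j w where x: "x = (j, w)" by (cases x)
      show "f x = f' x"
      proof (cases "f x = 0 \<and> f' x = 0")
        case False
        then have "x \<in> slice s (Suc l)"
          using f f' V_support by blast
        then obtain w' where w: "w = hd w # w'"
          using slice_Cons x by fastforce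
        have "hd w = b"
          using False f f' W_support x by blast
        with w fun_cong[OF eq, of "(j, w')"] x show ?thesis
          by (metis after_apply)
      qed simp
    qed
    ultimately have "D (Suc l) b = fvs.dim U"
      using dim_image_eq_inj[OF linear_after _ subspace_keep_part[OF V(1)], of b "Suc l" "?first b"]
      unfolding D_def by simp
    also have "\<dots> = (\<Sum>c\<in>B. fvs.dim {f \<in> U. keep (?first c) f = f})"
    proof (rule dim_partition[OF finite_slice finite_letters])
      show "fvs.subspace U"
        unfolding U_def by (rule subspace_keep_part[OF V(1)])
      show "U \<subseteq> finfuns (slice s l)"
        using V(2) by (auto simp: U_def)
      show "hd (snd x) \<in> B" if "x \<in> slice s l" for x
        using that slice_Cons[of "fst x" "snd x" l] by auto
      show "keep (?first c) f \<in> U" if "f \<in> U" "c \<in> B" for f c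
      proof -
        have "keep (\<lambda>x. G b (hd (snd x))) (keep (?first c) f) = keep (?first c) f"
        proof
          fix x
          show "keep (\<lambda>x. G b (hd (snd x))) (keep (?first c) f) x = keep (?first c) f x"
            using G_U[OF that(1), of x] by auto
        qed
        then show ?thesis
          using keep_V[of f l c] that by (auto simp: U_def)
      qed
    qed
    also have "\<dots> = (\<Sum>c\<in>B. if G b c then D l c else 0)"
    proof (rule sum.cong[OF refl])
      fix c
      show "fvs.dim {f \<in> U. keep (?first c) f = f} = (if G b c then D l c else 0)"
      proof (cases "G b c")
        case True
        have "keep (\<lambda>x. G b (hd (snd x))) f = f" if f: "keep (?first c) f = f" for f :: "nat \<times> 'a list \<Rightarrow> 'k"
        proof -
          have "keep (\<lambda>x. G b (hd (snd x))) (keep (?first c) f) = keep (?first c) f"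
            using True by (auto simp: fun_eq_iff)
          then show ?thesis
            by (simp only: f)
        qed
        then have "{f \<in> U. keep (?first c) f = f} = {f \<in> V l. keep (?first c) f = f}"
          unfolding U_def by blast
        with True show ?thesis
          by (simp add: D_def)
      next
        case False
        have "f = 0" if "f \<in> U" "keep (?first c) f = f" for f
        proof -
          have "keep (?first c) f = 0"
          proof
            fix x
            show "keep (?first c) f x = 0 x"
              using G_U[OF that(1), of x] False by auto
          qed
          then show ?thesis
            by (simp only: that(2))
        qed
        then have "{f \<in> U. keep (?first c) f = f} \<subseteq> {0}"
          by blast
        then have "fvs.dim {f \<in> U. keep (?first c) f = f} = 0"
          by (rule dim_eq_0)
        with False show ?thesis
          by simp
      qed
    qed
    finally show ?thesis .
  qed
  ultimately show ?thesis
    by blast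
qed

end

section \<open>Linear recurrences and rational series\<close>

text \<open>
  Any \<open>card B + 1\<close> vectors indexed by \<open>B\<close> are linearly dependent. A dependence between the first of the
  vectors \<open>D l\<close> is carried along by the recurrence, which is linear.
\<close>

lemma linear_recurrence_exists:
  fixes D :: "nat \<Rightarrow> 'b \<Rightarrow> 'k::field"
  assumes B: "finite B"
    and rec: "\<And>l b. b \<in> B \<Longrightarrow> D (Suc l) b = (\<Sum>b'\<in>B. m b b' * D l b')"
  shows "\<exists>r c. (\<exists>i\<le>r. c i \<noteq> 0) \<and> (\<forall>l. \<forall>b\<in>B. (\<Sum>i\<le>r. c i * D (l + i) b) = 0)"
proof -
  define r where "r = card B"
  define v where "v i = keep (\<lambda>b. b \<in> B) (D i)" for i
  have "\<exists>c. (\<exists>i\<le>r. c i \<noteq> 0) \<and> (\<forall>b\<in>B. (\<Sum>i\<le>r. c i * D i b) = 0)"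
  proof (cases "inj_on v {..r}")
    case False
    then obtain i j where ij: "i \<le> r" "j \<le> r" "i \<noteq> j" "v i = v j"
      by (auto simp: inj_on_def)
    \<comment> \<open>two of the vectors coincide, and their difference is the dependence\<close>
    define c where "c k = (if k = i then 1 else if k = j then - 1 else 0 :: 'k)" for k
    have "(\<Sum>k\<le>r. c k * D k b) = 0" if "b \<in> B" for b
    proof -
      have "(\<Sum>k\<le>r. c k * D k b) = (\<Sum>k\<in>{i, j}. c k * D k b)"
        using ij by (intro sum.mono_neutral_right) (auto simp: c_def)
      also have "\<dots> = D i b - D j b"
        using ij(3) by (simp add: c_def)
      also have "D i b = D j b"
        using fun_cong[OF ij(4), of b] that by (simp add: v_def)
      finally show ?thesis
        by (simp only: diff_self)
    qed
    moreover have "c i \<noteq> 0"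
      by (simp add: c_def)
    ultimately show ?thesis
      using ij(1) by blast
  next
    case True
    have "v ` {..r} \<subseteq> finfuns B"
      using B by (auto simp: v_def finfuns_def split: if_splits)
    then have "v ` {..r} \<subseteq> fvs.span (unit_fun ` B)"
      using finfuns_subset_span[of B] by blast
    moreover have "card (v ` {..r}) > card (unit_fun ` B :: ('b \<Rightarrow> 'k) set)"
      using card_image[OF True] card_image_le[OF B, of "unit_fun :: 'b \<Rightarrow> 'b \<Rightarrow> 'k"] by (simp add: r_def)
    ultimately have "fvs.dependent (v ` {..r})"
      using fvs.independent_span_bound[of "unit_fun ` B" "v ` {..r}"] B by fastforce
    then obtain u where u: "(\<Sum>x\<in>v ` {..r}. fscale (u x) x) = 0" "\<exists>x\<in>v ` {..r}. u x \<noteq> 0"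
      using fvs.dependent_finite[of "v ` {..r}"] by auto
    have "(\<Sum>i\<le>r. u (v i) * D i b) = 0" if "b \<in> B" for b
    proof -
      have "(\<Sum>i\<le>r. fscale (u (v i)) (v i)) = 0"
        using u(1) True by (simp add: sum.reindex)
      then have "(\<Sum>i\<le>r. fscale (u (v i)) (v i)) b = 0"
        by (simp only: zero_fun_apply)
      with that show ?thesis
        by (simp add: sum_fun_apply v_def)
    qed
    with u(2) show ?thesis
      by (intro exI[of _ "\<lambda>i. u (v i)"]) auto
  qed
  then obtain c where c: "\<exists>i\<le>r. c i \<noteq> 0" "\<forall>b\<in>B. (\<Sum>i\<le>r. c i * D i b) = 0"
    by blast
  have "\<forall>b\<in>B. (\<Sum>i\<le>r. c i * D (l + i) b) = 0" for l
  proof (induction l)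
    case (Suc l)
    show ?case
    proof
      fix b assume b: "b \<in> B"
      have "(\<Sum>i\<le>r. c i * D (Suc l + i) b) = (\<Sum>i\<le>r. \<Sum>b'\<in>B. m b b' * (c i * D (l + i) b'))"
        using rec[OF b] by (simp add: sum_distrib_left algebra_simps)
      also have "\<dots> = (\<Sum>b'\<in>B. m b b' * (\<Sum>i\<le>r. c i * D (l + i) b'))"
        by (subst sum.swap) (simp add: sum_distrib_left)
      finally show "(\<Sum>i\<le>r. c i * D (Suc l + i) b) = 0"
        using Suc by simp
    qed
  qed (use c in simp)
  with c(1) show ?thesis
    by blast
qed

lemma eval_fls_0 [simp]: "eval_fls 0 T = 0"
  by (simp add: eval_fls_def)

lemma eval_fls_pCons: "eval_fls (pCons a p) T = fls_const a + T * eval_fls p T"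
  by (cases "a = 0 \<and> p = 0") (auto simp: eval_fls_def map_poly_pCons)

lemma eval_fls_add: "eval_fls (p + q) T = eval_fls p T + eval_fls q T"
proof (induction p q rule: poly_induct2)
  case (pCons a p b q)
  then show ?case
    by (simp add: eval_fls_pCons algebra_simps flip: fls_plus_const)
qed simp

lemma eval_fls_sum: "eval_fls (\<Sum>i\<in>A. p i) T = (\<Sum>i\<in>A. eval_fls (p i) T)"
  by (induction A rule: infinite_finite_induct) (simp_all add: eval_fls_add)

lemma eval_fls_monom: "eval_fls (monom c n) T = fls_const c * T ^ n"
  by (induction n) (simp_all add: monom_0 monom_Suc eval_fls_pCons algebra_simps)

lemma eval_fls_X_nth: "fls_nth (eval_fls p fls_X) n = (if n < 0 then 0 else coeff p (nat n))"
proof (induction p arbitrary: n)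
  case (pCons a p)
  show ?case
  proof (cases "n \<le> 0")
    case True
    then show ?thesis
      using pCons.IH[of "n - 1"] by (auto simp: eval_fls_pCons fls_X_times_conv_shift(1))
  next
    case False
    then have "nat n = Suc (nat (n - 1))"
      by simp
    with False show ?thesis
      using pCons.IH[of "n - 1"] by (simp add: eval_fls_pCons fls_X_times_conv_shift(1))
  qed
qed simp

lemma eval_fls_X_eq_0_iff: "eval_fls p fls_X = 0 \<longleftrightarrow> p = 0"
proof
  assume "eval_fls p fls_X = 0"
  then have "coeff p n = 0" for n
    using eval_fls_X_nth[of p "int n"] by simp
  then show "p = 0"
    by (simp add: poly_eq_iff)
qed simp

lemma eval_fls_times_power: "eval_fls (monom 1 k * p) T = T ^ k * eval_fls p T"
proof (induction k)
  case (Suc k)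
  have "monom 1 (Suc k) * p = pCons 0 (monom 1 k * p)"
    by (simp add: monom_Suc)
  then show ?case
    using Suc by (simp add: eval_fls_pCons mult.assoc)
qed (simp add: monom_0)

text \<open>
  If \<open>\<Sum>i\<le>r. c i * h (n + i)\<close> vanishes for large \<open>n\<close>, then multiplying the series by
  \<open>\<Sum>i\<le>r. c i t\<^sup>r\<^sup>-\<^sup>i\<close> leaves only finitely many terms; a power of \<open>t\<close> removes those of
  negative degree.
\<close>

lemma rational_in_t_if_recurrence:
  fixes h :: "int \<Rightarrow> nat" and D :: "nat \<Rightarrow> 'b \<Rightarrow> rat"
  assumes low: "\<And>n. n < a \<Longrightarrow> h n = 0"
    and B: "finite B"
    and h: "\<And>l. of_nat (h (n0 + int l)) = (\<Sum>b\<in>B. D l b)"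
    and rec: "\<And>l b. b \<in> B \<Longrightarrow> D (Suc l) b = (\<Sum>b'\<in>B. m b b' * D l b')"
  shows "rational_in_t h"
proof -
  have "\<exists>r c. (\<exists>i\<le>r. c i \<noteq> 0) \<and> (\<forall>l. \<forall>b\<in>B. (\<Sum>i\<le>r. c i * D (l + i) b) = 0)"
    by (rule linear_recurrence_exists[where m = m, OF B]) (rule rec)
  then obtain r c where c: "\<exists>i\<le>r. c i \<noteq> 0" "\<And>l b. b \<in> B \<Longrightarrow> (\<Sum>i\<le>r. c i * D (l + i) b) = 0"
    by blast
  have rec_h: "(\<Sum>i\<le>r. c i * of_nat (h (n + int i))) = 0" if "n \<ge> n0" for n
  proof -
    define l where "l = nat (n - n0)"
    have "(\<Sum>i\<le>r. c i * of_nat (h (n + int i))) = (\<Sum>i\<le>r. \<Sum>b\<in>B. c i * D (l + i) b)"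
    proof (rule sum.cong[OF refl])
      fix i
      have "n + int i = n0 + int (l + i)"
        using that by (simp add: l_def)
      then show "c i * of_nat (h (n + int i)) = (\<Sum>b\<in>B. c i * D (l + i) b)"
        by (simp only: h sum_distrib_left)
    qed
    also have "\<dots> = (\<Sum>b\<in>B. \<Sum>i\<le>r. c i * D (l + i) b)"
      by (rule sum.swap)
    finally show ?thesis
      by (simp add: c(2))
  qed
  define F where "F = Abs_fls (\<lambda>n. of_nat (h n) :: rat)"
  have F: "fls_nth F n = of_nat (h n)" for n
    unfolding F_def by (rule nth_Abs_fls_lower_bound[of a]) (use low in auto)
  define q where "q = (\<Sum>i\<le>r. monom (c i) (r - i))"
  have coeff_q: "coeff q (r - i) = c i" if "i \<le> r" for i
  proof -
    have "coeff q (r - i) = (\<Sum>i'\<le>r. if i' = i then c i' else 0)"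
      unfolding q_def coeff_sum coeff_monom using that by (intro sum.cong) auto
    then show ?thesis
      using that by simp
  qed
  then have q: "q \<noteq> 0"
    using c(1) by (metis coeff_0)
  \<comment> \<open>the exponent that clears the terms of negative degree\<close>
  define s where "s = nat (- a)"
  define N where "N = nat (n0 + int r + int s)"
  define H where "H = fls_X ^ s * (eval_fls q fls_X * F)"
  have H: "fls_nth H n = (\<Sum>i\<le>r. c i * of_nat (h ((n - int s - int r) + int i)))" for n
  proof -
    have "fls_nth H n = fls_nth (eval_fls q fls_X * F) (n - int s)"
      by (simp add: H_def fls_X_power_times_conv_shift(1))
    also have "\<dots> = (\<Sum>i\<le>r. fls_nth (fls_const (c i) * (fls_X ^ (r - i) * F)) (n - int s))"
      by (simp add: q_def eval_fls_sum eval_fls_monom sum_distrib_right fls_nth_sum mult.assoc)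
    also have "\<dots> = (\<Sum>i\<le>r. c i * of_nat (h ((n - int s - int r) + int i)))"
    proof (rule sum.cong[OF refl])
      fix i assume "i \<in> {..r}"
      then have "n - int s - int (r - i) = (n - int s - int r) + int i"
        by simp
      moreover have "fls_nth (fls_const (c i) * (fls_X ^ (r - i) * F)) (n - int s) =
          c i * of_nat (h (n - int s - int (r - i)))"
        by (simp add: fls_X_power_times_conv_shift(1) F)
      ultimately show "fls_nth (fls_const (c i) * (fls_X ^ (r - i) * F)) (n - int s) =
          c i * of_nat (h ((n - int s - int r) + int i))"
        by (simp only:)
    qed
    finally show ?thesis .
  qed
  define p where "p = (\<Sum>n<N. monom (fls_nth H (int n)) n)"
  have "H = eval_fls p fls_X"
  proof (rule fls_eqI)
    fix n
    have p: "coeff p k = (if k < N then fls_nth H (int k) else 0)" for k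
      unfolding p_def coeff_sum coeff_monom by (simp add: sum.delta)
    show "fls_nth H n = fls_nth (eval_fls p fls_X) n"
    proof (cases "n < 0 \<or> n \<ge> int N")
      case True
      then have "fls_nth H n = 0"
      proof
        assume "n < 0"
        then show ?thesis
          unfolding H by (intro sum.neutral) (auto simp: low s_def)
      next
        assume "n \<ge> int N"
        then have "n - int s - int r \<ge> n0"
          unfolding N_def by linarith
        then show ?thesis
          unfolding H by (rule rec_h)
      qed
      with True show ?thesis
        by (auto simp: eval_fls_X_nth p)
    next
      case False
      then show ?thesis
        by (simp add: eval_fls_X_nth p nat_less_iff)
    qed
  qed
  moreover have "fls_X ^ s * eval_fls q fls_X \<noteq> 0"
    using q by (simp add: eval_fls_X_eq_0_iff)
  then have "F = H / (fls_X ^ s * eval_fls q fls_X)"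
    unfolding H_def mult.assoc[symmetric] by (rule nonzero_mult_div_cancel_left[symmetric])
  ultimately have "F = eval_fls p fls_X / eval_fls (monom 1 s * q) fls_X"
    by (simp only: eval_fls_times_power)
  moreover have "monom 1 s * q \<noteq> 0"
    using q by simp
  ultimately show ?thesis
    unfolding rational_in_t_def using F by blast
qed

text \<open>
  Reversing the coefficients of a polynomial of degree \<open>d\<close> gives \<open>p(t) = t\<^sup>d p'(t\<^sup>-\<^sup>1)\<close>.
\<close>

lemma eval_fls_X_reflect:
  "\<exists>p'. (p \<noteq> 0 \<longrightarrow> p' \<noteq> 0) \<and> eval_fls p fls_X = fls_X ^ degree p * eval_fls p' fls_X_inv"
proof -
  have "eval_fls p fls_X = fls_X ^ degree p * eval_fls (\<Sum>i\<le>degree p. monom (coeff p i) (degree p - i)) fls_X_inv"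
  proof -
    have inv: "fls_X ^ n * fls_X_inv ^ k = (fls_X ^ (n - k) :: rat fls)" if "k \<le> n" for n k
    proof -
      have "fls_X * fls_X_inv = (1 :: rat fls)"
        by (simp only: fls_inverse_X[symmetric] right_inverse[OF fls_X_nonzero])
      then have one: "fls_X ^ k * fls_X_inv ^ k = (1 :: rat fls)"
        by (simp only: power_mult_distrib[symmetric] power_one)
      have "fls_X ^ n * fls_X_inv ^ k = (fls_X ^ (n - k) * fls_X ^ k * fls_X_inv ^ k :: rat fls)"
        using that by (simp only: power_add[symmetric] le_add_diff_inverse2)
      then show ?thesis
        by (simp only: mult.assoc one mult_1_right)
    qed
    have "eval_fls p fls_X = eval_fls (\<Sum>i\<le>degree p. monom (coeff p i) i) fls_X"
      by (simp add: poly_as_sum_of_monoms)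
    also have "\<dots> = (\<Sum>i\<le>degree p. fls_const (coeff p i) * (fls_X ^ degree p * fls_X_inv ^ (degree p - i)))"
      unfolding eval_fls_sum eval_fls_monom by (intro sum.cong refl) (simp add: inv)
    finally show ?thesis
      by (simp add: eval_fls_sum eval_fls_monom sum_distrib_left algebra_simps)
  qed
  moreover have "(\<Sum>i\<le>degree p. monom (coeff p i) (degree p - i)) \<noteq> 0" if "p \<noteq> 0"
    using that calculation eval_fls_X_eq_0_iff[of p] by auto
  ultimately show ?thesis
    by blast
qed

lemma rational_in_t_inverse_if_rational_in_t:
  assumes "rational_in_t (\<lambda>n. h (- n))"
  shows "rational_in_t_inverse h"
proof -
  obtain F p q where F: "\<And>n. fls_nth F n = of_nat (h (- n))" and q: "q \<noteq> 0"
    and eq: "F = eval_fls p fls_X / eval_fls q fls_X"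
    using assms unfolding rational_in_t_def by blast
  obtain p' where p': "eval_fls p fls_X = fls_X ^ degree p * eval_fls p' fls_X_inv"
    using eval_fls_X_reflect[of p] by blast
  obtain q' where q': "q' \<noteq> 0" "eval_fls q fls_X = fls_X ^ degree q * eval_fls q' fls_X_inv"
    using eval_fls_X_reflect[of q] q by blast
  have cancel: "x ^ m * A / (x ^ n * C) = inverse x ^ n * A / (inverse x ^ m * C)"
    if "x \<noteq> 0" for x A C :: "rat fls" and m n
    using that by (cases "C = 0") (simp_all add: field_simps power_inverse)
  have "F = eval_fls (monom 1 (degree q) * p') fls_X_inv / eval_fls (monom 1 (degree p) * q') fls_X_inv"
    unfolding eval_fls_times_power eq p' q'(2) fls_inverse_X[symmetric]
    by (rule cancel) (rule fls_X_nonzero)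
  moreover have "monom 1 (degree p) * q' \<noteq> 0"
    using q' by simp
  ultimately show ?thesis
    unfolding rational_in_t_inverse_def using F by blast
qed

section \<open>Images and kernels of graded maps between spaces of functions on words\<close>

definition grade :: "'x set \<Rightarrow> ('x \<Rightarrow> int) \<Rightarrow> int \<Rightarrow> 'x set" where
  "grade X deg m = {x \<in> X. deg x = m}"

definition graded_linear ::
    "'x set \<Rightarrow> ('x \<Rightarrow> int) \<Rightarrow> 'y set \<Rightarrow> ('y \<Rightarrow> int) \<Rightarrow> (('x \<Rightarrow> 'k::field) \<Rightarrow> 'y \<Rightarrow> 'k) \<Rightarrow> bool" where
  "graded_linear X deg Y deg' \<delta> \<longleftrightarrow>
    (\<forall>f\<in>finfuns X. \<delta> f \<in> finfuns Y) \<and>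
    (\<forall>f\<in>finfuns X. \<forall>g\<in>finfuns X. \<delta> (f + g) = \<delta> f + \<delta> g) \<and>
    (\<forall>c. \<forall>f\<in>finfuns X. \<delta> (fscale c f) = fscale c (\<delta> f)) \<and>
    (\<forall>m. \<forall>f\<in>finfuns (grade X deg m). \<delta> f \<in> finfuns (grade Y deg' m))"

lemma finfuns_gradeD: "f \<in> finfuns (grade X deg m) \<Longrightarrow> f \<in> finfuns X"
  by (auto simp: finfuns_def grade_def)

lemma graded_linear_zero:
  assumes "graded_linear X deg Y deg' \<delta>"
  shows "\<delta> 0 = 0"
proof -
  have "\<delta> (fscale 0 0) = fscale 0 (\<delta> 0)"
    using assms finfuns_zero unfolding graded_linear_def by blast
  then show ?thesis
    by simp
qed

lemma graded_linear_sum: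
  assumes \<delta>: "graded_linear X deg Y deg' \<delta>" and "finite I" "\<And>i. i \<in> I \<Longrightarrow> f i \<in> finfuns X"
  shows "\<delta> (\<Sum>i\<in>I. f i) = (\<Sum>i\<in>I. \<delta> (f i))"
  using assms(2,3)
proof (induction I rule: finite_induct)
  case (insert i I)
  have "(\<Sum>i\<in>I. f i) \<in> finfuns X"
    using insert.prems by (intro finfuns_sum) auto
  then have "\<delta> (f i + (\<Sum>i\<in>I. f i)) = \<delta> (f i) + \<delta> (\<Sum>i\<in>I. f i)"
    using \<delta> insert.prems unfolding graded_linear_def by blast
  moreover have "\<delta> (\<Sum>i\<in>I. f i) = (\<Sum>i\<in>I. \<delta> (f i))"
    by (rule insert.IH) (simp add: insert.prems)
  ultimately show ?case
    by (simp only: sum.insert[OF insert.hyps])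
qed (simp add: graded_linear_zero[OF \<delta>])

lemma finfuns_keep_grade: "f \<in> finfuns X \<Longrightarrow> keep (\<lambda>x. deg x = m) f \<in> finfuns (grade X deg m)"
  using keep_finfuns[of f X "\<lambda>x. deg x = m"] by (simp add: grade_def)

lemma sum_homogeneous_parts:
  assumes "f \<in> finfuns X"
  shows "(\<Sum>m\<in>deg ` {x. f x \<noteq> 0}. keep (\<lambda>x. deg x = m) f) = f"
  using assms by (intro sum_keep_partition) (auto simp: finfuns_def)

lemma keep_grade: "f \<in> finfuns (grade X deg n) \<Longrightarrow> keep (\<lambda>x. deg x = m) f = (if n = m then f else 0)"
  by (auto simp: finfuns_def grade_def fun_eq_iff)

lemma graded_linear_keep:
  assumes \<delta>: "graded_linear X deg Y deg' \<delta>" and f: "f \<in> finfuns X"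
  shows "keep (\<lambda>y. deg' y = m) (\<delta> f) = \<delta> (keep (\<lambda>x. deg x = m) f)"
proof -
  let ?N = "deg ` {x. f x \<noteq> 0}"
  let ?f = "\<lambda>n. keep (\<lambda>x. deg x = n) f"
  have fin: "finite ?N"
    using f by (simp add: finfuns_def)
  have "\<delta> f = \<delta> (\<Sum>n\<in>?N. ?f n)"
    by (simp only: sum_homogeneous_parts[OF f])
  also have "\<dots> = (\<Sum>n\<in>?N. \<delta> (?f n))"
    by (rule graded_linear_sum[OF \<delta> fin]) (rule finfuns_keep[OF f])
  finally have "keep (\<lambda>y. deg' y = m) (\<delta> f) = (\<Sum>n\<in>?N. keep (\<lambda>y. deg' y = m) (\<delta> (?f n)))"
    by (simp only: keep_sum)
  also have "\<dots> = (\<Sum>n\<in>?N. if n = m then \<delta> (?f n) else 0)"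
  proof (rule sum.cong[OF refl])
    fix n
    have "\<delta> (?f n) \<in> finfuns (grade Y deg' n)"
      using \<delta> finfuns_keep_grade[OF f, of deg n] unfolding graded_linear_def by blast
    then show "keep (\<lambda>y. deg' y = m) (\<delta> (?f n)) = (if n = m then \<delta> (?f n) else 0)"
      by (rule keep_grade)
  qed
  also have "\<dots> = \<delta> (?f m)"
  proof (cases "m \<in> ?N")
    case False
    then have "?f m = 0"
      by (auto simp: fun_eq_iff)
    with False fin graded_linear_zero[OF \<delta>] show ?thesis
      by simp
  qed (use fin in simp)
  finally show ?thesis .
qed

lemma subspace_graded_linear_image:
  assumes \<delta>: "graded_linear X deg Y deg' \<delta>" and S: "fvs.subspace S" "S \<subseteq> finfuns X"
  shows "fvs.subspace (\<delta> ` S)"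
proof (rule fvs.subspaceI)
  show "0 \<in> \<delta> ` S"
    using graded_linear_zero[OF \<delta>] fvs.subspace_0[OF S(1)] by force
  show "f + g \<in> \<delta> ` S" if fg: "f \<in> \<delta> ` S" "g \<in> \<delta> ` S" for f g
  proof -
    obtain f' g' where "f' \<in> S" "g' \<in> S" "f = \<delta> f'" "g = \<delta> g'"
      using fg by blast
    moreover from this have "\<delta> (f' + g') = \<delta> f' + \<delta> g'"
      using \<delta> S(2) unfolding graded_linear_def by blast
    ultimately show ?thesis
      using fvs.subspace_add[OF S(1)] by (metis image_eqI)
  qed
  show "fscale c f \<in> \<delta> ` S" if fg: "f \<in> \<delta> ` S" for c f
  proof -
    obtain f' where "f' \<in> S" "f = \<delta> f'"
      using fg by blast
    moreover from this have "\<delta> (fscale c f') = fscale c (\<delta> f')"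
      using \<delta> S(2) unfolding graded_linear_def by blast
    ultimately show ?thesis
      using fvs.subspace_scale[OF S(1)] by (metis image_eqI)
  qed
qed

lemma subspace_graded_linear_kernel:
  assumes \<delta>: "graded_linear X deg Y deg' \<delta>" and S: "fvs.subspace S" "S \<subseteq> finfuns X"
  shows "fvs.subspace {f \<in> S. \<delta> f = 0}"
proof (rule fvs.subspaceI)
  show "0 \<in> {f \<in> S. \<delta> f = 0}"
    using fvs.subspace_0[OF S(1)] graded_linear_zero[OF \<delta>] by simp
  show "f + g \<in> {f \<in> S. \<delta> f = 0}" if "f \<in> {f \<in> S. \<delta> f = 0}" "g \<in> {f \<in> S. \<delta> f = 0}" for f g
  proof -
    have "\<delta> (f + g) = \<delta> f + \<delta> g"
      using \<delta> that S(2) unfolding graded_linear_def by blast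
    with that show ?thesis
      by (simp add: fvs.subspace_add[OF S(1)])
  qed
  show "fscale c f \<in> {f \<in> S. \<delta> f = 0}" if "f \<in> {f \<in> S. \<delta> f = 0}" for c f
  proof -
    have "\<delta> (fscale c f) = fscale c (\<delta> f)"
      using \<delta> that S(2) unfolding graded_linear_def by blast
    with that show ?thesis
      by (simp add: fvs.subspace_scale[OF S(1)])
  qed
qed

context word_system begin

text \<open>
  In coordinates an arc acts by \<open>push\<close> on sums of projectives and by \<open>after\<close> on sums of injectives.
\<close>

definition push :: "'a \<Rightarrow> (nat \<times> 'a list \<Rightarrow> 'k::zero) \<Rightarrow> nat \<times> 'a list \<Rightarrow> 'k" where
  "push b f = (\<lambda>(j, w). if (j, w) \<in> total \<and> w \<noteq> [] \<and> hd w = b then f (j, tl w) else 0)"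

lemma after_finfuns:
  assumes "f \<in> finfuns total"
  shows "after b f \<in> finfuns total"
proof -
  have "{x. after b f x \<noteq> 0} \<subseteq> (\<lambda>(j, w). (j, tl w)) ` {x. f x \<noteq> 0}"
    by (force simp: image_iff)
  moreover have "{x. after b f x \<noteq> 0} \<subseteq> total"
    using assms tail_closed by (fastforce simp: finfuns_def total_def)
  ultimately show ?thesis
    using assms unfolding finfuns_def by (blast intro: finite_subset)
qed

lemma push_finfuns:
  assumes "f \<in> finfuns total"
  shows "push b f \<in> finfuns total"
proof -
  have "{x. push b f x \<noteq> 0} \<subseteq> (\<lambda>(j, w). (j, b # w)) ` {x. f x \<noteq> 0}"
  proof clarify
    fix j w assume "push b f (j, w) \<noteq> 0"
    then have "f (j, tl w) \<noteq> 0" "w = b # tl w"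
      by (auto simp: push_def split: if_splits)
    then show "(j, w) \<in> (\<lambda>(j, w). (j, b # w)) ` {x. f x \<noteq> 0}"
      by (auto intro: image_eqI[of _ _ "(j, tl w)"])
  qed
  moreover have "{x. push b f x \<noteq> 0} \<subseteq> total"
    by (auto simp: push_def split: if_splits)
  ultimately show ?thesis
    using assms unfolding finfuns_def by (blast intro: finite_subset)
qed

lemma push_after:
  assumes "f \<in> finfuns total" and "\<And>j. f (j, []) = 0"
  shows "push b (after b f) = keep (\<lambda>x. hd (snd x) = b) f"
proof
  fix x :: "nat \<times> 'a list"
  obtain j w where x: "x = (j, w)" by (cases x)
  show "push b (after b f) x = keep (\<lambda>x. hd (snd x) = b) f x"
  proof (cases w)
    case Nil
    then show ?thesis
      by (simp add: x push_def assms(2))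
  next
    case (Cons c w')
    then show ?thesis
      using assms(1) by (auto simp: x push_def finfuns_def)
  qed
qed

lemma keep_first_push: "keep (\<lambda>x. hd (snd x) = c) (push b f) = (if b = c then push b f else 0)"
  by (auto simp: push_def fun_eq_iff)

lemma sum_keep_first:
  assumes "f \<in> finfuns total" and "\<And>j. f (j, []) = 0"
  shows "(\<Sum>b\<in>B. keep (\<lambda>x. hd (snd x) = b) f) = f"
proof (rule sum_keep_partition[OF finite_letters])
  fix x assume nz: "f x \<noteq> 0"
  obtain j w where x: "x = (j, w)" by (cases x)
  have "(j, w) \<in> total" "w \<noteq> []"
    using assms nz x by (auto simp: finfuns_def)
  then show "hd (snd x) \<in> B"
    using letters[of j w] x by (cases w) (auto simp: total_def)
qed

end

text \<open>
  Arrows raise the degree, so a path of length \<open>n\<close> has degree \<open>n\<close> in a projective, whereas the dual of such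
  a path has degree \<open>- n\<close> in an injective. The shift of the \<open>j\<close>-th summand is \<open>i j\<close>.
\<close>

definition proj_degree :: "(nat \<Rightarrow> int) \<Rightarrow> nat \<times> 'a list \<Rightarrow> int" where
  "proj_degree i = (\<lambda>(j, w). i j + int (length w))"

definition inj_degree :: "(nat \<Rightarrow> int) \<Rightarrow> nat \<times> 'a list \<Rightarrow> int" where
  "inj_degree i = (\<lambda>(j, w). i j - int (length w))"

context word_system begin

lemma finite_grade_proj_degree: "finite (grade total (proj_degree i) m)"
  by (rule finite_subset[OF _ finite_layer[of "\<lambda>j. nat (m - i j)"]]) (auto simp: grade_def proj_degree_def)

lemma finite_grade_inj_degree: "finite (grade total (inj_degree i) m)"
  by (rule finite_subset[OF _ finite_layer[of "\<lambda>j. nat (i j - m)"]]) (auto simp: grade_def inj_degree_def)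

lemma grade_proj_degree_eq_slice:
  assumes "\<And>j. j < J \<Longrightarrow> i j < n"
  shows "grade total (proj_degree i) (n + int l) = slice (\<lambda>j. nat (n - i j)) l"
proof -
  have "i j + int k = n + int l \<longleftrightarrow> k = l + nat (n - i j)" if "j < J" for j k
    using assms[OF that] by auto
  then show ?thesis
    by (auto simp: grade_def proj_degree_def slice_def total_def)
qed

lemma grade_inj_degree_eq_slice:
  assumes "\<And>j. j < J \<Longrightarrow> n < i j"
  shows "grade total (inj_degree i) (n - int l) = slice (\<lambda>j. nat (i j - n)) l"
proof -
  have "i j - int k = n - int l \<longleftrightarrow> k = l + nat (i j - n)" if "j < J" for j k
    using assms[OF that] by auto
  then show ?thesis
    by (auto simp: grade_def inj_degree_def slice_def total_def)
qed

lemma after_grade_proj_degree: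
  "f \<in> finfuns (grade total (proj_degree i) m) \<Longrightarrow> after b f \<in> finfuns (grade total (proj_degree i) (m - 1))"
  using after_finfuns[OF finfuns_gradeD, of f "proj_degree i" m b]
  by (fastforce simp: finfuns_def grade_def proj_degree_def)

lemma after_grade_inj_degree:
  "f \<in> finfuns (grade total (inj_degree i) m) \<Longrightarrow> after b f \<in> finfuns (grade total (inj_degree i) (m + 1))"
  using after_finfuns[OF finfuns_gradeD, of f "inj_degree i" m b]
  by (fastforce simp: finfuns_def grade_def inj_degree_def)

lemma push_grade_proj_degree:
  assumes "f \<in> finfuns (grade total (proj_degree i) m)"
  shows "push b f \<in> finfuns (grade total (proj_degree i) (m + 1))"
proof -
  have "proj_degree i x = m + 1" if "push b f x \<noteq> 0" for x
  proof -
    obtain j w where x: "x = (j, w)" by (cases x)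
    then have "f (j, tl w) \<noteq> 0" "w \<noteq> []"
      using that by (auto simp: push_def split: if_splits)
    then show ?thesis
      using assms x by (cases w) (auto simp: finfuns_def grade_def proj_degree_def subset_iff)
  qed
  then show ?thesis
    using push_finfuns[OF finfuns_gradeD[OF assms], of b] by (auto simp: finfuns_def grade_def)
qed

lemma grade_proj_degree_Nil:
  assumes "f \<in> finfuns (grade total (proj_degree i) m)" and "\<And>j. j < J \<Longrightarrow> i j < m"
  shows "f (j, []) = 0"
  using assms by (fastforce simp: finfuns_def grade_def proj_degree_def total_def)

lemma grade_inj_degree_Nil:
  assumes "f \<in> finfuns (grade total (inj_degree i) m)" and "\<And>j. j < J \<Longrightarrow> m < i j"
  shows "f (j, []) = 0"
  using assms by (fastforce simp: finfuns_def grade_def inj_degree_def total_def)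

end

text \<open>
  Above the degrees \<open>i1 j\<close> of the generators, every \<open>p\<close> is the sum of the elements
  \<open>push b (after b p)\<close>, on which \<open>\<delta>\<close> is determined by its values one degree lower. Hence the images are
  closed under restriction to words with a given first letter, and membership in degree \<open>m + 1\<close>
  amounts to membership of all shifted functions in degree \<open>m\<close>.
\<close>

lemma image_recurrence:
  fixes \<delta> :: "(nat \<times> 'a list \<Rightarrow> 'k::field) \<Rightarrow> nat \<times> 'a list \<Rightarrow> 'k"
  assumes W1: "word_system B G J1 X1" and W0: "word_system B G J0 X0"
    and \<delta>: "graded_linear (word_system.total J1 X1) (proj_degree i1) (word_system.total J0 X0) (proj_degree i0) \<delta>"
    and push: "\<And>b f. b \<in> B \<Longrightarrow> f \<in> finfuns (word_system.total J1 X1) \<Longrightarrow>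
      \<delta> (word_system.push J1 X1 b f) = word_system.push J0 X0 b (\<delta> f)"
    and n: "\<And>j. j < J1 \<Longrightarrow> i1 j < n" "\<And>j. j < J0 \<Longrightarrow> i0 j < n"
  shows "\<exists>D::nat \<Rightarrow> 'a \<Rightarrow> nat. \<forall>l.
    fvs.dim (\<delta> ` finfuns (grade (word_system.total J1 X1) (proj_degree i1) (n + int l))) = (\<Sum>b\<in>B. D l b) \<and>
    (\<forall>b\<in>B. D (Suc l) b = (\<Sum>c\<in>B. if G b c then D l c else 0))"
proof -
  interpret W1: word_system B G J1 X1 by (rule W1)
  interpret W0: word_system B G J0 X0 by (rule W0)
  let ?S = "\<lambda>m. finfuns (grade W1.total (proj_degree i1) m) :: (nat \<times> 'a list \<Rightarrow> 'k) set"
  let ?first = "\<lambda>b. \<lambda>x::nat \<times> 'a list. hd (snd x) = b"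
  define V where "V l = \<delta> ` ?S (n + int l)" for l
  have slice: "grade W0.total (proj_degree i0) (n + int l) = W0.slice (\<lambda>j. nat (n - i0 j)) l" for l
    by (rule W0.grade_proj_degree_eq_slice[OF n(2)])
  have \<delta>_grade: "\<delta> p \<in> finfuns (grade W0.total (proj_degree i0) m)" if "p \<in> ?S m" for p m
    using \<delta> that unfolding graded_linear_def by blast
  have V_slice: "V l \<subseteq> finfuns (W0.slice (\<lambda>j. nat (n - i0 j)) l)" for l
    unfolding V_def slice[symmetric] using \<delta>_grade by blast
  have V_sub: "fvs.subspace (V l)" for l
    unfolding V_def
    by (rule subspace_graded_linear_image[OF \<delta> subspace_finfuns]) (use finfuns_gradeD in blast)
  have \<delta>_decomp: "keep (?first b) (\<delta> p) = \<delta> (keep (?first b) p) \<and>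
      keep (?first b) (\<delta> p) = W0.push b (\<delta> (after b p))"
    if p: "p \<in> ?S m" and m: "m \<ge> n" and b: "b \<in> B" for p m b
  proof -
    have p_total: "p \<in> finfuns W1.total"
      by (rule finfuns_gradeD[OF p])
    have Nil: "p (j, []) = 0" for j
      using W1.grade_proj_degree_Nil[OF p] n(1) m by force
    have push_p: "W1.push c (after c p) = keep (?first c) p" for c
      by (rule W1.push_after[OF p_total Nil])
    have \<delta>_push: "\<delta> (keep (?first c) p) = W0.push c (\<delta> (after c p))" if "c \<in> B" for c
      using push[OF that W1.after_finfuns[OF p_total], of c] push_p by simp
    have "\<delta> p = \<delta> (\<Sum>c\<in>B. keep (?first c) p)"
      by (simp only: W1.sum_keep_first[OF p_total Nil])
    also have "\<dots> = (\<Sum>c\<in>B. \<delta> (keep (?first c) p))"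
      by (rule graded_linear_sum[OF \<delta> W1.finite_letters]) (rule finfuns_keep[OF p_total])
    also have "\<dots> = (\<Sum>c\<in>B. W0.push c (\<delta> (after c p)))"
      by (rule sum.cong[OF refl]) (rule \<delta>_push)
    finally have "keep (?first b) (\<delta> p) = (\<Sum>c\<in>B. if c = b then W0.push c (\<delta> (after c p)) else 0)"
      by (simp only: keep_sum W0.keep_first_push)
    also have "\<dots> = W0.push b (\<delta> (after b p))"
      using b W1.finite_letters by simp
    finally show ?thesis
      using \<delta>_push[OF b] by simp
  qed
  have keep_V: "keep (?first b) f \<in> V l" if f: "f \<in> V l" and b: "b \<in> B" for f l b
  proof -
    obtain p where p: "p \<in> ?S (n + int l)" "f = \<delta> p"
      using f unfolding V_def by blast
    then have "keep (?first b) f = \<delta> (keep (?first b) p)"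
      using \<delta>_decomp[OF p(1) _ b] by simp
    then show ?thesis
      unfolding V_def using finfuns_keep[OF p(1)] by blast
  qed
  have after_V: "after b f \<in> V l" if f: "f \<in> V (Suc l)" and b: "b \<in> B" for f l b
  proof -
    obtain p where p: "p \<in> ?S (n + int (Suc l))" "f = \<delta> p"
      using f unfolding V_def by blast
    define g where "g = \<delta> (after b p)"
    have g: "g \<in> V l"
      unfolding V_def g_def using W1.after_grade_proj_degree[OF p(1), of b] by simp
    then have g_grade: "g \<in> finfuns (grade W0.total (proj_degree i0) (n + int l))"
      using V_slice[of l] unfolding slice by blast
    have g_total: "g \<in> finfuns W0.total"
      by (rule finfuns_gradeD[OF g_grade])
    have g_Nil: "g (j, []) = 0" for j
      using W0.grade_proj_degree_Nil[OF g_grade] n(2) by force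
    have "after b f = after b (W0.push b g)"
    proof -
      have "after b f = after b (keep (?first b) f)"
        by (auto simp: fun_eq_iff)
      moreover have "keep (?first b) f = W0.push b g"
        using \<delta>_decomp[OF p(1) _ b, THEN conjunct2] p(2) by (simp only: g_def)
      ultimately show ?thesis
        by (simp only:)
    qed
    \<comment> \<open>only words that \<open>b\<close> can precede survive the multiplication by \<open>b\<close>\<close>
    also have "\<dots> = (\<Sum>c\<in>B. if G b c then keep (?first c) g else 0)"
    proof
      fix x :: "nat \<times> 'a list"
      obtain j w where x: "x = (j, w)" by (cases x)
      show "after b (W0.push b g) x = (\<Sum>c\<in>B. if G b c then keep (?first c) g else 0) x"
      proof (cases "g (j, w) = 0")
        case True
        have "(\<Sum>c\<in>B. if G b c then keep (?first c) g else 0) x = 0"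
          unfolding sum_fun_apply by (rule sum.neutral) (simp add: x True)
        then show ?thesis
          using True by (simp add: x W0.push_def)
      next
        case False
        then obtain c w' where w: "w = c # w'"
          using g_Nil by (cases w) auto
        have jw: "(j, w) \<in> W0.total"
          using False g_total by (auto simp: finfuns_def)
        then have c: "c \<in> B"
          using W0.letters[of j w] w by (auto simp: W0.total_def)
        have "(\<Sum>d\<in>B. if G b d then keep (?first d) g else 0) x =
            (\<Sum>d\<in>B. if d = c then (if G b c then g x else 0) else 0)"
          unfolding sum_fun_apply by (rule sum.cong) (auto simp: x w)
        also have "\<dots> = (if G b c then g x else 0)"
          using c W1.finite_letters by simp
        finally show ?thesis
          using jw W0.Cons_Cons_iff[of j b c w'] by (auto simp: x w W0.push_def W0.total_def)
      qed
    qed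
    also have "\<dots> \<in> V l"
    proof (rule fvs.subspace_sum[OF V_sub])
      fix c assume "c \<in> B"
      then show "(if G b c then keep (?first c) g else 0) \<in> V l"
        using keep_V[OF g] fvs.subspace_0[OF V_sub] by simp
    qed
    finally show ?thesis .
  qed
  have V_Suc: "f \<in> V (Suc l) \<longleftrightarrow> (\<forall>b\<in>B. after b f \<in> V l)"
    if f: "f \<in> finfuns (W0.slice (\<lambda>j. nat (n - i0 j)) (Suc l))" for l f
  proof
    assume "\<forall>b\<in>B. after b f \<in> V l"
    then have "\<forall>b\<in>B. \<exists>q. q \<in> ?S (n + int l) \<and> after b f = \<delta> q"
      unfolding V_def by blast
    then obtain q where q: "\<And>b. b \<in> B \<Longrightarrow> q b \<in> ?S (n + int l)" "\<And>b. b \<in> B \<Longrightarrow> after b f = \<delta> (q b)"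
      by (auto dest!: bchoice)
    have f_grade: "f \<in> finfuns (grade W0.total (proj_degree i0) (n + int (Suc l)))"
      using f by (simp only: slice)
    have f_total: "f \<in> finfuns W0.total"
      by (rule finfuns_gradeD[OF f_grade])
    have Nil: "f (j, []) = 0" for j
      using W0.grade_proj_degree_Nil[OF f_grade] n(2) by force
    have q_total: "q b \<in> finfuns W1.total" if "b \<in> B" for b
      by (rule finfuns_gradeD[OF q(1)[OF that]])
    have "f = (\<Sum>b\<in>B. W0.push b (after b f))"
      by (simp only: W0.push_after[OF f_total Nil] W0.sum_keep_first[OF f_total Nil])
    also have "\<dots> = (\<Sum>b\<in>B. \<delta> (W1.push b (q b)))"
      by (rule sum.cong[OF refl]) (simp add: q(2) push q_total)
    also have "\<dots> = \<delta> (\<Sum>b\<in>B. W1.push b (q b))"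
      by (rule graded_linear_sum[OF \<delta> W1.finite_letters, symmetric]) (rule W1.push_finfuns[OF q_total])
    also have "\<dots> \<in> V (Suc l)"
      unfolding V_def using W1.push_grade_proj_degree[OF q(1)]
      by (intro imageI finfuns_sum) (simp add: add_ac)
    finally show "f \<in> V (Suc l)" .
  qed (use after_V in blast)
  have "\<exists>D::nat \<Rightarrow> 'a \<Rightarrow> nat. \<forall>l. fvs.dim (V l) = (\<Sum>b\<in>B. D l b) \<and>
    (\<forall>b\<in>B. D (Suc l) b = (\<Sum>c\<in>B. if G b c then D l c else 0))"
  proof (rule W0.shift_recurrence[OF _ V_sub V_slice V_Suc keep_V])
    show "1 \<le> nat (n - i0 j)" if "j < J0" for j
      using n(2)[OF that] by simp
  qed
  then show ?thesis
    by (simp add: V_def)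
qed

text \<open>
  Below all the degrees \<open>i1 j\<close>, functions in the target are supported on nonempty words, so \<open>\<delta> f\<close>
  vanishes if and only if \<open>after b (\<delta> f) = \<delta> (after b f)\<close> does for all letters \<open>b\<close>.
\<close>

lemma kernel_recurrence:
  fixes \<delta> :: "(nat \<times> 'a list \<Rightarrow> 'k::field) \<Rightarrow> nat \<times> 'a list \<Rightarrow> 'k"
  assumes W0: "word_system B G J0 X0" and W1: "word_system B G J1 X1"
    and \<delta>: "graded_linear (word_system.total J0 X0) (inj_degree i0) (word_system.total J1 X1) (inj_degree i1) \<delta>"
    and after: "\<And>b f. b \<in> B \<Longrightarrow> f \<in> finfuns (word_system.total J0 X0) \<Longrightarrow> \<delta> (after b f) = after b (\<delta> f)"
    and n: "\<And>j. j < J0 \<Longrightarrow> n < i0 j" "\<And>j. j < J1 \<Longrightarrow> n < i1 j"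
  shows "\<exists>D::nat \<Rightarrow> 'a \<Rightarrow> nat. \<forall>l.
    fvs.dim {f \<in> finfuns (grade (word_system.total J0 X0) (inj_degree i0) (n - int l)). \<delta> f = 0} = (\<Sum>b\<in>B. D l b) \<and>
    (\<forall>b\<in>B. D (Suc l) b = (\<Sum>c\<in>B. if G b c then D l c else 0))"
proof -
  interpret W0: word_system B G J0 X0 by (rule W0)
  interpret W1: word_system B G J1 X1 by (rule W1)
  let ?S = "\<lambda>m. finfuns (grade W0.total (inj_degree i0) m) :: (nat \<times> 'a list \<Rightarrow> 'k) set"
  let ?first = "\<lambda>b. \<lambda>x::nat \<times> 'a list. hd (snd x) = b"
  define V where "V l = {f \<in> ?S (n - int l). \<delta> f = 0}" for l
  have slice: "grade W0.total (inj_degree i0) (n - int l) = W0.slice (\<lambda>j. nat (i0 j - n)) l" for l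
    by (rule W0.grade_inj_degree_eq_slice[OF n(1)])
  have S_total: "f \<in> finfuns W0.total" if "f \<in> ?S m" for f m
    using that by (rule finfuns_gradeD)
  have V_sub: "fvs.subspace (V l)" for l
    unfolding V_def
    by (rule subspace_graded_linear_kernel[OF \<delta> subspace_finfuns]) (use finfuns_gradeD in blast)
  have V_slice: "V l \<subseteq> finfuns (W0.slice (\<lambda>j. nat (i0 j - n)) l)" for l
    by (auto simp: V_def slice)
  have vanish: "\<delta> f = 0 \<longleftrightarrow> (\<forall>b\<in>B. \<delta> (after b f) = 0)" if f: "f \<in> ?S m" and m: "m \<le> n" for f m
  proof -
    have \<delta>f: "\<delta> f \<in> finfuns (grade W1.total (inj_degree i1) m)"
      using \<delta> f unfolding graded_linear_def by blast
    have Nil: "\<delta> f (j, []) = 0" for j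
      using W1.grade_inj_degree_Nil[OF \<delta>f] n(2) m by force
    have "\<delta> f = (\<Sum>b\<in>B. W1.push b (after b (\<delta> f)))"
      by (simp only: W1.push_after[OF finfuns_gradeD[OF \<delta>f] Nil] W1.sum_keep_first[OF finfuns_gradeD[OF \<delta>f] Nil])
    also have "\<dots> = (\<Sum>b\<in>B. W1.push b (\<delta> (after b f)))"
      by (rule sum.cong[OF refl]) (simp add: after S_total[OF f])
    finally have "\<delta> f = (\<Sum>b\<in>B. W1.push b (\<delta> (after b f)))" .
    moreover have "W1.push b (0 :: nat \<times> 'a list \<Rightarrow> 'k) = 0" for b
      by (auto simp: W1.push_def fun_eq_iff)
    moreover have "\<delta> (after b f) = 0" if "\<delta> f = 0" "b \<in> B" for b
      using after[OF that(2) S_total[OF f]] that(1) by (auto simp: fun_eq_iff)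
    ultimately show ?thesis
      by (metis (no_types, lifting) sum.neutral)
  qed
  have after_S: "after b f \<in> ?S (n - int l)" if "f \<in> ?S (n - int (Suc l))" for b f l
    using W0.after_grade_inj_degree[OF that, of b] by simp
  have V_Suc: "f \<in> V (Suc l) \<longleftrightarrow> (\<forall>b\<in>B. after b f \<in> V l)"
    if f: "f \<in> finfuns (W0.slice (\<lambda>j. nat (i0 j - n)) (Suc l))" for l f
  proof -
    have f: "f \<in> ?S (n - int (Suc l))"
      using f by (simp only: slice)
    with vanish[OF f] after_S[OF f] show ?thesis
      by (simp add: V_def)
  qed
  have V_0: "keep (?first b) f \<in> V 0" if f: "f \<in> V 0" and b: "b \<in> B" for f b
  proof -
    have fS: "f \<in> ?S n" and \<delta>f: "\<delta> f = 0"
      using f by (simp_all add: V_def)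
    have "\<delta> (after c (keep (?first b) f)) = 0" if "c \<in> B" for c
    proof -
      have "after c (keep (?first b) f) = (if c = b then after c f else 0)"
        by (auto simp: fun_eq_iff)
      moreover have "\<delta> (after c f) = 0"
        using vanish[OF fS order_refl] \<delta>f that by blast
      ultimately show ?thesis
        using graded_linear_zero[OF \<delta>] by (cases "c = b") simp_all
    qed
    then have "\<delta> (keep (?first b) f) = 0"
      using vanish[OF finfuns_keep[OF fS] order_refl] by blast
    then show ?thesis
      using finfuns_keep[OF fS] by (simp add: V_def)
  qed
  have "\<exists>D::nat \<Rightarrow> 'a \<Rightarrow> nat. \<forall>l. fvs.dim (V l) = (\<Sum>b\<in>B. D l b) \<and>
    (\<forall>b\<in>B. D (Suc l) b = (\<Sum>c\<in>B. if G b c then D l c else 0))"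
  proof (rule W0.shift_recurrence[OF _ V_sub V_slice V_Suc V_0])
    show "1 \<le> nat (i0 j - n)" if "j < J0" for j
      using n(1)[OF that] by simp
  qed
  then show ?thesis
    by (simp add: V_def)
qed

section \<open>Graded modules in coordinates\<close>

text \<open>
  A graded module with a homogeneous basis indexed by \<open>X\<close>; the map \<open>\<kappa>\<close> sends an element to its family of
  coefficients.
\<close>

locale coordinates =
  fixes A :: "('a, 'k::field) graded_algebra" and P :: "('a, 'p) graded_module"
    and X :: "'x set" and deg :: "'x \<Rightarrow> int" and \<kappa> :: "'p \<Rightarrow> 'x \<Rightarrow> 'k"
  assumes bij: "bij_betw \<kappa> (carrier P) (finfuns X)"
    and add_closed: "\<And>p q. p \<in> carrier P \<Longrightarrow> q \<in> carrier P \<Longrightarrow> p \<oplus>\<^bsub>P\<^esub> q \<in> carrier P"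
    and coord_add: "\<And>p q. p \<in> carrier P \<Longrightarrow> q \<in> carrier P \<Longrightarrow> \<kappa> (p \<oplus>\<^bsub>P\<^esub> q) = \<kappa> p + \<kappa> q"
    and scalar_closed: "\<And>c p. p \<in> carrier P \<Longrightarrow> scalar A c \<odot>\<^bsub>P\<^esub> p \<in> carrier P"
    and coord_scalar: "\<And>c p. p \<in> carrier P \<Longrightarrow> \<kappa> (scalar A c \<odot>\<^bsub>P\<^esub> p) = fscale c (\<kappa> p)"
    and zero_closed: "\<zero>\<^bsub>P\<^esub> \<in> carrier P"
    and coord_zero: "\<kappa> \<zero>\<^bsub>P\<^esub> = 0"
    and mcomp_eq: "\<And>m. mcomp P m = {p \<in> carrier P. \<kappa> p \<in> finfuns (grade X deg m)}"
begin

definition of_coord :: "('x \<Rightarrow> 'k) \<Rightarrow> 'p" where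
  "of_coord = inv_into (carrier P) \<kappa>"

lemma of_coord_closed: "f \<in> finfuns X \<Longrightarrow> of_coord f \<in> carrier P"
  using bij_betw_imp_surj_on[OF bij] unfolding of_coord_def by (blast intro: inv_into_into)

lemma coord_of_coord: "f \<in> finfuns X \<Longrightarrow> \<kappa> (of_coord f) = f"
  unfolding of_coord_def by (rule bij_betw_inv_into_right[OF bij])

lemma of_coord_coord: "p \<in> carrier P \<Longrightarrow> of_coord (\<kappa> p) = p"
  unfolding of_coord_def by (rule bij_betw_inv_into_left[OF bij])

lemma coord_closed: "p \<in> carrier P \<Longrightarrow> \<kappa> p \<in> finfuns X"
  using bij_betw_imp_surj_on[OF bij] by blast

lemma coord_inj: "p \<in> carrier P \<Longrightarrow> q \<in> carrier P \<Longrightarrow> \<kappa> p = \<kappa> q \<Longrightarrow> p = q"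
  using of_coord_coord by metis

lemma of_coord_add: "f \<in> finfuns X \<Longrightarrow> g \<in> finfuns X \<Longrightarrow> of_coord (f + g) = of_coord f \<oplus>\<^bsub>P\<^esub> of_coord g"
  by (rule coord_inj) (simp_all only: of_coord_closed add_closed finfuns_add coord_add coord_of_coord)

lemma of_coord_fscale: "f \<in> finfuns X \<Longrightarrow> of_coord (fscale c f) = scalar A c \<odot>\<^bsub>P\<^esub> of_coord f"
  by (rule coord_inj) (simp_all only: of_coord_closed scalar_closed finfuns_fscale coord_scalar coord_of_coord)

lemma of_coord_mcomp: "f \<in> finfuns (grade X deg m) \<Longrightarrow> of_coord f \<in> mcomp P m"
  by (simp add: mcomp_eq of_coord_closed coord_of_coord finfuns_gradeD)

end

text \<open>
  The properties of the structure map that make homogeneous components of modules into vector spaces.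
\<close>

locale scalar_algebra =
  fixes A :: "('a, 'k::field) graded_algebra"
  assumes scalar_in: "\<And>c. scalar A c \<in> carrier A"
    and scalar_degree: "\<And>c. scalar A c \<in> acomp A 0"
    and scalar_add: "\<And>c d. scalar A (c + d) = scalar A c \<oplus>\<^bsub>A\<^esub> scalar A d"
    and scalar_mult: "\<And>c d. scalar A (c * d) = scalar A c \<otimes>\<^bsub>A\<^esub> scalar A d"
    and scalar_one: "scalar A 1 = \<one>\<^bsub>A\<^esub>"

locale scalar_module = scalar_algebra A + graded_left_module A M
  for A :: "('a, 'k::field) graded_algebra" and M :: "('a, 'm) graded_module"
begin

lemma mcomp_subset: "mcomp M n \<subseteq> carrier M"
  using comp_subgroup by (rule additive_subgroup.a_subset)

lemma vectorspace_comp_space: "vectorspace class_ring (comp_space A M n)"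
proof -
  interpret N: additive_subgroup "mcomp M n" M
    by (rule comp_subgroup)
  show ?thesis
  proof (rule vs_criteria)
    show "\<forall>v\<in>carrier (comp_space A M n). \<exists>w\<in>carrier (comp_space A M n).
        v \<oplus>\<^bsub>comp_space A M n\<^esub> w = \<zero>\<^bsub>comp_space A M n\<^esub>"
    proof
      fix v assume "v \<in> carrier (comp_space A M n)"
      then have v: "v \<in> mcomp M n"
        by (simp add: comp_space_def)
      then have "\<ominus>\<^bsub>M\<^esub> v \<in> mcomp M n" "v \<oplus>\<^bsub>M\<^esub> \<ominus>\<^bsub>M\<^esub> v = \<zero>\<^bsub>M\<^esub>"
        using mcomp_subset M.r_neg by auto
      then show "\<exists>w\<in>carrier (comp_space A M n). v \<oplus>\<^bsub>comp_space A M n\<^esub> w = \<zero>\<^bsub>comp_space A M n\<^esub>"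
        by (auto simp: comp_space_def)
    qed
    have "scalar A c \<odot>\<^bsub>M\<^esub> v \<in> mcomp M n" if "v \<in> mcomp M n" for c v
      using comp_smult[OF scalar_degree that, of c] by simp
    then show "\<forall>c v. c \<in> carrier class_ring \<and> v \<in> carrier (comp_space A M n) \<longrightarrow>
        c \<odot>\<^bsub>comp_space A M n\<^esub> v \<in> carrier (comp_space A M n)"
      by (simp add: comp_space_def)
  qed (use mcomp_subset in \<open>auto simp: comp_space_def class_field scalar_add scalar_mult scalar_one scalar_in
      smult_l_distr smult_r_distr smult_assoc smult_one M.a_ac subset_iff\<close>)
qed

lemma homogeneous_summand:
  assumes F: "finite F" and c: "\<And>n. n \<in> F \<Longrightarrow> c n \<in> mcomp M n"
    and x: "(\<Oplus>\<^bsub>M\<^esub>n\<in>F. c n) \<in> mcomp M m"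
  shows "(\<Oplus>\<^bsub>M\<^esub>n\<in>F. c n) = (if m \<in> F then c m else \<zero>\<^bsub>M\<^esub>)"
proof -
  define x where "x = (\<Oplus>\<^bsub>M\<^esub>n\<in>F. c n)"
  \<comment> \<open>two decompositions of the same element into homogeneous components, which have to agree\<close>
  define c1 where "c1 n = (if n \<in> F then c n else \<zero>\<^bsub>M\<^esub>)" for n
  define c2 where "c2 n = (if n = m then x else \<zero>\<^bsub>M\<^esub>)" for n
  let ?P = "\<lambda>c. (\<forall>n. c n \<in> mcomp M n) \<and> finite {n. c n \<noteq> \<zero>\<^bsub>M\<^esub>} \<and>
    x = (\<Oplus>\<^bsub>M\<^esub>n\<in>{n. c n \<noteq> \<zero>\<^bsub>M\<^esub>}. c n)"
  have zero: "\<zero>\<^bsub>M\<^esub> \<in> mcomp M n" for n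
    using comp_subgroup by (rule additive_subgroup.zero_closed)
  have xm: "x \<in> mcomp M m"
    using x by (simp add: x_def)
  have "finite {n. c1 n \<noteq> \<zero>\<^bsub>M\<^esub>}"
    using F by (rule finite_subset[rotated]) (auto simp: c1_def)
  moreover have "x = (\<Oplus>\<^bsub>M\<^esub>n\<in>{n. c1 n \<noteq> \<zero>\<^bsub>M\<^esub>}. c1 n)"
    unfolding x_def
  proof (rule M.add.finprod_mono_neutral_cong_right[OF F])
    show "c \<in> F \<rightarrow> carrier M"
      using c mcomp_subset by blast
  qed (auto simp: c1_def split: if_splits)
  ultimately have "?P c1"
    using c zero by (simp add: c1_def)
  moreover have "?P c2"
  proof -
    have "{n. c2 n \<noteq> \<zero>\<^bsub>M\<^esub>} = (if x = \<zero>\<^bsub>M\<^esub> then {} else {m})"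
      by (auto simp: c2_def)
    then show ?thesis
      using xm zero mcomp_subset[of m] by (auto simp: c2_def)
  qed
  moreover have "\<exists>!c. ?P c"
    using xm mcomp_subset by (intro comp_direct_sum) blast
  ultimately have "c1 = c2"
    by blast
  then have "c1 m = c2 m"
    by simp
  then show ?thesis
    by (simp add: c1_def c2_def flip: x_def)
qed

end

lemma graded_hom_mcomp: "d \<in> graded_hom A P P' \<Longrightarrow> p \<in> mcomp P m \<Longrightarrow> d p \<in> mcomp P' m"
  unfolding graded_hom_def by blast

lemma graded_hom_coordinates:
  assumes "coordinates A P X deg \<kappa>" and "coordinates A P' X' deg' \<kappa>'" and "scalar_algebra A"
    and d: "d \<in> graded_hom A P P'"
  shows "graded_linear X deg X' deg' (\<lambda>f. \<kappa>' (d (coordinates.of_coord P \<kappa> f)))"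
proof -
  interpret P: coordinates A P X deg \<kappa> by fact
  interpret P': coordinates A P' X' deg' \<kappa>' by fact
  interpret A: scalar_algebra A by fact
  have d_closed: "d p \<in> carrier P'" if "p \<in> carrier P" for p
    using d that by (auto simp: graded_hom_def)
  have d_add: "d (p \<oplus>\<^bsub>P\<^esub> q) = d p \<oplus>\<^bsub>P'\<^esub> d q" if "p \<in> carrier P" "q \<in> carrier P" for p q
    using d that by (simp add: graded_hom_def)
  have d_scalar: "d (scalar A c \<odot>\<^bsub>P\<^esub> p) = scalar A c \<odot>\<^bsub>P'\<^esub> d p" if "p \<in> carrier P" for p c
    using d that A.scalar_in by (simp add: graded_hom_def)
  note d_mcomp = graded_hom_mcomp[OF d]
  show ?thesis
    unfolding graded_linear_def
  proof (intro conjI allI ballI)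
    show "\<kappa>' (d (P.of_coord f)) \<in> finfuns X'" if "f \<in> finfuns X" for f
      by (intro P'.coord_closed d_closed P.of_coord_closed that)
    show "\<kappa>' (d (P.of_coord (f + g))) = \<kappa>' (d (P.of_coord f)) + \<kappa>' (d (P.of_coord g))" if "f \<in> finfuns X" "g \<in> finfuns X" for f g
      using that by (simp add: P.of_coord_add d_add P'.coord_add d_closed P.of_coord_closed)
    show "\<kappa>' (d (P.of_coord (fscale c f))) = fscale c (\<kappa>' (d (P.of_coord f)))" if "f \<in> finfuns X" for c f
      using that by (simp add: P.of_coord_fscale d_scalar P'.coord_scalar d_closed P.of_coord_closed)
    show "\<kappa>' (d (P.of_coord f)) \<in> finfuns (grade X' deg' m)" if "f \<in> finfuns (grade X deg m)" for m f
      using d_mcomp[OF P.of_coord_mcomp[OF that]] by (simp add: P'.mcomp_eq)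
  qed
qed

lemma finite_upper_bound: "\<exists>n. \<forall>j<J. i j < (n::int)" for i :: "nat \<Rightarrow> int"
proof (induction J)
  case (Suc J)
  then obtain n where "\<forall>j<J. i j < n"
    by blast
  then have "\<forall>j<Suc J. i j < max n (i J + 1)"
    by (auto simp: less_Suc_eq)
  then show ?case
    by blast
qed simp

lemma finite_lower_bound: "\<exists>n. \<forall>j<J. (n::int) < i j" for i :: "nat \<Rightarrow> int"
proof -
  obtain n where "\<forall>j<J. - i j < n"
    using finite_upper_bound[of J "\<lambda>j. - i j"] by blast
  then have "\<forall>j<J. - n < i j"
    by force
  then show ?thesis
    by blast
qed

text \<open>
  Under the coordinates \<open>d\<close> becomes a graded map \<open>\<delta>\<close> of function spaces that commutes with \<open>push\<close>, and the
  component of \<open>M\<close> in degree \<open>m\<close> becomes the quotient of all functions of degree \<open>m\<close> by the image of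
  \<open>\<delta>\<close>. Both dimensions satisfy the same recurrence from the degree \<open>n\<close> on, hence so does
  their difference.
\<close>

theorem presented_rational:
  fixes A :: "('r, 'k::field) graded_algebra" and M :: "('r, 'm) graded_module"
    and P1 :: "('r, 'p) graded_module" and P0 :: "('r, 'q) graded_module"
    and B :: "'a set"
  assumes M: "scalar_module A M"
    and W1: "word_system B G J1 X1" and W0: "word_system B G J0 X0"
    and P1: "coordinates A P1 (word_system.total J1 X1) (proj_degree i1) \<kappa>1"
    and P0: "coordinates A P0 (word_system.total J0 X0) (proj_degree i0) \<kappa>0"
    and arr: "\<And>b. b \<in> B \<Longrightarrow> arr b \<in> carrier A"
    and act1: "\<And>b p. b \<in> B \<Longrightarrow> p \<in> carrier P1 \<Longrightarrow>
      arr b \<odot>\<^bsub>P1\<^esub> p \<in> carrier P1 \<and> \<kappa>1 (arr b \<odot>\<^bsub>P1\<^esub> p) = word_system.push J1 X1 b (\<kappa>1 p)"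
    and act0: "\<And>b p. b \<in> B \<Longrightarrow> p \<in> carrier P0 \<Longrightarrow>
      arr b \<odot>\<^bsub>P0\<^esub> p \<in> carrier P0 \<and> \<kappa>0 (arr b \<odot>\<^bsub>P0\<^esub> p) = word_system.push J0 X0 b (\<kappa>0 p)"
    and d: "d \<in> graded_hom A P1 P0" and \<epsilon>: "\<epsilon> \<in> graded_hom A P0 M"
    and exact: "d ` carrier P1 = {p \<in> carrier P0. \<epsilon> p = \<zero>\<^bsub>M\<^esub>}"
    and surj: "\<epsilon> ` carrier P0 = carrier M"
  shows "rational_in_t (comp_dim A M)"
proof -
  interpret M: scalar_module A M by fact
  interpret W1: word_system B G J1 X1 by (rule W1)
  interpret W0: word_system B G J0 X0 by (rule W0)
  interpret P1: coordinates A P1 W1.total "proj_degree i1" \<kappa>1 by (rule P1)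
  interpret P0: coordinates A P0 W0.total "proj_degree i0" \<kappa>0 by (rule P0)
  define \<delta> where "\<delta> = (\<lambda>f. \<kappa>0 (d (P1.of_coord f)))"
  define e where "e f = \<epsilon> (P0.of_coord f)" for f
  let ?S0 = "\<lambda>m. finfuns (grade W0.total (proj_degree i0) m) :: (nat \<times> 'a list \<Rightarrow> 'k) set"
  let ?S1 = "\<lambda>m. finfuns (grade W1.total (proj_degree i1) m) :: (nat \<times> 'a list \<Rightarrow> 'k) set"
  have \<delta>: "graded_linear W1.total (proj_degree i1) W0.total (proj_degree i0) \<delta>"
    unfolding \<delta>_def by (rule graded_hom_coordinates[OF P1 P0 M.scalar_algebra_axioms d])
  have d_closed: "d p \<in> carrier P0" if "p \<in> carrier P1" for p
    using d that by (auto simp: graded_hom_def)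
  have e_closed: "e f \<in> carrier M" if "f \<in> finfuns W0.total" for f
    using \<epsilon> P0.of_coord_closed[OF that] by (auto simp: graded_hom_def e_def)
  have e_add: "e (f + g) = e f \<oplus>\<^bsub>M\<^esub> e g" if "f \<in> finfuns W0.total" "g \<in> finfuns W0.total" for f g
    using \<epsilon> P0.of_coord_closed[OF that(1)] P0.of_coord_closed[OF that(2)]
    by (simp add: graded_hom_def e_def P0.of_coord_add that)
  have e_scale: "e (fscale c f) = scalar A c \<odot>\<^bsub>M\<^esub> e f" if "f \<in> finfuns W0.total" for f c
    using \<epsilon> P0.of_coord_closed[OF that] M.scalar_in
    by (simp add: graded_hom_def e_def P0.of_coord_fscale that)
  have e_mcomp: "e f \<in> mcomp M m" if "f \<in> ?S0 m" for f m
    unfolding e_def by (rule graded_hom_mcomp[OF \<epsilon> P0.of_coord_mcomp[OF that]])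
  have e_zero: "e 0 = \<zero>\<^bsub>M\<^esub>"
  proof -
    have "e 0 \<oplus>\<^bsub>M\<^esub> e 0 = e 0"
      using e_add[OF finfuns_zero finfuns_zero] by simp
    then show ?thesis
      using e_closed[OF finfuns_zero] by (metis M.M.add.r_cancel_one')
  qed
  have e_sum: "e (\<Sum>i\<in>I. f i) = (\<Oplus>\<^bsub>M\<^esub>i\<in>I. e (f i))"
    if "finite I" "\<And>i. i \<in> I \<Longrightarrow> f i \<in> finfuns W0.total" for I :: "int set" and f
    using that
  proof (induction I rule: finite_induct)
    case empty
    show ?case
      by (simp only: sum.empty M.M.finsum_empty e_zero)
  next
    case (insert i I)
    have f: "f j \<in> finfuns W0.total" if "j \<in> insert i I" for j
      by (rule insert.prems[OF that])
    have "e (f i + (\<Sum>i\<in>I. f i)) = e (f i) \<oplus>\<^bsub>M\<^esub> e (\<Sum>i\<in>I. f i)"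
      using f by (intro e_add finfuns_sum) auto
    moreover have "e (\<Sum>i\<in>I. f i) = (\<Oplus>\<^bsub>M\<^esub>i\<in>I. e (f i))"
      by (rule insert.IH) (simp add: f)
    moreover have "(\<Oplus>\<^bsub>M\<^esub>i\<in>insert i I. e (f i)) = e (f i) \<oplus>\<^bsub>M\<^esub> (\<Oplus>\<^bsub>M\<^esub>i\<in>I. e (f i))"
      using insert.hyps f e_closed by (intro M.M.finsum_insert) auto
    ultimately show ?case
      by (simp only: sum.insert[OF insert.hyps])
  qed
  have image: "e ` ?S0 m = mcomp M m" for m
  proof
    show "e ` ?S0 m \<subseteq> mcomp M m"
      using e_mcomp by blast
    show "mcomp M m \<subseteq> e ` ?S0 m"
    proof
      fix x assume x: "x \<in> mcomp M m"
      then obtain p where p: "p \<in> carrier P0" "x = \<epsilon> p"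
        using M.mcomp_subset surj by blast
      define f where "f = \<kappa>0 p"
      have f: "f \<in> finfuns W0.total" "x = e f"
        using P0.coord_closed[OF p(1)] P0.of_coord_coord[OF p(1)] p(2) by (simp_all add: f_def e_def)
      let ?N = "proj_degree i0 ` {x. f x \<noteq> 0}"
      let ?f = "\<lambda>n. keep (\<lambda>x. proj_degree i0 x = n) f"
      have fin: "finite ?N"
        using f(1) by (simp add: finfuns_def)
      have "x = e (\<Sum>n\<in>?N. ?f n)"
        by (simp only: sum_homogeneous_parts[OF f(1)] f(2))
      also have "\<dots> = (\<Oplus>\<^bsub>M\<^esub>n\<in>?N. e (?f n))"
        by (rule e_sum[OF fin]) (rule finfuns_keep[OF f(1)])
      finally have sum: "x = (\<Oplus>\<^bsub>M\<^esub>n\<in>?N. e (?f n))" .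
      have "(\<Oplus>\<^bsub>M\<^esub>n\<in>?N. e (?f n)) = (if m \<in> ?N then e (?f m) else \<zero>\<^bsub>M\<^esub>)"
      proof (rule M.homogeneous_summand[OF fin])
        show "e (?f n) \<in> mcomp M n" for n
          by (rule e_mcomp[OF finfuns_keep_grade[OF f(1)]])
        show "(\<Oplus>\<^bsub>M\<^esub>n\<in>?N. e (?f n)) \<in> mcomp M m"
          using x sum by simp
      qed
      then have "x = e (?f m) \<or> x = e 0"
        using sum e_zero by presburger
      then show "x \<in> e ` ?S0 m"
        using finfuns_keep_grade[OF f(1)] finfuns_zero by blast
    qed
  qed
  have kernel: "{f \<in> ?S0 m. e f = \<zero>\<^bsub>M\<^esub>} = \<delta> ` ?S1 m" for m
  proof (intro equalityI subsetI)
    fix f assume "f \<in> {f \<in> ?S0 m. e f = \<zero>\<^bsub>M\<^esub>}"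
    then have f: "f \<in> ?S0 m" "e f = \<zero>\<^bsub>M\<^esub>"
      by auto
    have "P0.of_coord f \<in> d ` carrier P1"
      using f exact P0.of_coord_closed[OF finfuns_gradeD[OF f(1)]] by (simp add: e_def)
    then obtain q where q: "q \<in> carrier P1" "P0.of_coord f = d q"
      by blast
    define g where "g = \<kappa>1 q"
    have g: "g \<in> finfuns W1.total" "\<delta> g = f"
      using P1.coord_closed[OF q(1)] P1.of_coord_coord[OF q(1)] q(2) P0.coord_of_coord[OF finfuns_gradeD[OF f(1)]]
      by (simp_all add: g_def \<delta>_def)
    have "f = keep (\<lambda>x. proj_degree i0 x = m) f"
      using keep_grade[OF f(1), of m] by simp
    also have "\<dots> = \<delta> (keep (\<lambda>x. proj_degree i1 x = m) g)"
      using graded_linear_keep[OF \<delta> g(1), of m] g(2) by simp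
    finally show "f \<in> \<delta> ` ?S1 m"
      using finfuns_keep_grade[OF g(1)] by blast
  next
    fix f assume "f \<in> \<delta> ` ?S1 m"
    then obtain g where g: "g \<in> ?S1 m" "f = \<delta> g"
      by blast
    have "f \<in> ?S0 m"
      using \<delta> g unfolding graded_linear_def by blast
    moreover have "d (P1.of_coord g) \<in> {p \<in> carrier P0. \<epsilon> p = \<zero>\<^bsub>M\<^esub>}"
      using exact P1.of_coord_closed[OF finfuns_gradeD[OF g(1)]] by blast
    then have "e f = \<zero>\<^bsub>M\<^esub>"
      by (simp add: e_def g(2) \<delta>_def P0.of_coord_coord)
    ultimately show "f \<in> {f \<in> ?S0 m. e f = \<zero>\<^bsub>M\<^esub>}"
      by simp
  qed
  have dim: "comp_dim A M m + fvs.dim (\<delta> ` ?S1 m) = fvs.dim (?S0 m)" for m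
    unfolding comp_dim_def kernel[symmetric]
  proof -
    let ?V = "comp_space A M m"
    have "vectorspace.dim class_ring ?V + fvs.dim {f \<in> ?S0 m. e f = \<zero>\<^bsub>?V\<^esub>} = fvs.dim (?S0 m)"
    proof (rule dim_surj_fun_space[OF M.vectorspace_comp_space subspace_finfuns W0.finite_grade_proj_degree order_refl])
      show "e ` ?S0 m = carrier ?V"
        by (simp add: comp_space_def image)
      show "e (f + g) = e f \<oplus>\<^bsub>?V\<^esub> e g" if "f \<in> ?S0 m" "g \<in> ?S0 m" for f g
        using e_add[OF finfuns_gradeD[OF that(1)] finfuns_gradeD[OF that(2)]] by (simp add: comp_space_def)
      show "e (fscale c f) = c \<odot>\<^bsub>?V\<^esub> e f" if "f \<in> ?S0 m" for c f
        using e_scale[OF finfuns_gradeD[OF that]] by (simp add: comp_space_def)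
    qed
    then show "vectorspace.dim class_ring ?V + fvs.dim {f \<in> ?S0 m. e f = \<zero>\<^bsub>M\<^esub>} = fvs.dim (?S0 m)"
      by (simp add: comp_space_def)
  qed
  obtain n1 where n1: "\<forall>j<J1. i1 j < n1"
    using finite_upper_bound by blast
  obtain n0 where n0: "\<forall>j<J0. i0 j < n0"
    using finite_upper_bound by blast
  obtain a where a: "\<forall>j<J0. a < i0 j"
    using finite_lower_bound by blast
  define n where "n = max n0 n1"
  have n: "i1 j < n" if "j < J1" for j
    using n1 that by (auto simp: n_def)
  have n': "i0 j < n" if "j < J0" for j
    using n0 that by (auto simp: n_def)
  have push: "\<delta> (W1.push b f) = W0.push b (\<delta> f)" if b: "b \<in> B" and f: "f \<in> finfuns W1.total" for b f
  proof -
    have "P1.of_coord (W1.push b f) = arr b \<odot>\<^bsub>P1\<^esub> P1.of_coord f"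
      using act1[OF b P1.of_coord_closed[OF f]] P1.of_coord_coord[of "arr b \<odot>\<^bsub>P1\<^esub> P1.of_coord f"] P1.coord_of_coord[OF f] by simp
    moreover have "d (arr b \<odot>\<^bsub>P1\<^esub> P1.of_coord f) = arr b \<odot>\<^bsub>P0\<^esub> d (P1.of_coord f)"
      using d arr[OF b] P1.of_coord_closed[OF f] by (simp add: graded_hom_def)
    ultimately show ?thesis
      using act0[OF b d_closed[OF P1.of_coord_closed[OF f]]] by (simp add: \<delta>_def)
  qed
  obtain D1 :: "nat \<Rightarrow> 'a \<Rightarrow> nat" where "\<forall>l. fvs.dim (\<delta> ` ?S1 (n + int l)) = (\<Sum>b\<in>B. D1 l b) \<and>
      (\<forall>b\<in>B. D1 (Suc l) b = (\<Sum>c\<in>B. if G b c then D1 l c else 0))"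
    using image_recurrence[OF W1 W0 \<delta> push n n'] by (rule exE)
  then have D1: "\<And>l. fvs.dim (\<delta> ` ?S1 (n + int l)) = (\<Sum>b\<in>B. D1 l b)"
    "\<And>l b. b \<in> B \<Longrightarrow> D1 (Suc l) b = (\<Sum>c\<in>B. if G b c then D1 l c else 0)"
    by simp_all
  \<comment> \<open>the image of the identity is the whole module \<open>P0\<close>\<close>
  have id: "graded_linear W0.total (proj_degree i0) W0.total (proj_degree i0) (\<lambda>f :: nat \<times> 'a list \<Rightarrow> 'k. f)"
    by (simp add: graded_linear_def)
  obtain D0 :: "nat \<Rightarrow> 'a \<Rightarrow> nat" where "\<forall>l. fvs.dim (?S0 (n + int l)) = (\<Sum>b\<in>B. D0 l b) \<and>
      (\<forall>b\<in>B. D0 (Suc l) b = (\<Sum>c\<in>B. if G b c then D0 l c else 0))"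
    using image_recurrence[OF W0 W0 id refl n' n'] unfolding image_ident by (rule exE)
  then have D0: "\<And>l. fvs.dim (?S0 (n + int l)) = (\<Sum>b\<in>B. D0 l b)"
    "\<And>l b. b \<in> B \<Longrightarrow> D0 (Suc l) b = (\<Sum>c\<in>B. if G b c then D0 l c else 0)"
    by simp_all
  define D where "D l b = (of_nat (D0 l b) - of_nat (D1 l b) :: rat)" for l b
  show ?thesis
  proof (rule rational_in_t_if_recurrence[where a = a and ?n0.0 = n and B = B and D = D
        and m = "\<lambda>b c. if G b c then 1 else 0"])
    show "comp_dim A M m = 0" if "m < a" for m
    proof -
      have "grade W0.total (proj_degree i0) m = {}"
        using a that by (force simp: grade_def proj_degree_def W0.total_def)
      then have "?S0 m \<subseteq> {0}"
        by (auto simp: finfuns_def fun_eq_iff)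
      then have "fvs.dim (?S0 m) = 0"
        by (rule dim_eq_0)
      with dim[of m] show ?thesis
        by simp
    qed
    show "finite B"
      by (rule W0.finite_letters)
    show "of_nat (comp_dim A M (n + int l)) = (\<Sum>b\<in>B. D l b)" for l
    proof -
      have "of_nat (comp_dim A M (n + int l)) + of_nat (\<Sum>b\<in>B. D1 l b) = (of_nat (\<Sum>b\<in>B. D0 l b) :: rat)"
        using dim[of "n + int l"] unfolding D0(1) D1(1) of_nat_add[symmetric] by simp
      then show ?thesis
        by (simp add: D_def sum_subtractf)
    qed
    show "D (Suc l) b = (\<Sum>c\<in>B. (if G b c then 1 else 0) * D l c)" if "b \<in> B" for l b
      unfolding D_def D0(2)[OF that] D1(2)[OF that] of_nat_sum sum_subtractf[symmetric]
      by (rule sum.cong) auto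
  qed
qed

text \<open>
  Under the coordinates the component of \<open>M\<close> in degree \<open>m\<close> becomes the kernel \<open>K m\<close> of a graded map \<open>\<delta>\<close>
  that commutes with \<open>after\<close>. The recurrence runs towards decreasing degrees, so it gives
  rationality for \<open>m \<mapsto> comp_dim A M (- m)\<close>.
\<close>

theorem copresented_rational:
  fixes A :: "('r, 'k::field) graded_algebra" and M :: "('r, 'm) graded_module"
    and P1 :: "('r, 'p) graded_module" and P0 :: "('r, 'q) graded_module"
    and B :: "'a set"
  assumes M: "scalar_module A M"
    and W0: "word_system B G J0 X0" and W1: "word_system B G J1 X1"
    and P0: "coordinates A P0 (word_system.total J0 X0) (inj_degree i0) \<kappa>0"
    and P1: "coordinates A P1 (word_system.total J1 X1) (inj_degree i1) \<kappa>1"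
    and arr: "\<And>b. b \<in> B \<Longrightarrow> arr b \<in> carrier A"
    and act0: "\<And>b p. b \<in> B \<Longrightarrow> p \<in> carrier P0 \<Longrightarrow>
      arr b \<odot>\<^bsub>P0\<^esub> p \<in> carrier P0 \<and> \<kappa>0 (arr b \<odot>\<^bsub>P0\<^esub> p) = after b (\<kappa>0 p)"
    and act1: "\<And>b p. b \<in> B \<Longrightarrow> p \<in> carrier P1 \<Longrightarrow>
      arr b \<odot>\<^bsub>P1\<^esub> p \<in> carrier P1 \<and> \<kappa>1 (arr b \<odot>\<^bsub>P1\<^esub> p) = after b (\<kappa>1 p)"
    and \<iota>: "\<iota> \<in> graded_hom A M P0" and d: "d \<in> graded_hom A P0 P1"
    and inj: "inj_on \<iota> (carrier M)"
    and exact: "\<iota> ` carrier M = {p \<in> carrier P0. d p = \<zero>\<^bsub>P1\<^esub>}"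
  shows "rational_in_t_inverse (comp_dim A M)"
proof -
  interpret M: scalar_module A M by fact
  interpret W1: word_system B G J1 X1 by (rule W1)
  interpret W0: word_system B G J0 X0 by (rule W0)
  interpret P1: coordinates A P1 W1.total "inj_degree i1" \<kappa>1 by (rule P1)
  interpret P0: coordinates A P0 W0.total "inj_degree i0" \<kappa>0 by (rule P0)
  define \<delta> where "\<delta> = (\<lambda>f. \<kappa>1 (d (P0.of_coord f)))"
  define t where "t x = \<kappa>0 (\<iota> x)" for x
  let ?S0 = "\<lambda>m. finfuns (grade W0.total (inj_degree i0) m) :: (nat \<times> 'a list \<Rightarrow> 'k) set"
  define K where "K m = {f \<in> ?S0 m. \<delta> f = 0}" for m
  have \<delta>: "graded_linear W0.total (inj_degree i0) W1.total (inj_degree i1) \<delta>"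
    unfolding \<delta>_def by (rule graded_hom_coordinates[OF P0 P1 M.scalar_algebra_axioms d])
  have d_closed: "d p \<in> carrier P1" if "p \<in> carrier P0" for p
    using d that by (auto simp: graded_hom_def)
  have \<iota>_closed: "\<iota> x \<in> carrier P0" if "x \<in> carrier M" for x
    using \<iota> that by (auto simp: graded_hom_def)
  have t_closed: "t x \<in> finfuns W0.total" if "x \<in> carrier M" for x
    unfolding t_def by (intro P0.coord_closed \<iota>_closed that)
  have t_add: "t (x \<oplus>\<^bsub>M\<^esub> y) = t x + t y" if "x \<in> carrier M" "y \<in> carrier M" for x y
    using \<iota> that by (simp add: t_def graded_hom_def P0.coord_add \<iota>_closed)
  have t_scale: "t (scalar A c \<odot>\<^bsub>M\<^esub> x) = fscale c (t x)" if "x \<in> carrier M" for x c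
    using \<iota> that M.scalar_in by (simp add: t_def graded_hom_def P0.coord_scalar \<iota>_closed)
  have t_mcomp: "t x \<in> ?S0 m" if "x \<in> mcomp M m" for x m
    using graded_hom_mcomp[OF \<iota> that] by (simp add: t_def P0.mcomp_eq)
  have t_inj: "inj_on t (carrier M)"
  proof (rule inj_onI)
    fix x y assume xy: "x \<in> carrier M" "y \<in> carrier M" "t x = t y"
    then have "\<iota> x = \<iota> y"
      using P0.coord_inj[OF \<iota>_closed \<iota>_closed] by (simp add: t_def)
    with xy inj show "x = y"
      by (auto dest: inj_onD)
  qed
  have t_zero: "t \<zero>\<^bsub>M\<^esub> = 0"
  proof -
    have "t \<zero>\<^bsub>M\<^esub> + t \<zero>\<^bsub>M\<^esub> = t \<zero>\<^bsub>M\<^esub>"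
      using t_add[of "\<zero>\<^bsub>M\<^esub>" "\<zero>\<^bsub>M\<^esub>"] by simp
    then show ?thesis
      by (simp only: add_cancel_left_right)
  qed
  have t_sum: "t (\<Oplus>\<^bsub>M\<^esub>i\<in>I. x i) = (\<Sum>i\<in>I. t (x i))"
    if "finite I" "\<And>i. i \<in> I \<Longrightarrow> x i \<in> carrier M" for I :: "int set" and x
    using that
  proof (induction I rule: finite_induct)
    case empty
    show ?case
      using t_zero by simp
  next
    case (insert i I)
    have x: "x j \<in> carrier M" if "j \<in> insert i I" for j
      by (rule insert.prems[OF that])
    have "(\<Oplus>\<^bsub>M\<^esub>i\<in>insert i I. x i) = x i \<oplus>\<^bsub>M\<^esub> (\<Oplus>\<^bsub>M\<^esub>i\<in>I. x i)"
      using insert.hyps x by (intro M.M.finsum_insert) auto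
    moreover have "t (x i \<oplus>\<^bsub>M\<^esub> (\<Oplus>\<^bsub>M\<^esub>i\<in>I. x i)) = t (x i) + t (\<Oplus>\<^bsub>M\<^esub>i\<in>I. x i)"
      using x by (intro t_add M.M.finsum_closed) auto
    moreover have "t (\<Oplus>\<^bsub>M\<^esub>i\<in>I. x i) = (\<Sum>i\<in>I. t (x i))"
      by (rule insert.IH) (simp add: x)
    ultimately show ?case
      by (simp only: sum.insert[OF insert.hyps])
  qed
  have \<delta>_zero_iff: "\<delta> f = 0 \<longleftrightarrow> f \<in> t ` carrier M" if f: "f \<in> finfuns W0.total" for f
  proof
    assume "\<delta> f = 0"
    then have "d (P0.of_coord f) = \<zero>\<^bsub>P1\<^esub>"
      using P1.coord_inj[OF d_closed[OF P0.of_coord_closed[OF f]] P1.zero_closed] P1.coord_zero by (simp add: \<delta>_def)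
    then have "P0.of_coord f \<in> \<iota> ` carrier M"
      using exact P0.of_coord_closed[OF f] by blast
    then show "f \<in> t ` carrier M"
      using P0.coord_of_coord[OF f] by (auto simp: t_def)
  next
    assume "f \<in> t ` carrier M"
    then obtain x where x: "x \<in> carrier M" "f = \<kappa>0 (\<iota> x)"
      by (auto simp: t_def)
    have "d (\<iota> x) = \<zero>\<^bsub>P1\<^esub>"
      using exact x(1) by blast
    then show "\<delta> f = 0"
      using P1.coord_zero P0.of_coord_coord[OF \<iota>_closed[OF x(1)]] by (simp add: \<delta>_def x(2))
  qed
  have image: "t ` mcomp M m = K m" for m
  proof
    show "t ` mcomp M m \<subseteq> K m"
      using t_mcomp \<delta>_zero_iff M.mcomp_subset finfuns_gradeD by (fastforce simp: K_def)
    show "K m \<subseteq> t ` mcomp M m"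
    proof
      fix f assume "f \<in> K m"
      then have f: "f \<in> ?S0 m" "\<delta> f = 0"
        by (auto simp: K_def)
      then obtain x where x: "x \<in> carrier M" "f = t x"
        using \<delta>_zero_iff finfuns_gradeD by blast
      obtain c where c: "\<forall>n. c n \<in> mcomp M n" "finite {n. c n \<noteq> \<zero>\<^bsub>M\<^esub>}"
        "x = (\<Oplus>\<^bsub>M\<^esub>n\<in>{n. c n \<noteq> \<zero>\<^bsub>M\<^esub>}. c n)"
        using M.comp_direct_sum[OF x(1)] by blast
      let ?N = "{n. c n \<noteq> \<zero>\<^bsub>M\<^esub>}"
      have "f = keep (\<lambda>x. inj_degree i0 x = m) f"
        using keep_grade[OF f(1), of m] by simp
      also have "\<dots> = (\<Sum>n\<in>?N. keep (\<lambda>x. inj_degree i0 x = m) (t (c n)))"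
      proof -
        have "t x = (\<Sum>n\<in>?N. t (c n))"
          unfolding c(3) by (rule t_sum[OF c(2)]) (use c(1) M.mcomp_subset in blast)
        then show ?thesis
          by (simp only: x(2) keep_sum)
      qed
      also have "\<dots> = (\<Sum>n\<in>?N. if n = m then t (c n) else 0)"
        by (rule sum.cong[OF refl]) (rule keep_grade[OF t_mcomp[OF c(1)[rule_format]]])
      also have "\<dots> = t (c m)"
        using c(2) t_zero by simp
      finally show "f \<in> t ` mcomp M m"
        using c(1) by blast
    qed
  qed
  have K_sub: "fvs.subspace (K m)" for m
    unfolding K_def
    by (rule subspace_graded_linear_kernel[OF \<delta> subspace_finfuns]) (use finfuns_gradeD in blast)
  have dim: "comp_dim A M m = fvs.dim (K m)" for m
  proof -
    let ?V = "comp_space A M m"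
    define e where "e = inv_into (carrier M) t"
    have e_t: "e (t x) = x" if "x \<in> carrier M" for x
      unfolding e_def by (rule inv_into_f_f[OF t_inj that])
    have K_E: "\<exists>x\<in>mcomp M m. f = t x" if "f \<in> K m" for f
      using that image by blast
    have "vectorspace.dim class_ring ?V + fvs.dim {f \<in> K m. e f = \<zero>\<^bsub>?V\<^esub>} = fvs.dim (K m)"
    proof (rule dim_surj_fun_space[OF M.vectorspace_comp_space K_sub W0.finite_grade_inj_degree])
      show "K m \<subseteq> ?S0 m"
        by (auto simp: K_def)
      show "e ` K m = carrier ?V"
      proof -
        have "(\<lambda>x. e (t x)) ` mcomp M m = (\<lambda>x. x) ` mcomp M m"
          by (rule image_cong[OF refl], rule e_t) (use M.mcomp_subset in blast)
        then show ?thesis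
          by (simp add: comp_space_def image[symmetric] image_image)
      qed
      show "e (f + g) = e f \<oplus>\<^bsub>?V\<^esub> e g" if fg: "f \<in> K m" "g \<in> K m" for f g
      proof -
        obtain x y where xy: "x \<in> carrier M" "y \<in> carrier M" "f = t x" "g = t y"
          using K_E[OF fg(1)] K_E[OF fg(2)] M.mcomp_subset by blast
        then have "e (f + g) = x \<oplus>\<^bsub>M\<^esub> y"
          using e_t[of "x \<oplus>\<^bsub>M\<^esub> y"] by (simp add: t_add)
        with xy show ?thesis
          by (simp add: e_t comp_space_def)
      qed
      show "e (fscale c f) = c \<odot>\<^bsub>?V\<^esub> e f" if f: "f \<in> K m" for c f
      proof -
        obtain x where x: "x \<in> carrier M" "f = t x"
          using K_E[OF f] M.mcomp_subset by blast
        then have "e (fscale c f) = scalar A c \<odot>\<^bsub>M\<^esub> x"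
          using e_t[of "scalar A c \<odot>\<^bsub>M\<^esub> x"] M.smult_closed[OF M.scalar_in] by (simp add: t_scale)
        with x show ?thesis
          by (simp add: e_t comp_space_def)
      qed
    qed
    moreover have "{f \<in> K m. e f = \<zero>\<^bsub>?V\<^esub>} \<subseteq> {0}"
    proof
      fix f assume "f \<in> {f \<in> K m. e f = \<zero>\<^bsub>?V\<^esub>}"
      then have f: "f \<in> K m" "e f = \<zero>\<^bsub>M\<^esub>"
        by (simp_all add: comp_space_def)
      obtain x where x: "x \<in> mcomp M m" "f = t x"
        using K_E[OF f(1)] by blast
      then have "x = \<zero>\<^bsub>M\<^esub>"
        using f(2) e_t[of x] M.mcomp_subset by auto
      then show "f \<in> {0}"
        by (simp only: x(2) t_zero singleton_iff)
    qed
    then have "fvs.dim {f \<in> K m. e f = \<zero>\<^bsub>?V\<^esub>} = 0"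
      by (rule dim_eq_0)
    ultimately show ?thesis
      by (simp add: comp_dim_def)
  qed
  obtain n1 where n1: "\<forall>j<J1. n1 < i1 j"
    using finite_lower_bound by blast
  obtain n0 where n0: "\<forall>j<J0. n0 < i0 j"
    using finite_lower_bound by blast
  obtain a where a: "\<forall>j<J0. i0 j < a"
    using finite_upper_bound by blast
  define n where "n = min n0 n1"
  have n: "n < i1 j" if "j < J1" for j
    using n1 that by (auto simp: n_def)
  have n': "n < i0 j" if "j < J0" for j
    using n0 that by (auto simp: n_def)
  have after: "\<delta> (after b f) = after b (\<delta> f)" if b: "b \<in> B" and f: "f \<in> finfuns W0.total" for b f
  proof -
    have "P0.of_coord (after b f) = arr b \<odot>\<^bsub>P0\<^esub> P0.of_coord f"
      using act0[OF b P0.of_coord_closed[OF f]] P0.of_coord_coord[of "arr b \<odot>\<^bsub>P0\<^esub> P0.of_coord f"] P0.coord_of_coord[OF f] by simp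
    moreover have "d (arr b \<odot>\<^bsub>P0\<^esub> P0.of_coord f) = arr b \<odot>\<^bsub>P1\<^esub> d (P0.of_coord f)"
      using d arr[OF b] P0.of_coord_closed[OF f] by (simp add: graded_hom_def)
    ultimately show ?thesis
      using act1[OF b d_closed[OF P0.of_coord_closed[OF f]]] by (simp add: \<delta>_def)
  qed
  obtain D :: "nat \<Rightarrow> 'a \<Rightarrow> nat" where "\<forall>l. fvs.dim (K (n - int l)) = (\<Sum>b\<in>B. D l b) \<and>
      (\<forall>b\<in>B. D (Suc l) b = (\<Sum>c\<in>B. if G b c then D l c else 0))"
    using kernel_recurrence[OF W0 W1 \<delta> after n' n] unfolding K_def by (rule exE)
  then have D: "\<And>l. fvs.dim (K (n - int l)) = (\<Sum>b\<in>B. D l b)"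
    "\<And>l b. b \<in> B \<Longrightarrow> D (Suc l) b = (\<Sum>c\<in>B. if G b c then D l c else 0)"
    by simp_all
  have "rational_in_t (\<lambda>m. comp_dim A M (- m))"
  proof (rule rational_in_t_if_recurrence[where a = "- a" and ?n0.0 = "- n" and B = B
        and D = "\<lambda>l b. of_nat (D l b)" and m = "\<lambda>b c. if G b c then 1 else 0"])
    show "comp_dim A M (- m) = 0" if "m < - a" for m
    proof -
      have "grade W0.total (inj_degree i0) (- m) = {}"
        using a that by (force simp: grade_def inj_degree_def W0.total_def)
      then have "K (- m) \<subseteq> {0}"
        by (auto simp: K_def finfuns_def fun_eq_iff)
      then show ?thesis
        unfolding dim by (rule dim_eq_0)
    qed
    show "finite B"
      by (rule W0.finite_letters)
    show "of_nat (comp_dim A M (- (- n + int l))) = (\<Sum>b\<in>B. of_nat (D l b))" for l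
      using D(1)[of l] by (simp add: dim)
    show "of_nat (D (Suc l) b) = (\<Sum>c\<in>B. (if G b c then 1 else 0) * of_nat (D l c))" if "b \<in> B" for l b
      unfolding D(2)[OF that] of_nat_sum by (rule sum.cong) auto
  qed
  then show ?thesis
    by (rule rational_in_t_inverse_if_rational_in_t)
qed

section \<open>The path algebra and its quadratic monomial ideals\<close>

context fin_digraph begin

abbreviation pathring :: "('a \<times> 'b list \<Rightarrow> 'k::field) ring" ("R")
  where "R \<equiv> path_algebra G"

lemma carrier_path_algebra: "carrier R = finfuns (paths G)"
  by (auto simp: path_algebra_def finfuns_def)

lemma zero_path_algebra: "\<zero>\<^bsub>R\<^esub> = 0"
  by (auto simp: path_algebra_def)

lemma add_path_algebra: "f \<oplus>\<^bsub>R\<^esub> g = f + g"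
  by (auto simp: path_algebra_def)

lemma one_path_algebra: "\<one>\<^bsub>R\<^esub> (u, as) = (if u \<in> verts G \<and> as = [] then 1 else 0)"
  by (auto simp: path_algebra_def)

lemma mult_path_algebra:
  "(f \<otimes>\<^bsub>R\<^esub> g) (u, as) = (\<Sum>i\<le>length as. f (awlast u (take i as), drop i as) * g (u, take i as))"
  by (simp add: path_algebra_def)

lemma paths_iff: "(u, as) \<in> paths G \<longleftrightarrow> awalk u as (awlast u as)"
  by (auto simp: paths_def)

lemma awlast_append: "awlast u (as @ bs) = awlast (awlast u as) bs"
proof (induction as arbitrary: u)
  case Nil
  then show ?case by simp
next
  case (Cons a as)
  have "awalk_verts v cs \<noteq> []" for v cs
    by (cases cs) auto
  with Cons show ?case
    by simp
qed

lemma paths_append_iff: "(u, as @ bs) \<in> paths G \<longleftrightarrow> (u, as) \<in> paths G \<and> (awlast u as, bs) \<in> paths G"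
  unfolding paths_iff awlast_append by (subst awalk_append_iff) simp

lemma path_take_drop:
  "(u, as) \<in> paths G \<longleftrightarrow> (u, take i as) \<in> paths G \<and> (awlast u (take i as), drop i as) \<in> paths G"
  using paths_append_iff[of u "take i as" "drop i as"] by simp

lemma Nil_in_paths: "(u, []) \<in> paths G \<longleftrightarrow> u \<in> verts G"
  by (auto simp: paths_iff awalk_Nil_iff)

lemma arc_in_paths: "a \<in> arcs G \<Longrightarrow> (tail G a, [a]) \<in> paths G"
  by (auto simp: paths_iff awalk_Cons_iff awalk_Nil_iff)

lemma mult_closed:
  assumes "f \<in> finfuns (paths G)" "g \<in> finfuns (paths G)"
  shows "f \<otimes>\<^bsub>R\<^esub> g \<in> finfuns (paths G)"
proof -
  have nz: "\<exists>i. f (awlast u (take i as), drop i as) \<noteq> 0 \<and> g (u, take i as) \<noteq> 0"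
    if "(f \<otimes>\<^bsub>R\<^esub> g) (u, as) \<noteq> 0" for u as
    using that unfolding mult_path_algebra by (metis (no_types, lifting) mult_eq_0_iff sum.neutral)
  have "{p. (f \<otimes>\<^bsub>R\<^esub> g) p \<noteq> 0} \<subseteq> paths G"
  proof clarify
    fix u as assume "(f \<otimes>\<^bsub>R\<^esub> g) (u, as) \<noteq> 0"
    then obtain i where "f (awlast u (take i as), drop i as) \<noteq> 0" "g (u, take i as) \<noteq> 0"
      using nz by blast
    then show "(u, as) \<in> paths G"
      using assms path_take_drop[of u as i] by (auto simp: finfuns_def)
  qed
  moreover have "{p. (f \<otimes>\<^bsub>R\<^esub> g) p \<noteq> 0} \<subseteq>
      (\<lambda>(p, q). (fst q, snd q @ snd p)) ` ({p. f p \<noteq> 0} \<times> {q. g q \<noteq> 0})"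
  proof clarify
    fix u as assume "(f \<otimes>\<^bsub>R\<^esub> g) (u, as) \<noteq> 0"
    then obtain i where "f (awlast u (take i as), drop i as) \<noteq> 0" "g (u, take i as) \<noteq> 0"
      using nz by blast
    then show "(u, as) \<in> (\<lambda>(p, q). (fst q, snd q @ snd p)) ` ({p. f p \<noteq> 0} \<times> {q. g q \<noteq> 0})"
      by (intro image_eqI[of _ _ "((awlast u (take i as), drop i as), (u, take i as))"]) auto
  qed
  moreover have "finite ((\<lambda>(p, q). (fst q, snd q @ snd p)) ` ({p. f p \<noteq> 0} \<times> {q. g q \<noteq> 0}))"
    using assms by (auto simp: finfuns_def)
  ultimately show ?thesis
    unfolding finfuns_def by (blast intro: finite_subset)
qed

lemma one_closed: "(\<one>\<^bsub>R\<^esub> :: 'a \<times> 'b list \<Rightarrow> 'k::field) \<in> finfuns (paths G)"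
proof -
  have "{p. (\<one>\<^bsub>R\<^esub> :: 'a \<times> 'b list \<Rightarrow> 'k) p \<noteq> 0} = (\<lambda>u. (u, [])) ` verts G"
    by (auto simp: one_path_algebra split: if_splits)
  then show ?thesis
    by (auto simp: finfuns_def Nil_in_paths)
qed

lemma mult_one_left: "f \<in> finfuns (paths G) \<Longrightarrow> \<one>\<^bsub>R\<^esub> \<otimes>\<^bsub>R\<^esub> f = f"
proof
  fix p :: "'a \<times> 'b list"
  assume f: "f \<in> finfuns (paths G)"
  obtain u as where p: "p = (u, as)" by (cases p)
  show "(\<one>\<^bsub>R\<^esub> \<otimes>\<^bsub>R\<^esub> f) p = f p"
  proof (cases "(u, as) \<in> paths G")
    case True
    then have "awlast u as \<in> verts G"
      unfolding paths_iff by (rule awalk_last_in_verts)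
    then have "(\<one>\<^bsub>R\<^esub> \<otimes>\<^bsub>R\<^esub> f) p = (\<Sum>i\<le>length as. if i = length as then f p else 0)"
      unfolding p mult_path_algebra one_path_algebra by (intro sum.cong) auto
    then show ?thesis
      by simp
  next
    case False
    then show ?thesis
      using finfuns_outside[OF f] finfuns_outside[OF mult_closed[OF one_closed f]] p by simp
  qed
qed

lemma mult_one_right: "f \<in> finfuns (paths G) \<Longrightarrow> f \<otimes>\<^bsub>R\<^esub> \<one>\<^bsub>R\<^esub> = f"
proof
  fix p :: "'a \<times> 'b list"
  assume f: "f \<in> finfuns (paths G)"
  obtain u as where p: "p = (u, as)" by (cases p)
  show "(f \<otimes>\<^bsub>R\<^esub> \<one>\<^bsub>R\<^esub>) p = f p"
  proof (cases "(u, as) \<in> paths G")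
    case True
    then have "u \<in> verts G"
      unfolding paths_iff by (rule awalk_hd_in_verts)
    then have "(f \<otimes>\<^bsub>R\<^esub> \<one>\<^bsub>R\<^esub>) p = (\<Sum>i\<le>length as. if i = 0 then f p else 0)"
      unfolding p mult_path_algebra one_path_algebra by (intro sum.cong) auto
    then show ?thesis
      by simp
  next
    case False
    then show ?thesis
      using finfuns_outside[OF f] finfuns_outside[OF mult_closed[OF f one_closed]] p by simp
  qed
qed

text \<open>
  Both sides sum over the ways to cut a path into three pieces, at positions \<open>i \<le> k\<close>.
\<close>

lemma mult_assoc: "(f \<otimes>\<^bsub>R\<^esub> g) \<otimes>\<^bsub>R\<^esub> h = f \<otimes>\<^bsub>R\<^esub> (g \<otimes>\<^bsub>R\<^esub> h)"
proof
  fix p :: "'a \<times> 'b list"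
  obtain u as where p: "p = (u, as)" by (cases p)
  define n where "n = length as"
  define F where "F i k = f (awlast u (take k as), drop k as) *
      g (awlast u (take i as), drop i (take k as)) * h (u, take i as)" for i k
  have "((f \<otimes>\<^bsub>R\<^esub> g) \<otimes>\<^bsub>R\<^esub> h) p = (\<Sum>i\<le>n. \<Sum>j\<le>n - i. F i (i + j))"
  proof -
    have "awlast (awlast u (take i as)) (take j (drop i as)) = awlast u (take (i + j) as)" for i j
      by (simp only: awlast_append[symmetric] take_add)
    then show ?thesis
      unfolding p mult_path_algebra F_def n_def sum_distrib_right
      by (simp add: take_drop add.commute)
  qed
  also have "\<dots> = (\<Sum>(i, j)\<in>(SIGMA i:{..n}. {..n - i}). F i (i + j))"
    by (simp add: sum.Sigma)
  also have "\<dots> = (\<Sum>(k, i)\<in>(SIGMA k:{..n}. {..k}). F i k)"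
    by (rule sum.reindex_bij_witness[of _ "\<lambda>(k, i). (i, k - i)" "\<lambda>(i, j). (i + j, i)"]) auto
  also have "\<dots> = (\<Sum>k\<le>n. \<Sum>i\<le>k. F i k)"
    by (simp add: sum.Sigma)
  also have "\<dots> = (f \<otimes>\<^bsub>R\<^esub> (g \<otimes>\<^bsub>R\<^esub> h)) p"
    unfolding p mult_path_algebra
  proof (rule sum.cong)
    fix k assume "k \<in> {..length as}"
    then have "(\<Sum>i\<le>k. F i k) = (\<Sum>i\<le>length (take k as). f (awlast u (take k as), drop k as) *
        (g (awlast u (take i (take k as)), drop i (take k as)) * h (u, take i (take k as))))"
      by (intro sum.cong) (auto simp: F_def mult.assoc min_absorb1)
    then show "(\<Sum>i\<le>k. F i k) = f (awlast u (take k as), drop k as) *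
        (\<Sum>i\<le>length (take k as). g (awlast u (take i (take k as)), drop i (take k as)) * h (u, take i (take k as)))"
      by (simp only: sum_distrib_left)
  qed (simp add: n_def)
  finally show "((f \<otimes>\<^bsub>R\<^esub> g) \<otimes>\<^bsub>R\<^esub> h) p = (f \<otimes>\<^bsub>R\<^esub> (g \<otimes>\<^bsub>R\<^esub> h)) p" .
qed

lemma mult_add_left: "(f + g) \<otimes>\<^bsub>R\<^esub> h = f \<otimes>\<^bsub>R\<^esub> h + g \<otimes>\<^bsub>R\<^esub> h"
proof
  fix p :: "'a \<times> 'b list"
  show "((f + g) \<otimes>\<^bsub>R\<^esub> h) p = (f \<otimes>\<^bsub>R\<^esub> h + g \<otimes>\<^bsub>R\<^esub> h) p"
    by (cases p) (simp add: mult_path_algebra algebra_simps sum.distrib)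
qed

lemma mult_add_right: "h \<otimes>\<^bsub>R\<^esub> (f + g) = h \<otimes>\<^bsub>R\<^esub> f + h \<otimes>\<^bsub>R\<^esub> g"
proof
  fix p :: "'a \<times> 'b list"
  show "(h \<otimes>\<^bsub>R\<^esub> (f + g)) p = (h \<otimes>\<^bsub>R\<^esub> f + h \<otimes>\<^bsub>R\<^esub> g) p"
    by (cases p) (simp add: mult_path_algebra algebra_simps sum.distrib)
qed

lemma mult_fscale_left: "fscale c f \<otimes>\<^bsub>R\<^esub> g = fscale c (f \<otimes>\<^bsub>R\<^esub> g)"
proof
  fix p :: "'a \<times> 'b list"
  show "(fscale c f \<otimes>\<^bsub>R\<^esub> g) p = fscale c (f \<otimes>\<^bsub>R\<^esub> g) p"
    by (cases p) (simp add: mult_path_algebra sum_distrib_left mult.assoc)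
qed

lemma mult_fscale_right: "f \<otimes>\<^bsub>R\<^esub> fscale c g = fscale c (f \<otimes>\<^bsub>R\<^esub> g)"
proof
  fix p :: "'a \<times> 'b list"
  show "(f \<otimes>\<^bsub>R\<^esub> fscale c g) p = fscale c (f \<otimes>\<^bsub>R\<^esub> g) p"
    by (cases p) (simp add: mult_path_algebra sum_distrib_left algebra_simps)
qed

lemma finfuns_uminus: "f \<in> finfuns X \<Longrightarrow> - f \<in> finfuns X" for f :: "'x \<Rightarrow> 'k::field"
  by (rule fvs.subspace_neg[OF subspace_finfuns])

lemma ring_path_algebra: "ring (R :: ('a \<times> 'b list \<Rightarrow> 'k::field) ring)"
proof (rule ringI)
  show "abelian_group (R :: ('a \<times> 'b list \<Rightarrow> 'k) ring)"
  proof (rule abelian_groupI)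
    show "\<exists>y\<in>carrier R. y \<oplus>\<^bsub>R\<^esub> x = \<zero>\<^bsub>R\<^esub>" if "x \<in> carrier R" for x :: "'a \<times> 'b list \<Rightarrow> 'k"
      using that finfuns_uminus[of x "paths G"]
      by (intro bexI[of _ "- x"]) (simp_all add: carrier_path_algebra add_path_algebra zero_path_algebra)
  qed (simp_all add: carrier_path_algebra add_path_algebra zero_path_algebra finfuns_add finfuns_zero add_ac)
  show "Group.monoid (R :: ('a \<times> 'b list \<Rightarrow> 'k) ring)"
    by (rule Group.monoidI)
      (simp_all add: carrier_path_algebra mult_closed one_closed mult_assoc mult_one_left mult_one_right)
qed (simp_all add: carrier_path_algebra add_path_algebra mult_add_left mult_add_right)

lemma path_vec_in_carrier: "p \<in> paths G \<Longrightarrow> path_vec p \<in> finfuns (paths G)"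
  by (auto simp: path_vec_def finfuns_def)

lemma path_vec_mult:
  assumes "v = awlast u as"
  shows "path_vec (v, bs) \<otimes>\<^bsub>R\<^esub> path_vec (u, as) = path_vec (u, as @ bs)"
proof
  fix p :: "'a \<times> 'b list"
  obtain w cs where p: "p = (w, cs)" by (cases p)
  have "(path_vec (v, bs) \<otimes>\<^bsub>R\<^esub> path_vec (u, as)) p =
      (\<Sum>i\<le>length cs. if i = length as then (if w = u \<and> cs = as @ bs then 1 else 0) else 0)"
    unfolding p mult_path_algebra
  proof (rule sum.cong[OF refl])
    fix i assume i: "i \<in> {..length cs}"
    have split: "take i cs = as \<and> drop i cs = bs \<longleftrightarrow> i = length as \<and> cs = as @ bs"
    proof
      assume *: "take i cs = as \<and> drop i cs = bs"
      then have "as @ bs = cs"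
        using append_take_drop_id[of i cs] by simp
      moreover have "length as = i"
        using * i by auto
      ultimately show "i = length as \<and> cs = as @ bs"
        by simp
    qed simp
    have "path_vec (v, bs) (awlast w (take i cs), drop i cs) * path_vec (u, as) (w, take i cs) =
        (if w = u \<and> (take i cs = as \<and> drop i cs = bs) then 1 else 0)"
      using assms by (auto simp: path_vec_def)
    also have "\<dots> = (if i = length as then (if w = u \<and> cs = as @ bs then 1 else 0) else 0)"
      unfolding split by simp
    finally show "path_vec (v, bs) (awlast w (take i cs), drop i cs) * path_vec (u, as) (w, take i cs) =
        (if i = length as then (if w = u \<and> cs = as @ bs then 1 else 0) else 0)" .
  qed
  then show "(path_vec (v, bs) \<otimes>\<^bsub>R\<^esub> path_vec (u, as)) p = path_vec (u, as @ bs) p"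
    by (auto simp: path_vec_def p)
qed

lemma path_vec_mult_zero:
  assumes "v \<noteq> awlast u as"
  shows "path_vec (v, bs) \<otimes>\<^bsub>R\<^esub> path_vec (u, as) = 0"
proof
  fix p :: "'a \<times> 'b list"
  obtain w cs where p: "p = (w, cs)" by (cases p)
  show "(path_vec (v, bs) \<otimes>\<^bsub>R\<^esub> path_vec (u, as)) p = 0 p"
    unfolding p mult_path_algebra using assms by (auto simp: path_vec_def intro!: sum.neutral)
qed

lemma vertex_mult: "(path_vec (x, []) \<otimes>\<^bsub>R\<^esub> f) (u, as) = (if awlast u as = x then f (u, as) else 0)"
proof -
  have "(path_vec (x, []) \<otimes>\<^bsub>R\<^esub> f) (u, as) =
      (\<Sum>i\<le>length as. if i = length as then (if awlast u as = x then f (u, as) else 0) else 0)"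
    unfolding mult_path_algebra path_vec_def by (intro sum.cong) auto
  then show ?thesis
    by simp
qed

lemma mult_vertex: "(f \<otimes>\<^bsub>R\<^esub> path_vec (x, [])) (u, as) = (if u = x then f (u, as) else 0)"
proof -
  have "(f \<otimes>\<^bsub>R\<^esub> path_vec (x, [])) (u, as) =
      (\<Sum>i\<le>length as. if i = 0 then (if u = x then f (u, as) else 0) else 0)"
    unfolding mult_path_algebra path_vec_def by (intro sum.cong) auto
  then show ?thesis
    by simp
qed

lemma arc_mult: "(path_vec (tail G a, [a]) \<otimes>\<^bsub>R\<^esub> f) (u, as @ [b]) =
    (if a = b \<and> awlast u as = tail G a then f (u, as) else 0)"
proof -
  have "(path_vec (tail G a, [a]) \<otimes>\<^bsub>R\<^esub> f) (u, as @ [b]) =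
      (\<Sum>i\<le>length (as @ [b]). if i = length as then (if a = b \<and> awlast u as = tail G a then f (u, as) else 0) else 0)"
    unfolding mult_path_algebra
  proof (rule sum.cong[OF refl])
    fix i assume "i \<in> {..length (as @ [b])}"
    then consider "i < length as" | "i = length as" | "i = Suc (length as)"
      by fastforce
    then show "path_vec (tail G a, [a]) (awlast u (take i (as @ [b])), drop i (as @ [b])) * f (u, take i (as @ [b])) =
        (if i = length as then (if a = b \<and> awlast u as = tail G a then f (u, as) else 0) else 0)"
      by cases (auto simp: path_vec_def dest: arg_cong[of _ _ length])
  qed
  then show ?thesis
    by simp
qed

lemma arc_mult_Nil: "(path_vec (tail G a, [a]) \<otimes>\<^bsub>R\<^esub> f) (u, []) = 0"
  by (simp add: mult_path_algebra path_vec_def)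

lemma mult_arc: "(f \<otimes>\<^bsub>R\<^esub> path_vec (tail G b, [b])) (v, c # cs) =
    (if v = tail G b \<and> c = b then f (head G b, cs) else 0)"
proof -
  have "(f \<otimes>\<^bsub>R\<^esub> path_vec (tail G b, [b])) (v, c # cs) =
      (\<Sum>i\<le>length (c # cs). if i = 1 then (if v = tail G b \<and> c = b then f (head G b, cs) else 0) else 0)"
    unfolding mult_path_algebra
  proof (rule sum.cong[OF refl])
    fix i assume "i \<in> {..length (c # cs)}"
    then consider "i = 0" | "i = 1" | k where "i = Suc (Suc k)" "k < length cs"
      by (cases i rule: nat.exhaust; cases "i - 1") auto
    then show "f (awlast v (take i (c # cs)), drop i (c # cs)) * path_vec (tail G b, [b]) (v, take i (c # cs)) =
        (if i = 1 then (if v = tail G b \<and> c = b then f (head G b, cs) else 0) else 0)"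
    proof cases
      case (3 k)
      then have "take (Suc k) cs \<noteq> []"
        by auto
      with 3 show ?thesis
        by (simp add: path_vec_def)
    qed (simp_all add: path_vec_def)
  qed
  also have "\<dots> = (if v = tail G b \<and> c = b then f (head G b, cs) else 0)"
    unfolding sum.delta[OF finite_atMost] by simp
  finally show ?thesis .
qed

lemma mult_arc_Nil: "(f \<otimes>\<^bsub>R\<^esub> path_vec (tail G b, [b])) (v, []) = 0"
  by (simp add: mult_path_algebra path_vec_def)

text \<open>
  \<open>T a b\<close> expresses that traversing first \<open>a\<close>, then \<open>b\<close> is a relation of the algebra. The good paths
  form a basis of the quotient by \<open>monomial_ideal T\<close>.
\<close>

definition good_paths :: "('b \<Rightarrow> 'b \<Rightarrow> bool) \<Rightarrow> ('a \<times> 'b list) set" where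
  "good_paths T = {(u, as) \<in> paths G. successively (\<lambda>a b. \<not> T a b) as}"

definition monomial_ideal :: "('b \<Rightarrow> 'b \<Rightarrow> bool) \<Rightarrow> ('a \<times> 'b list \<Rightarrow> 'k::field) set" where
  "monomial_ideal T = {f \<in> finfuns (paths G). \<forall>p\<in>good_paths T. f p = 0}"

lemma good_paths_append:
  assumes "(u, as @ bs) \<in> good_paths T"
  shows "(u, as) \<in> good_paths T" "(awlast u as, bs) \<in> good_paths T"
  using assms paths_append_iff[of u as bs] by (auto simp: good_paths_def successively_append_iff)

lemma good_paths_take_drop:
  assumes "(u, as) \<in> good_paths T"
  shows "(u, take i as) \<in> good_paths T" "(awlast u (take i as), drop i as) \<in> good_paths T"
  using good_paths_append[of u "take i as" "drop i as" T] assms by simp_all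

lemma ideal_monomial_ideal: "ideal (monomial_ideal T :: ('a \<times> 'b list \<Rightarrow> 'k::field) set) R"
proof (rule idealI[OF ring_path_algebra])
  interpret Rr: ring "R :: ('a \<times> 'b list \<Rightarrow> 'k) ring"
    by (rule ring_path_algebra)
  have minus: "\<ominus>\<^bsub>R\<^esub> f = - f" if "f \<in> finfuns (paths G)" for f :: "'a \<times> 'b list \<Rightarrow> 'k"
  proof (rule Rr.minus_equality)
    show "- f \<oplus>\<^bsub>R\<^esub> f = \<zero>\<^bsub>R\<^esub>"
      by (simp add: add_path_algebra zero_path_algebra)
  qed (use that finfuns_uminus in \<open>auto simp: carrier_path_algebra\<close>)
  show "subgroup (monomial_ideal T) (add_monoid (R :: ('a \<times> 'b list \<Rightarrow> 'k) ring))"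
  proof (rule group.subgroupI[OF Rr.a_group])
    show "monomial_ideal T \<noteq> {}"
      using finfuns_zero by (force simp: monomial_ideal_def)
    show "inv\<^bsub>add_monoid R\<^esub> f \<in> monomial_ideal T" if "f \<in> monomial_ideal T" for f :: "'a \<times> 'b list \<Rightarrow> 'k"
      using minus[of f] that finfuns_uminus by (auto simp: monomial_ideal_def a_inv_def)
  qed (auto simp: monomial_ideal_def carrier_path_algebra add_path_algebra finfuns_add)
  fix f g :: "'a \<times> 'b list \<Rightarrow> 'k"
  assume f: "f \<in> monomial_ideal T" and g: "g \<in> carrier R"
  have "(g \<otimes>\<^bsub>R\<^esub> f) (u, as) = 0 \<and> (f \<otimes>\<^bsub>R\<^esub> g) (u, as) = 0" if "(u, as) \<in> good_paths T" for u as
    unfolding mult_path_algebra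
    using f good_paths_take_drop[OF that] by (auto simp: monomial_ideal_def intro!: sum.neutral)
  then show "g \<otimes>\<^bsub>R\<^esub> f \<in> monomial_ideal T" "f \<otimes>\<^bsub>R\<^esub> g \<in> monomial_ideal T"
    using f g mult_closed by (auto simp: monomial_ideal_def carrier_path_algebra)
qed

lemma not_successivelyD:
  "\<not> successively P xs \<Longrightarrow> \<exists>ys x y zs. xs = ys @ [x, y] @ zs \<and> \<not> P x y"
proof (induction xs rule: induct_list012)
  case (3 x y zs)
  show ?case
  proof (cases "P x y")
    case True
    with 3 obtain ys a b zs' where "y # zs = ys @ [a, b] @ zs'" "\<not> P a b"
      by auto
    then have "x # y # zs = (x # ys) @ [a, b] @ zs'" "\<not> P a b"
      by simp_all
    then show ?thesis
      by blast
  next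
    case False
    then have "x # y # zs = [] @ [x, y] @ zs" "\<not> P x y"
      by simp_all
    then show ?thesis
      by blast
  qed
qed simp_all

text \<open>
  A path that is not good contains a relation, so it is the product of a path, a relation and a path.
  Conversely the functions vanishing on good paths form an ideal, because both pieces of a good path are
  good.
\<close>

lemma genideal_quadratic_monomials:
  "genideal R {path_vec (tail G a, [a, b]) | a b.
      a \<in> arcs G \<and> b \<in> arcs G \<and> head G a = tail G b \<and> T a b} =
   (monomial_ideal T :: ('a \<times> 'b list \<Rightarrow> 'k::field) set)" (is "genideal R ?S = _")
proof
  interpret Rr: ring "R :: ('a \<times> 'b list \<Rightarrow> 'k) ring"
    by (rule ring_path_algebra)
  have S_paths: "(tail G a, [a, b]) \<in> paths G"
    if "a \<in> arcs G" "b \<in> arcs G" "head G a = tail G b" for a b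
    using that by (auto simp: paths_iff awalk_Cons_iff awalk_Nil_iff)
  have S_carrier: "?S \<subseteq> carrier R"
    using S_paths path_vec_in_carrier by (auto simp: carrier_path_algebra)
  have "?S \<subseteq> monomial_ideal T"
    using S_carrier by (auto simp: carrier_path_algebra monomial_ideal_def good_paths_def path_vec_def)
  then show "genideal R ?S \<subseteq> monomial_ideal T"
    by (rule Rr.genideal_minimal[OF ideal_monomial_ideal])
  interpret J: ideal "genideal R ?S" R
    by (rule Rr.genideal_ideal[OF S_carrier])
  have J_bad: "fscale c (path_vec (u, as)) \<in> genideal R ?S"
    if "(u, as) \<in> paths G" "(u, as) \<notin> good_paths T" for u as and c :: 'k
  proof -
    from that have "\<not> successively (\<lambda>a b. \<not> T a b) as"
      by (simp add: good_paths_def)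
    then obtain bs a b cs where as: "as = bs @ [a, b] @ cs" "T a b"
      using not_successivelyD by blast
    have walk: "(u, bs) \<in> paths G" "(tail G a, [a, b]) \<in> paths G" "(head G b, cs) \<in> paths G"
      "awlast u bs = tail G a" "a \<in> arcs G" "b \<in> arcs G" "head G a = tail G b"
      using that(1) unfolding as(1) paths_append_iff
      by (auto simp: paths_iff awalk_Cons_iff awalk_Nil_iff)
    have mid: "path_vec (tail G a, [a, b]) \<in> genideal R ?S"
      using Rr.genideal_self[OF S_carrier] walk as(2) by blast
    have eq: "fscale c (path_vec (u, as)) = fscale c (path_vec (head G b, cs)) \<otimes>\<^bsub>R\<^esub> path_vec (tail G a, [a, b]) \<otimes>\<^bsub>R\<^esub> path_vec (u, bs)"
      using walk by (simp add: mult_fscale_left path_vec_mult as(1))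
    show ?thesis
      unfolding eq
      by (intro J.I_r_closed J.I_l_closed mid)
        (simp_all add: carrier_path_algebra finfuns_fscale path_vec_in_carrier walk)
  qed
  show "monomial_ideal T \<subseteq> genideal R ?S"
  proof
    fix f :: "'a \<times> 'b list \<Rightarrow> 'k"
    assume f: "f \<in> monomial_ideal T"
    then have f_fin: "f \<in> finfuns (paths G)"
      by (simp add: monomial_ideal_def)
    have closed: "(\<Sum>p\<in>P. g p) \<in> genideal R ?S" if "finite P" "\<And>p. p \<in> P \<Longrightarrow> g p \<in> genideal R ?S"
      for P :: "('a \<times> 'b list) set" and g
      using that
    proof (induction P rule: finite_induct)
      case empty
      show ?case
        using J.zero_closed unfolding zero_path_algebra sum.empty .
    next
      case (insert p P)
      then have "g p \<in> genideal R ?S" "(\<Sum>p\<in>P. g p) \<in> genideal R ?S"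
        by blast+
      then have "g p + (\<Sum>p\<in>P. g p) \<in> genideal R ?S"
        using J.a_closed unfolding add_path_algebra by blast
      then show ?case
        by (simp only: sum.insert[OF insert.hyps])
    qed
    have "(\<Sum>p\<in>{p. f p \<noteq> 0}. fscale (f p) (path_vec p)) \<in> genideal R ?S"
    proof (rule closed)
      show "finite {p. f p \<noteq> 0}"
        using f_fin by (simp add: finfuns_def)
      fix p assume "p \<in> {p. f p \<noteq> 0}"
      then have "p \<in> paths G" "p \<notin> good_paths T"
        using f by (auto simp: monomial_ideal_def finfuns_def)
      then show "fscale (f p) (path_vec p) \<in> genideal R ?S"
        using J_bad by (cases p) auto
    qed
    moreover have "path_vec = (unit_fun :: 'a \<times> 'b list \<Rightarrow> 'a \<times> 'b list \<Rightarrow> 'k)"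
      by (auto simp: path_vec_def unit_fun_def fun_eq_iff)
    ultimately show "f \<in> genideal R ?S"
      using finfuns_eq_sum[OF f_fin] by simp
  qed
qed

end

section \<open>The quotient algebra and its projectives\<close>

locale monomial_algebra = fin_digraph G for G :: "('v, 'a) pre_digraph" +
  fixes T :: "'a \<Rightarrow> 'a \<Rightarrow> bool"
begin

abbreviation good :: "('v \<times> 'a list) set" where
  "good \<equiv> good_paths T"

abbreviation alg ("A") where
  "A \<equiv> bound_quiver_algebra G (monomial_ideal T)"

definition cls :: "('v \<times> 'a list \<Rightarrow> 'k::field) \<Rightarrow> ('v \<times> 'a list \<Rightarrow> 'k) set" where
  "cls f = monomial_ideal T +>\<^bsub>R\<^esub> f"

text \<open>
  The representative of a residue class that is supported on good paths. The choice of an element of the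
  class is immaterial, as all of them agree on good paths.
\<close>

definition nf :: "('v \<times> 'a list \<Rightarrow> 'k::field) set \<Rightarrow> 'v \<times> 'a list \<Rightarrow> 'k" where
  "nf a = keep (\<lambda>p. p \<in> good) (SOME f. f \<in> a)"

lemma good_subset: "good \<subseteq> paths G"
  by (auto simp: good_paths_def)

lemma finfuns_good: "f \<in> finfuns good \<Longrightarrow> f \<in> finfuns (paths G)"
  using finfuns_mono[OF good_subset] by blast

lemma cls_eq: "f \<in> finfuns (paths G) \<Longrightarrow> cls f = {h \<in> finfuns (paths G). \<forall>p\<in>good. h p = f p}"
proof (intro equalityI subsetI)
  fix h assume f: "f \<in> finfuns (paths G)" and "h \<in> cls f"
  then obtain i where "i \<in> monomial_ideal T" "h = i + f"
    by (auto simp: cls_def a_r_coset_def' add_path_algebra)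
  with f show "h \<in> {h \<in> finfuns (paths G). \<forall>p\<in>good. h p = f p}"
    by (auto simp: monomial_ideal_def finfuns_add)
next
  fix h assume f: "f \<in> finfuns (paths G)" and "h \<in> {h \<in> finfuns (paths G). \<forall>p\<in>good. h p = f p}"
  then have "h + - f \<in> monomial_ideal T" "h = (h + - f) + f"
    using finfuns_add[of h "paths G" "- f"] finfuns_uminus by (auto simp: monomial_ideal_def)
  then show "h \<in> cls f"
    unfolding cls_def a_r_coset_def' add_path_algebra by blast
qed

lemma cls_eq_iff:
  assumes "f \<in> finfuns (paths G)" "g \<in> finfuns (paths G)"
  shows "cls f = cls g \<longleftrightarrow> (\<forall>p\<in>good. f p = g p)"
  using assms cls_eq[of f] cls_eq[of g] by (auto simp: set_eq_iff)

lemma nf_cls: "f \<in> finfuns (paths G) \<Longrightarrow> nf (cls f) = keep (\<lambda>p. p \<in> good) f"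
proof -
  assume f: "f \<in> finfuns (paths G)"
  then have "f \<in> cls f"
    by (simp add: cls_eq)
  then have "(SOME h. h \<in> cls f) \<in> cls f"
    by (rule someI[of "\<lambda>h. h \<in> cls f"])
  then have "\<forall>p\<in>good. (SOME h. h \<in> cls f) p = f p"
    using f by (simp add: cls_eq)
  then show ?thesis
    by (auto simp: nf_def fun_eq_iff)
qed

lemma nf_cls_good: "f \<in> finfuns good \<Longrightarrow> nf (cls f) = f"
  unfolding nf_cls[OF finfuns_good] by (rule ext) (auto simp: finfuns_outside)

lemma carrier_alg: "carrier A = cls ` finfuns (paths G)"
  by (auto simp: bound_quiver_algebra_def FactRing_def A_RCOSETS_def' cls_def Let_def carrier_path_algebra)

lemma cls_closed: "f \<in> finfuns (paths G) \<Longrightarrow> cls f \<in> carrier A"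
  by (simp add: carrier_alg)

lemma nf_closed: "a \<in> carrier A \<Longrightarrow> nf a \<in> finfuns good"
proof -
  assume "a \<in> carrier A"
  then obtain f where f: "f \<in> finfuns (paths G)" "a = cls f"
    by (auto simp: carrier_alg)
  have "{p \<in> paths G. p \<in> good} = good"
    using good_subset by blast
  then show ?thesis
    using keep_finfuns[OF f(1), of "\<lambda>p. p \<in> good"] by (simp add: f(2) nf_cls[OF f(1)])
qed

lemma cls_nf: "a \<in> carrier A \<Longrightarrow> cls (nf a) = a"
proof -
  assume a: "a \<in> carrier A"
  then obtain f where f: "f \<in> finfuns (paths G)" "a = cls f"
    by (auto simp: carrier_alg)
  show ?thesis
    using cls_eq_iff[OF finfuns_good[OF nf_closed[OF a]] f(1)] by (simp add: f nf_cls)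
qed

lemma nf_inj: "a \<in> carrier A \<Longrightarrow> b \<in> carrier A \<Longrightarrow> nf a = nf b \<Longrightarrow> a = b"
  using cls_nf by metis

interpretation I: ideal "monomial_ideal T" "path_algebra G"
  by (rule ideal_monomial_ideal)

lemma cls_add:
  assumes "f \<in> finfuns (paths G)" "g \<in> finfuns (paths G)"
  shows "cls f \<oplus>\<^bsub>A\<^esub> cls g = cls (f + g)"
  using I.a_rcos_sum[of f g] assms
  by (simp add: bound_quiver_algebra_def FactRing_def Let_def cls_def carrier_path_algebra add_path_algebra)

lemma cls_mult:
  assumes "f \<in> finfuns (paths G)" "g \<in> finfuns (paths G)"
  shows "cls f \<otimes>\<^bsub>A\<^esub> cls g = cls (f \<otimes>\<^bsub>R\<^esub> g)"
  using I.rcoset_mult_add[of f g] assms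
  by (simp add: bound_quiver_algebra_def FactRing_def Let_def cls_def carrier_path_algebra)

lemma alg_add_closed: "a \<in> carrier A \<Longrightarrow> b \<in> carrier A \<Longrightarrow> a \<oplus>\<^bsub>A\<^esub> b \<in> carrier A"
  by (auto simp: carrier_alg cls_add finfuns_add)

lemma alg_mult_closed: "a \<in> carrier A \<Longrightarrow> b \<in> carrier A \<Longrightarrow> a \<otimes>\<^bsub>A\<^esub> b \<in> carrier A"
  by (auto simp: carrier_alg cls_mult mult_closed)

lemma alg_zero: "\<zero>\<^bsub>A\<^esub> = cls 0"
  unfolding cls_eq[OF finfuns_zero]
  by (auto simp: bound_quiver_algebra_def FactRing_def Let_def monomial_ideal_def)

lemma alg_zero_closed: "\<zero>\<^bsub>A\<^esub> \<in> carrier A"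
  unfolding alg_zero by (rule cls_closed[OF finfuns_zero])

lemma nf_zero: "nf \<zero>\<^bsub>A\<^esub> = 0"
  unfolding alg_zero by (rule nf_cls_good[OF finfuns_zero])

lemma nf_add: "a \<in> carrier A \<Longrightarrow> b \<in> carrier A \<Longrightarrow> nf (a \<oplus>\<^bsub>A\<^esub> b) = nf a + nf b"
proof -
  assume a: "a \<in> carrier A" and b: "b \<in> carrier A"
  have "a \<oplus>\<^bsub>A\<^esub> b = cls (nf a + nf b)"
    using cls_add[OF finfuns_good[OF nf_closed[OF a]] finfuns_good[OF nf_closed[OF b]]]
    by (simp only: cls_nf a b)
  then show ?thesis
    by (simp only: nf_cls_good finfuns_add nf_closed a b)
qed

lemma nf_mult: "a \<in> carrier A \<Longrightarrow> b \<in> carrier A \<Longrightarrow> nf (a \<otimes>\<^bsub>A\<^esub> b) = keep (\<lambda>p. p \<in> good) (nf a \<otimes>\<^bsub>R\<^esub> nf b)"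
proof -
  assume a: "a \<in> carrier A" and b: "b \<in> carrier A"
  note ab = finfuns_good[OF nf_closed[OF a]] finfuns_good[OF nf_closed[OF b]]
  have "a \<otimes>\<^bsub>A\<^esub> b = cls (nf a \<otimes>\<^bsub>R\<^esub> nf b)"
    using cls_mult[OF ab] by (simp only: cls_nf a b)
  then show ?thesis
    by (simp only: nf_cls mult_closed ab)
qed

lemma acomp_alg: "acomp A n = {a \<in> carrier A. \<forall>p. nf a p \<noteq> 0 \<longrightarrow> int (length (snd p)) = n}"
proof (intro equalityI subsetI)
  fix a assume "a \<in> acomp A n"
  then obtain f where f: "f \<in> finfuns (paths G)" "a = cls f" "\<forall>p. f p \<noteq> 0 \<longrightarrow> int (length (snd p)) = n"
    by (auto simp: bound_quiver_algebra_def Let_def cls_def carrier_path_algebra)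
  then show "a \<in> {a \<in> carrier A. \<forall>p. nf a p \<noteq> 0 \<longrightarrow> int (length (snd p)) = n}"
    by (auto simp: cls_closed nf_cls)
next
  fix a assume "a \<in> {a \<in> carrier A. \<forall>p. nf a p \<noteq> 0 \<longrightarrow> int (length (snd p)) = n}"
  then have a: "a \<in> carrier A" "\<forall>p. nf a p \<noteq> 0 \<longrightarrow> int (length (snd p)) = n"
    by auto
  have "acomp A n = {cls f | f. f \<in> finfuns (paths G) \<and> (\<forall>p. f p \<noteq> 0 \<longrightarrow> int (length (snd p)) = n)}"
    by (simp add: bound_quiver_algebra_def Let_def cls_def carrier_path_algebra)
  then show "a \<in> acomp A n"
    using cls_nf[OF a(1)] finfuns_good[OF nf_closed[OF a(1)]] a(2) by blast
qed

lemma scalar_alg: "scalar A c = cls (fscale c \<one>\<^bsub>R\<^esub>)"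
  by (simp add: bound_quiver_algebra_def Let_def cls_def fscale_def)

lemma scalar_closed: "scalar A c \<in> carrier A"
  unfolding scalar_alg by (intro cls_closed finfuns_fscale one_closed)

lemma one_good: "(\<one>\<^bsub>R\<^esub> :: 'v \<times> 'a list \<Rightarrow> 'k::field) \<in> finfuns good"
proof -
  have "p \<in> good" if "(\<one>\<^bsub>R\<^esub> :: 'v \<times> 'a list \<Rightarrow> 'k) p \<noteq> 0" for p
    using that by (cases p) (auto simp: one_path_algebra good_paths_def Nil_in_paths split: if_splits)
  then show ?thesis
    using one_closed by (auto simp: finfuns_def)
qed

lemma nf_scalar: "nf (scalar A c) = fscale c \<one>\<^bsub>R\<^esub>"
  unfolding scalar_alg by (intro nf_cls_good finfuns_fscale one_good)

lemma keep_good: "f \<in> finfuns good \<Longrightarrow> keep (\<lambda>p. p \<in> good) f = f"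
  by (rule ext) (auto simp: finfuns_outside)

lemma nf_scalar_mult: "a \<in> carrier A \<Longrightarrow> nf (scalar A c \<otimes>\<^bsub>A\<^esub> a) = fscale c (nf a)"
  using nf_closed[of a] by (simp add: nf_mult scalar_closed nf_scalar mult_fscale_left
      mult_one_left finfuns_good keep_good finfuns_fscale)

lemma nf_mult_scalar: "a \<in> carrier A \<Longrightarrow> nf (a \<otimes>\<^bsub>A\<^esub> scalar A c) = fscale c (nf a)"
  using nf_closed[of a] by (simp add: nf_mult scalar_closed nf_scalar mult_fscale_right
      mult_one_right finfuns_good keep_good finfuns_fscale)

lemma mult_scalar_commute: "a \<in> carrier A \<Longrightarrow> a \<otimes>\<^bsub>A\<^esub> scalar A c = scalar A c \<otimes>\<^bsub>A\<^esub> a"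
  by (rule nf_inj) (simp_all add: alg_mult_closed scalar_closed nf_scalar_mult nf_mult_scalar)

lemma scalar_algebra_alg: "scalar_algebra (A :: (('v \<times> 'a list \<Rightarrow> 'k::field) set, 'k) graded_algebra)"
proof
  fix c d :: 'k
  show "scalar A c \<in> carrier A"
    by (rule scalar_closed)
  have "int (length (snd p)) = 0" if "nf (scalar A c) p \<noteq> 0" for p
    using that by (cases p) (simp add: nf_scalar one_path_algebra split: if_splits)
  then show "scalar A c \<in> acomp A 0"
    unfolding acomp_alg using scalar_closed by blast
  show "scalar A (c + d) = scalar A c \<oplus>\<^bsub>A\<^esub> scalar A d"
    by (rule nf_inj) (simp_all only: scalar_closed alg_add_closed nf_add nf_scalar fvs.scale_left_distrib)
  show "scalar A (c * d) = scalar A c \<otimes>\<^bsub>A\<^esub> scalar A d"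
    by (rule nf_inj) (simp_all only: scalar_closed alg_mult_closed nf_scalar_mult nf_scalar fvs.scale_scale)
  show "scalar A 1 = \<one>\<^bsub>A\<^esub>"
    by (simp add: scalar_alg) (simp add: bound_quiver_algebra_def FactRing_def Let_def cls_def)
qed

definition idem :: "'v \<Rightarrow> ('v \<times> 'a list \<Rightarrow> 'k::field) set" where
  "idem x = cls (path_vec (x, []))"

definition arr :: "'a \<Rightarrow> ('v \<times> 'a list \<Rightarrow> 'k::field) set" where
  "arr b = cls (path_vec (tail G b, [b]))"

lemma path_vec_finfuns: "p \<in> X \<Longrightarrow> path_vec p \<in> finfuns X"
  by (auto simp: path_vec_def finfuns_def)

lemma Nil_good: "x \<in> verts G \<Longrightarrow> (x, []) \<in> good"
  by (simp add: good_paths_def Nil_in_paths)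

lemma arc_good: "b \<in> arcs G \<Longrightarrow> (tail G b, [b]) \<in> good"
  by (simp add: good_paths_def arc_in_paths)

lemma idem_closed: "x \<in> verts G \<Longrightarrow> idem x \<in> carrier A"
  unfolding idem_def by (intro cls_closed finfuns_good path_vec_finfuns Nil_good)

lemma arr_closed: "b \<in> arcs G \<Longrightarrow> arr b \<in> carrier A"
  unfolding arr_def by (intro cls_closed finfuns_good path_vec_finfuns arc_good)

lemma nf_idem: "x \<in> verts G \<Longrightarrow> nf (idem x) = path_vec (x, [])"
  unfolding idem_def by (intro nf_cls_good path_vec_finfuns Nil_good)

lemma nf_arr: "b \<in> arcs G \<Longrightarrow> nf (arr b) = path_vec (tail G b, [b])"
  unfolding arr_def by (intro nf_cls_good path_vec_finfuns arc_good)

lemma nf_mult_idem: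
  assumes "x \<in> verts G" "a \<in> carrier A"
  shows "nf (a \<otimes>\<^bsub>A\<^esub> idem x) (u, as) = (if u = x then nf a (u, as) else 0)"
  using finfuns_outside[OF nf_closed[OF assms(2)]]
  by (auto simp: nf_mult assms idem_closed nf_idem mult_vertex)

lemma nf_idem_mult:
  assumes "x \<in> verts G" "a \<in> carrier A"
  shows "nf (idem x \<otimes>\<^bsub>A\<^esub> a) (u, as) = (if awlast u as = x then nf a (u, as) else 0)"
  using finfuns_outside[OF nf_closed[OF assms(2)]]
  by (auto simp: nf_mult assms idem_closed nf_idem vertex_mult)

lemma left_ideal_idem:
  assumes x: "x \<in> verts G"
  shows "left_ideal A (idem x) = {a \<in> carrier A. \<forall>p. nf a p \<noteq> 0 \<longrightarrow> fst p = x}"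
proof (intro equalityI subsetI)
  fix a assume "a \<in> {a \<in> carrier A. \<forall>p. nf a p \<noteq> 0 \<longrightarrow> fst p = x}"
  then have a: "a \<in> carrier A" "\<And>u as. u \<noteq> x \<Longrightarrow> nf a (u, as) = 0"
    by auto
  have "nf (a \<otimes>\<^bsub>A\<^esub> idem x) = nf a"
    using a by (auto simp: fun_eq_iff nf_mult_idem x)
  then have "a = a \<otimes>\<^bsub>A\<^esub> idem x"
    using nf_inj[of "a \<otimes>\<^bsub>A\<^esub> idem x" a] a(1) by (simp add: alg_mult_closed idem_closed x)
  with a(1) show "a \<in> left_ideal A (idem x)"
    unfolding left_ideal_def by blast
qed (auto simp: left_ideal_def alg_mult_closed idem_closed x nf_mult_idem split: if_splits)

lemma right_ideal_idem:
  assumes x: "x \<in> verts G"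
  shows "right_ideal A (idem x) = {a \<in> carrier A. \<forall>u as. nf a (u, as) \<noteq> 0 \<longrightarrow> awlast u as = x}"
proof (intro equalityI subsetI)
  fix a assume "a \<in> {a \<in> carrier A. \<forall>u as. nf a (u, as) \<noteq> 0 \<longrightarrow> awlast u as = x}"
  then have a: "a \<in> carrier A" "\<And>u as. awlast u as \<noteq> x \<Longrightarrow> nf a (u, as) = 0"
    by auto
  have "nf (idem x \<otimes>\<^bsub>A\<^esub> a) = nf a"
    using a by (auto simp: fun_eq_iff nf_idem_mult x)
  then have "a = idem x \<otimes>\<^bsub>A\<^esub> a"
    using nf_inj[of "idem x \<otimes>\<^bsub>A\<^esub> a" a] a(1) by (simp add: alg_mult_closed idem_closed x)
  with a(1) show "a \<in> right_ideal A (idem x)"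
    unfolding right_ideal_def by blast
qed (auto simp: right_ideal_def alg_mult_closed idem_closed x nf_idem_mult split: if_splits)

text \<open>
  Left multiplication by an arc prolongs a path at its end, so a path that starts at \<open>x\<close> is recorded
  by the list of its arcs in reverse.
\<close>

definition proj_words :: "'v \<Rightarrow> 'a list set" where
  "proj_words x = {w. (x, rev w) \<in> good}"

definition proj_coord :: "'v \<Rightarrow> ('v \<times> 'a list \<Rightarrow> 'k::field) set \<Rightarrow> 'a list \<Rightarrow> 'k" where
  "proj_coord x a w = nf a (x, rev w)"

lemma proj_coord_finfuns:
  assumes "a \<in> carrier A"
  shows "proj_coord x a \<in> finfuns (proj_words x)"
proof -
  have "{w. proj_coord x a w \<noteq> 0} \<subseteq> (\<lambda>p. rev (snd p)) ` {p. nf a p \<noteq> 0}"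
    by (force simp: proj_coord_def image_iff)
  moreover have "{w. proj_coord x a w \<noteq> 0} \<subseteq> proj_words x"
    using finfuns_outside[OF nf_closed[OF assms]] by (auto simp: proj_words_def proj_coord_def)
  ultimately show ?thesis
    using nf_closed[OF assms] unfolding finfuns_def by (blast intro: finite_subset)
qed

lemma coordinates_projective:
  assumes x: "x \<in> verts G"
  shows "coordinates (A :: (('v \<times> 'a list \<Rightarrow> 'k::field) set, 'k) graded_algebra)
    (graded_projective A (idem x)) (proj_words x) (\<lambda>w. int (length w)) (proj_coord x)"
proof
  let ?P = "graded_projective (A :: (('v \<times> 'a list \<Rightarrow> 'k::field) set, 'k) graded_algebra) (idem x)"
  have P: "carrier ?P = {a \<in> carrier A. \<forall>p. nf a p \<noteq> 0 \<longrightarrow> fst p = x}"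
    by (simp add: graded_projective_def left_ideal_idem x)
  show "bij_betw (proj_coord x) (carrier ?P) (finfuns (proj_words x))"
  proof (rule bij_betw_imageI)
    show "inj_on (proj_coord x) (carrier ?P)"
    proof (rule inj_onI)
      fix a b assume a: "a \<in> carrier ?P" and b: "b \<in> carrier ?P" and eq: "proj_coord x a = proj_coord x b"
      have "nf a = nf b"
      proof
        fix p :: "'v \<times> 'a list"
        obtain u as where p: "p = (u, as)" by (cases p)
        show "nf a p = nf b p"
        proof (cases "u = x")
          case True
          then show ?thesis
            using fun_cong[OF eq, of "rev as"] p by (simp add: proj_coord_def)
        next
          case False
          then have "nf a p = 0" "nf b p = 0"
            using a b unfolding P p by force+
          then show ?thesis
            by simp
        qed
      qed
      with a b show "a = b"
        unfolding P by (intro nf_inj) auto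
    qed
    show "proj_coord x ` carrier ?P = finfuns (proj_words x)"
    proof (intro equalityI subsetI)
      fix g :: "'a list \<Rightarrow> 'k"
      assume g: "g \<in> finfuns (proj_words x)"
      define f where "f = (\<lambda>(u, as). if u = x then g (rev as) else 0)"
      have "{p. f p \<noteq> 0} \<subseteq> (\<lambda>w. (x, rev w)) ` {w. g w \<noteq> 0}"
        by (force simp: f_def image_iff split: if_splits)
      moreover have "{p. f p \<noteq> 0} \<subseteq> good"
        using finfuns_outside[OF g] by (force simp: f_def proj_words_def split: if_splits)
      ultimately have f: "f \<in> finfuns good"
        using g unfolding finfuns_def by (blast intro: finite_subset)
      then have "cls f \<in> carrier ?P"
        unfolding P by (auto simp: cls_closed finfuns_good nf_cls_good) (auto simp: f_def split: if_splits)
      moreover have "proj_coord x (cls f) = g"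
        using f by (auto simp: proj_coord_def fun_eq_iff nf_cls_good) (simp add: f_def)
      ultimately show "g \<in> proj_coord x ` carrier ?P"
        by blast
    qed (use proj_coord_finfuns in \<open>auto simp: P\<close>)
  qed
  show "p \<oplus>\<^bsub>?P\<^esub> q \<in> carrier ?P" if "p \<in> carrier ?P" "q \<in> carrier ?P" for p q
  proof -
    have "p \<oplus>\<^bsub>A\<^esub> q \<in> carrier ?P"
      using that unfolding P by (auto simp: alg_add_closed nf_add) (metis add.right_neutral fst_conv)
    then show ?thesis
      by (simp add: graded_projective_def)
  qed
  show "proj_coord x (p \<oplus>\<^bsub>?P\<^esub> q) = proj_coord x p + proj_coord x q" if "p \<in> carrier ?P" "q \<in> carrier ?P" for p q
    using that unfolding P by (auto simp: graded_projective_def proj_coord_def fun_eq_iff nf_add)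
  show "scalar A c \<odot>\<^bsub>?P\<^esub> p \<in> carrier ?P" if "p \<in> carrier ?P" for c p
  proof -
    have "scalar A c \<otimes>\<^bsub>A\<^esub> p \<in> carrier ?P"
      using that unfolding P by (auto simp: alg_mult_closed scalar_closed nf_scalar_mult)
    then show ?thesis
      by (simp add: graded_projective_def)
  qed
  show "proj_coord x (scalar A c \<odot>\<^bsub>?P\<^esub> p) = fscale c (proj_coord x p)" if "p \<in> carrier ?P" for c p
    using that unfolding P by (auto simp: graded_projective_def proj_coord_def fun_eq_iff nf_scalar_mult)
  have zero: "\<zero>\<^bsub>?P\<^esub> = \<zero>\<^bsub>A\<^esub>"
    by (simp add: graded_projective_def)
  show "\<zero>\<^bsub>?P\<^esub> \<in> carrier ?P"
    unfolding zero P by (simp add: alg_zero_closed nf_zero)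
  show "proj_coord x \<zero>\<^bsub>?P\<^esub> = 0"
    unfolding zero by (simp add: proj_coord_def nf_zero fun_eq_iff)
  show "mcomp ?P m = {p \<in> carrier ?P. proj_coord x p \<in> finfuns (grade (proj_words x) (\<lambda>w. int (length w)) m)}" for m
  proof -
    have "mcomp ?P m = carrier ?P \<inter> acomp A m"
      by (simp add: graded_projective_def)
    moreover have "p \<in> acomp A m \<longleftrightarrow> proj_coord x p \<in> finfuns (grade (proj_words x) (\<lambda>w. int (length w)) m)"
      if p: "p \<in> carrier ?P" for p
    proof -
      have "p \<in> carrier A"
        using p by (simp add: P)
      then have "proj_coord x p \<in> finfuns (grade (proj_words x) (\<lambda>w. int (length w)) m) \<longleftrightarrow>
          (\<forall>w. proj_coord x p w \<noteq> 0 \<longrightarrow> int (length w) = m)"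
        using proj_coord_finfuns[of p x] by (auto simp: finfuns_def grade_def)
      also have "\<dots> \<longleftrightarrow> (\<forall>as. nf p (x, as) \<noteq> 0 \<longrightarrow> int (length as) = m)"
        unfolding proj_coord_def by (metis length_rev rev_rev_ident)
      also have "\<dots> \<longleftrightarrow> p \<in> acomp A m"
        using p unfolding acomp_alg P by fastforce
      finally show ?thesis ..
    qed
    ultimately show ?thesis
      by blast
  qed
qed

lemma projective_action:
  assumes x: "x \<in> verts G" and b: "b \<in> arcs G" and p: "p \<in> carrier (graded_projective A (idem x))"
  shows "arr b \<odot>\<^bsub>graded_projective A (idem x)\<^esub> p \<in> carrier (graded_projective A (idem x))"
    and "proj_coord x (arr b \<odot>\<^bsub>graded_projective A (idem x)\<^esub> p) w =
      (if w \<in> proj_words x \<and> w \<noteq> [] \<and> hd w = b then proj_coord x p (tl w) else 0)"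
proof -
  have P: "carrier (graded_projective A (idem x)) = {a \<in> carrier A. \<forall>p. nf a p \<noteq> 0 \<longrightarrow> fst p = x}"
    by (simp add: graded_projective_def left_ideal_idem x)
  have pA: "p \<in> carrier A" "\<And>u as. u \<noteq> x \<Longrightarrow> nf p (u, as) = 0"
    using p unfolding P by auto
  have nf: "nf (arr b \<otimes>\<^bsub>A\<^esub> p) (u, as) = (if (u, as) \<in> good \<and> as \<noteq> [] \<and> last as = b then nf p (u, butlast as) else 0)"
    for u as
  proof (cases as rule: rev_cases)
    case Nil
    then show ?thesis
      by (simp add: nf_mult arr_closed b pA nf_arr arc_mult_Nil)
  next
    case (snoc cs c)
    have "awlast u cs = tail G c" if "(u, cs @ [c]) \<in> good"
      using good_paths_append(2)[OF that] good_subset by (auto simp: paths_iff awalk_Cons_iff)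
    with snoc show ?thesis
      by (auto simp: nf_mult arr_closed b pA nf_arr arc_mult)
  qed
  have eq: "arr b \<odot>\<^bsub>graded_projective A (idem x)\<^esub> p = arr b \<otimes>\<^bsub>A\<^esub> p"
    by (simp add: graded_projective_def)
  show "arr b \<odot>\<^bsub>graded_projective A (idem x)\<^esub> p \<in> carrier (graded_projective A (idem x))"
    unfolding eq P using pA nf by (auto simp: alg_mult_closed arr_closed b split: if_splits)
  show "proj_coord x (arr b \<odot>\<^bsub>graded_projective A (idem x)\<^esub> p) w =
      (if w \<in> proj_words x \<and> w \<noteq> [] \<and> hd w = b then proj_coord x p (tl w) else 0)"
    unfolding eq by (auto simp: proj_coord_def nf proj_words_def last_rev butlast_rev)
qed

end

section \<open>The graded injectives\<close>

context monomial_algebra begin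

text \<open>
  The start vertex of a path that ends at \<open>x\<close>. Hence such a path is determined by its list of arcs, in
  the order of traversal: the action \<open>(b \<phi>)(u) = \<phi>(u b)\<close> prolongs paths at their start.
\<close>

definition start :: "'v \<Rightarrow> 'a list \<Rightarrow> 'v" where
  "start x w = (if w = [] then x else tail G (hd w))"

definition inj_words :: "'v \<Rightarrow> 'a list set" where
  "inj_words x = {w. (start x w, w) \<in> good \<and> awlast (start x w) w = x}"

definition basis :: "'v \<Rightarrow> 'a list \<Rightarrow> ('v \<times> 'a list \<Rightarrow> 'k::field) set" where
  "basis x w = cls (path_vec (start x w, w))"

lemma good_path_start:
  assumes "(u, as) \<in> good" "awlast u as = x"
  shows "u = start x as" "as \<in> inj_words x"
proof -
  show "u = start x as"
    using assms good_subset by (cases as) (auto simp: start_def paths_iff awalk_Cons_iff)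
  with assms show "as \<in> inj_words x"
    by (simp add: inj_words_def)
qed

lemma Cons_inj_wordsD:
  assumes "b # w \<in> inj_words x"
  shows "w \<in> inj_words x" "start x w = head G b" "b \<in> arcs G"
proof -
  have g: "(tail G b, [b] @ w) \<in> good" "awlast (tail G b) ([b] @ w) = x"
    using assms by (simp_all add: inj_words_def start_def)
  have "(head G b, w) \<in> good" "awlast (head G b) w = x"
    using good_paths_append(2)[OF g(1)] g(2) unfolding awlast_append by simp_all
  note tail = good_path_start[OF this]
  show "w \<in> inj_words x"
    by (rule tail(2))
  show "start x w = head G b"
    by (rule tail(1)[symmetric])
  show "b \<in> arcs G"
    using g(1) good_subset by (auto simp: paths_iff awalk_Cons_iff)
qed

lemma nf_basis: "w \<in> inj_words x \<Longrightarrow> nf (basis x w) = path_vec (start x w, w)"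
  unfolding basis_def by (intro nf_cls_good path_vec_finfuns) (simp add: inj_words_def)

lemma basis_carrier: "w \<in> inj_words x \<Longrightarrow> basis x w \<in> carrier A"
  unfolding basis_def by (intro cls_closed finfuns_good path_vec_finfuns) (simp add: inj_words_def)

text \<open>
  The coordinates of \<open>b \<phi>\<close> are the values of \<open>\<phi>\<close> at these products.
\<close>

lemma basis_mult_arr:
  assumes b: "b \<in> arcs G" and w: "w \<in> inj_words x"
  shows "basis x w \<otimes>\<^bsub>A\<^esub> arr b = (if b # w \<in> inj_words x then basis x (b # w) else \<zero>\<^bsub>A\<^esub>)"
proof -
  have w_path: "(start x w, w) \<in> paths G"
    using w good_subset by (auto simp: inj_words_def)
  have prod: "basis x w \<otimes>\<^bsub>A\<^esub> arr b = cls (path_vec (start x w, w) \<otimes>\<^bsub>R\<^esub> path_vec (tail G b, [b]))"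
    unfolding basis_def arr_def
    by (intro cls_mult path_vec_finfuns w_path arc_in_paths b)
  show ?thesis
  proof (cases "start x w = head G b")
    case True
    then have eq: "basis x w \<otimes>\<^bsub>A\<^esub> arr b = cls (path_vec (tail G b, b # w))"
      unfolding prod by (simp add: path_vec_mult)
    show ?thesis
    proof (cases "b # w \<in> inj_words x")
      case True
      then show ?thesis
        by (simp add: eq) (simp add: basis_def start_def)
    next
      case False
      have "(tail G b, [b] @ w) \<in> paths G"
        using w_path True b unfolding paths_append_iff by (simp add: arc_in_paths)
      moreover have "(tail G b, b # w) \<notin> good"
      proof
        assume "(tail G b, b # w) \<in> good"
        moreover have "awlast (tail G b) ([b] @ w) = x"
          using w True unfolding awlast_append by (simp add: inj_words_def)
        ultimately show False
          using False good_path_start(2)[of "tail G b" "b # w" x] by simp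
      qed
      ultimately have "cls (path_vec (tail G b, b # w)) = \<zero>\<^bsub>A\<^esub>"
        unfolding alg_zero by (subst cls_eq_iff) (auto simp: path_vec_finfuns finfuns_zero, auto simp: path_vec_def)
      with False show ?thesis
        by (simp add: eq)
    qed
  next
    case False
    then have "b # w \<notin> inj_words x"
      using Cons_inj_wordsD by blast
    moreover have "basis x w \<otimes>\<^bsub>A\<^esub> arr b = \<zero>\<^bsub>A\<^esub>"
      unfolding prod alg_zero using False by (simp add: path_vec_mult_zero)
    ultimately show ?thesis
      by simp
  qed
qed

definition functionals :: "'v \<Rightarrow> (('v \<times> 'a list \<Rightarrow> 'k::field) set \<Rightarrow> 'k) set" where
  "functionals x = {\<phi> \<in> extensional (right_ideal A (idem x)).
    (\<forall>u\<in>right_ideal A (idem x). \<forall>v\<in>right_ideal A (idem x). \<phi> (u \<oplus>\<^bsub>A\<^esub> v) = \<phi> u + \<phi> v) \<and>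
    (\<forall>c. \<forall>u\<in>right_ideal A (idem x). \<phi> (scalar A c \<otimes>\<^bsub>A\<^esub> u) = c * \<phi> u) \<and>
    finite {m. \<exists>u \<in> right_ideal A (idem x) \<inter> acomp A m. \<phi> u \<noteq> 0}}"

lemma injective_simps:
  "carrier (graded_injective A (idem x)) = functionals x"
  "zero (graded_injective A (idem x)) = (\<lambda>u\<in>right_ideal A (idem x). 0)"
  "add (graded_injective A (idem x)) = (\<lambda>\<phi> \<psi>. \<lambda>u\<in>right_ideal A (idem x). \<phi> u + \<psi> u)"
  "smult (graded_injective A (idem x)) = (\<lambda>a \<phi>. \<lambda>u\<in>right_ideal A (idem x). \<phi> (u \<otimes>\<^bsub>A\<^esub> a))"
  "mcomp (graded_injective A (idem x)) n =
    {\<phi> \<in> functionals x. \<forall>m. m \<noteq> - n \<longrightarrow> (\<forall>u \<in> right_ideal A (idem x) \<inter> acomp A m. \<phi> u = 0)}"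
  by (simp_all add: graded_injective_def Let_def functionals_def)

lemma functionalsI:
  assumes "\<phi> \<in> extensional (right_ideal A (idem x))"
    and "\<And>u v. u \<in> right_ideal A (idem x) \<Longrightarrow> v \<in> right_ideal A (idem x) \<Longrightarrow> \<phi> (u \<oplus>\<^bsub>A\<^esub> v) = \<phi> u + \<phi> v"
    and "\<And>c u. u \<in> right_ideal A (idem x) \<Longrightarrow> \<phi> (scalar A c \<otimes>\<^bsub>A\<^esub> u) = c * \<phi> u"
    and "finite S" "\<And>m u. u \<in> right_ideal A (idem x) \<Longrightarrow> u \<in> acomp A m \<Longrightarrow> \<phi> u \<noteq> 0 \<Longrightarrow> m \<in> S"
  shows "\<phi> \<in> functionals x"
proof -
  have "finite {m. \<exists>u \<in> right_ideal A (idem x) \<inter> acomp A m. \<phi> u \<noteq> 0}"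
    by (rule finite_subset[OF _ assms(4)]) (use assms(5) in blast)
  with assms(1-3) show ?thesis
    by (simp add: functionals_def)
qed

lemma functionalsD:
  assumes "\<phi> \<in> functionals x"
  shows "\<phi> \<in> extensional (right_ideal A (idem x))"
    and "\<And>u v. u \<in> right_ideal A (idem x) \<Longrightarrow> v \<in> right_ideal A (idem x) \<Longrightarrow> \<phi> (u \<oplus>\<^bsub>A\<^esub> v) = \<phi> u + \<phi> v"
    and "\<And>c u. u \<in> right_ideal A (idem x) \<Longrightarrow> \<phi> (scalar A c \<otimes>\<^bsub>A\<^esub> u) = c * \<phi> u"
    and "finite {m. \<exists>u \<in> right_ideal A (idem x) \<inter> acomp A m. \<phi> u \<noteq> 0}"
  using assms by (simp_all add: functionals_def)

text \<open>
  The value \<open>0\<close> outside \<open>inj_words x\<close> makes this a function supported on the basis.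
\<close>

definition inj_coord :: "'v \<Rightarrow> (('v \<times> 'a list \<Rightarrow> 'k::field) set \<Rightarrow> 'k) \<Rightarrow> 'a list \<Rightarrow> 'k" where
  "inj_coord x \<phi> w = (if w \<in> inj_words x then \<phi> (basis x w) else 0)"

context
  fixes x :: 'v
  assumes x: "x \<in> verts G"
begin

abbreviation D :: "('v \<times> 'a list \<Rightarrow> 'k::field) set set" where
  "D \<equiv> right_ideal A (idem x)"

lemma D_carrier: "u \<in> D \<Longrightarrow> u \<in> carrier A"
  by (simp add: right_ideal_idem x)

lemma D_nf: "u \<in> D \<Longrightarrow> nf u (v, as) \<noteq> 0 \<Longrightarrow> as \<in> inj_words x \<and> v = start x as"
  using finfuns_outside[OF nf_closed[OF D_carrier]] good_path_start[of v as x]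
  by (simp add: right_ideal_idem x) blast

lemma D_I: "u \<in> carrier A \<Longrightarrow> (\<And>v as. nf u (v, as) \<noteq> 0 \<Longrightarrow> awlast v as = x) \<Longrightarrow> u \<in> D"
  by (simp add: right_ideal_idem x)

lemma D_end: "u \<in> D \<Longrightarrow> nf u (v, as) \<noteq> 0 \<Longrightarrow> awlast v as = x"
  by (simp add: right_ideal_idem x)

lemma D_add: "u \<in> D \<Longrightarrow> v \<in> D \<Longrightarrow> u \<oplus>\<^bsub>A\<^esub> v \<in> D"
proof (rule D_I)
  fix y as assume u: "u \<in> D" and v: "v \<in> D" and "nf (u \<oplus>\<^bsub>A\<^esub> v) (y, as) \<noteq> 0"
  then have "nf u (y, as) \<noteq> 0 \<or> nf v (y, as) \<noteq> 0"
    by (auto simp: nf_add D_carrier)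
  with u v show "awlast y as = x"
    using D_end by blast
qed (simp add: alg_add_closed D_carrier)

lemma D_scalar: "u \<in> D \<Longrightarrow> scalar A c \<otimes>\<^bsub>A\<^esub> u \<in> D"
proof (rule D_I)
  fix y as assume u: "u \<in> D" and "nf (scalar A c \<otimes>\<^bsub>A\<^esub> u) (y, as) \<noteq> 0"
  then have "nf u (y, as) \<noteq> 0"
    by (auto simp: nf_scalar_mult D_carrier)
  with u show "awlast y as = x"
    using D_end by blast
qed (simp add: alg_mult_closed scalar_closed D_carrier)

lemma D_zero: "\<zero>\<^bsub>A\<^esub> \<in> D"
  by (rule D_I) (simp_all add: alg_zero_closed nf_zero)

lemma D_basis: "w \<in> inj_words x \<Longrightarrow> basis x w \<in> D"
  by (rule D_I) (auto simp: basis_carrier nf_basis path_vec_def inj_words_def split: if_splits)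

lemma basis_degree: "w \<in> inj_words x \<Longrightarrow> basis x w \<in> acomp A (int (length w))"
  by (auto simp: acomp_alg basis_carrier nf_basis path_vec_def split: if_splits)

lemma nf_mult_arr:
  assumes "u \<in> carrier A" "b \<in> arcs G"
  shows "nf (u \<otimes>\<^bsub>A\<^esub> arr b) (v, as) \<noteq> 0 \<Longrightarrow>
    \<exists>cs. as = b # cs \<and> v = tail G b \<and> nf u (head G b, cs) \<noteq> 0"
  by (cases as) (auto simp: nf_mult assms arr_closed nf_arr mult_arc mult_arc_Nil split: if_splits)

lemma D_mult_arr:
  assumes u: "u \<in> D" and b: "b \<in> arcs G"
  shows "u \<otimes>\<^bsub>A\<^esub> arr b \<in> D"
proof (rule D_I)
  fix v as assume "nf (u \<otimes>\<^bsub>A\<^esub> arr b) (v, as) \<noteq> 0"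
  then obtain cs where cs: "as = b # cs" "v = tail G b" "nf u (head G b, cs) \<noteq> 0"
    using nf_mult_arr[OF D_carrier[OF u] b] by blast
  have "awlast v ([b] @ cs) = awlast (head G b) cs"
    unfolding awlast_append by (simp add: cs)
  then show "awlast v as = x"
    using D_end[OF u cs(3)] by (simp add: cs(1))
qed (simp add: alg_mult_closed D_carrier u arr_closed b)

lemma acomp_mult_arr:
  assumes u: "u \<in> D" and b: "b \<in> arcs G" and m: "u \<in> acomp A m"
  shows "u \<otimes>\<^bsub>A\<^esub> arr b \<in> acomp A (m + 1)"
proof -
  have "int (length (snd p)) = m + 1" if "nf (u \<otimes>\<^bsub>A\<^esub> arr b) p \<noteq> 0" for p
  proof -
    obtain v as where p: "p = (v, as)" by (cases p)
    obtain cs where cs: "as = b # cs" "nf u (head G b, cs) \<noteq> 0"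
      using nf_mult_arr[OF D_carrier[OF u] b, of v as] \<open>nf (u \<otimes>\<^bsub>A\<^esub> arr b) p \<noteq> 0\<close> p by blast
    then have "int (length (snd (head G b, cs))) = m"
      using m unfolding acomp_alg by blast
    then show ?thesis
      by (simp add: p cs(1))
  qed
  moreover have "u \<otimes>\<^bsub>A\<^esub> arr b \<in> carrier A"
    using u b by (simp add: alg_mult_closed D_carrier arr_closed)
  ultimately show ?thesis
    unfolding acomp_alg by blast
qed

lemma functional_zero:
  fixes \<phi> :: "('v \<times> 'a list \<Rightarrow> 'k::field) set \<Rightarrow> 'k"
  assumes \<phi>: "\<phi> \<in> functionals x"
  shows "\<phi> \<zero>\<^bsub>A\<^esub> = 0"
proof -
  have "\<zero>\<^bsub>A\<^esub> \<oplus>\<^bsub>A\<^esub> \<zero>\<^bsub>A\<^esub> = (\<zero>\<^bsub>A\<^esub> :: ('v \<times> 'a list \<Rightarrow> 'k) set)"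
    by (rule nf_inj) (simp_all add: alg_add_closed alg_zero_closed nf_add nf_zero)
  then have "\<phi> \<zero>\<^bsub>A\<^esub> + \<phi> \<zero>\<^bsub>A\<^esub> = \<phi> \<zero>\<^bsub>A\<^esub>"
    using functionalsD(2)[OF \<phi> D_zero D_zero] by (simp only:)
  then show ?thesis
    by (simp only: add_cancel_left_right)
qed

lemma finite_nf_words: "u \<in> carrier A \<Longrightarrow> finite {w. nf u (start x w, w) \<noteq> 0}"
  using nf_closed[of u] by (intro finite_subset[of "{w. nf u (start x w, w) \<noteq> 0}" "snd ` {p. nf u p \<noteq> 0}"])
    (auto simp: finfuns_def image_iff)

text \<open>
  The classes of the good paths that end at \<open>x\<close> span the right ideal, so they determine a functional.
\<close>

lemma functional_expansion:
  assumes \<phi>: "\<phi> \<in> functionals x" and u: "u \<in> D"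
  shows "\<phi> u = (\<Sum>w\<in>{w. nf u (start x w, w) \<noteq> 0}. nf u (start x w, w) * inj_coord x \<phi> w)"
proof -
  let ?pv = "\<lambda>w. path_vec (start x w, w)"
  let ?W = "{w. nf u (start x w, w) \<noteq> 0}"
  have partial: "cls (\<Sum>w\<in>W. fscale (c w) (?pv w)) \<in> D \<and> (\<Sum>w\<in>W. fscale (c w) (?pv w)) \<in> finfuns good \<and>
      \<phi> (cls (\<Sum>w\<in>W. fscale (c w) (?pv w))) = (\<Sum>w\<in>W. c w * inj_coord x \<phi> w)"
    if "finite W" "W \<subseteq> inj_words x" for W c
    using that
  proof (induction W rule: finite_induct)
    case empty
    show ?case
      unfolding sum.empty alg_zero[symmetric] using D_zero functional_zero[OF \<phi>] finfuns_zero by blast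
  next
    case (insert w W)
    let ?f = "\<Sum>w\<in>W. fscale (c w) (?pv w)"
    have w: "w \<in> inj_words x"
      using insert.prems by simp
    have IH: "cls ?f \<in> D" "?f \<in> finfuns good" "\<phi> (cls ?f) = (\<Sum>w\<in>W. c w * inj_coord x \<phi> w)"
      using insert.IH insert.prems by blast+
    have pv: "?pv w \<in> finfuns good"
      using w by (intro path_vec_finfuns) (simp add: inj_words_def)
    then have pv': "fscale (c w) (?pv w) \<in> finfuns good"
      by (rule finfuns_fscale)
    have scaled: "cls (fscale (c w) (?pv w)) = scalar A (c w) \<otimes>\<^bsub>A\<^esub> basis x w"
      by (rule nf_inj) (simp_all add: cls_closed finfuns_good pv' alg_mult_closed scalar_closed basis_carrier w
          nf_cls_good nf_scalar_mult nf_basis)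
    have sum: "cls (fscale (c w) (?pv w) + ?f) = scalar A (c w) \<otimes>\<^bsub>A\<^esub> basis x w \<oplus>\<^bsub>A\<^esub> cls ?f"
      using cls_add[OF finfuns_good[OF pv'] finfuns_good[OF IH(2)]] by (simp only: scaled)
    have 1: "cls (fscale (c w) (?pv w) + ?f) \<in> D"
      unfolding sum by (intro D_add D_scalar D_basis w IH(1))
    have 2: "fscale (c w) (?pv w) + ?f \<in> finfuns good"
      by (rule finfuns_add[OF pv' IH(2)])
    have 3: "\<phi> (cls (fscale (c w) (?pv w) + ?f)) = c w * inj_coord x \<phi> w + (\<Sum>w\<in>W. c w * inj_coord x \<phi> w)"
    proof -
      have "\<phi> (scalar A (c w) \<otimes>\<^bsub>A\<^esub> basis x w \<oplus>\<^bsub>A\<^esub> cls ?f) =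
          \<phi> (scalar A (c w) \<otimes>\<^bsub>A\<^esub> basis x w) + \<phi> (cls ?f)"
        by (rule functionalsD(2)[OF \<phi> D_scalar[OF D_basis[OF w]] IH(1)])
      moreover have "\<phi> (scalar A (c w) \<otimes>\<^bsub>A\<^esub> basis x w) = c w * inj_coord x \<phi> w"
        using functionalsD(3)[OF \<phi> D_basis[OF w]] by (simp add: inj_coord_def w)
      ultimately show ?thesis
        by (simp only: sum IH(3))
    qed
    show ?case
      unfolding sum.insert[OF insert.hyps] using 1 2 3 by blast
  qed
  have "nf u = (\<Sum>w\<in>?W. fscale (nf u (start x w, w)) (?pv w))"
  proof
    fix p :: "'v \<times> 'a list"
    obtain v as where p: "p = (v, as)" by (cases p)
    have "(\<Sum>w\<in>?W. fscale (nf u (start x w, w)) (?pv w)) p =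
        (\<Sum>w\<in>?W. if w = as then (if v = start x as then nf u (v, as) else 0) else 0)"
      unfolding sum_fun_apply by (rule sum.cong) (auto simp: p path_vec_def)
    also have "\<dots> = (if as \<in> ?W then (if v = start x as then nf u (v, as) else 0) else 0)"
      by (rule sum.delta[OF finite_nf_words[OF D_carrier[OF u]]])
    also have "\<dots> = nf u p"
    proof (cases "nf u (v, as) = 0")
      case False
      then have "v = start x as"
        using D_nf[OF u] by blast
      with False p show ?thesis
        by simp
    qed (auto simp: p)
    finally show "nf u p = (\<Sum>w\<in>?W. fscale (nf u (start x w, w)) (?pv w)) p" ..
  qed
  moreover have "?W \<subseteq> inj_words x"
    using D_nf[OF u] by blast
  ultimately show ?thesis
    using partial[OF finite_nf_words[OF D_carrier[OF u]], of "\<lambda>w. nf u (start x w, w)"] cls_nf[OF D_carrier[OF u]]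
    by simp
qed

lemma inj_coord_finfuns:
  assumes \<phi>: "\<phi> \<in> functionals x"
  shows "inj_coord x \<phi> \<in> finfuns (inj_words x)"
proof -
  let ?S = "{m. \<exists>u \<in> D \<inter> acomp A m. \<phi> u \<noteq> 0}"
  \<comment> \<open>a functional lives in finitely many degrees, and in each of them there are finitely many paths\<close>
  have "{w. inj_coord x \<phi> w \<noteq> 0} \<subseteq> {w. set w \<subseteq> arcs G \<and> length w \<le> Max (nat ` ?S)}"
  proof clarify
    fix w assume nz: "inj_coord x \<phi> w \<noteq> 0"
    then have w: "w \<in> inj_words x" "\<phi> (basis x w) \<noteq> 0"
      by (auto simp: inj_coord_def split: if_splits)
    then have "int (length w) \<in> ?S"
      using D_basis basis_degree by blast
    then have "nat (int (length w)) \<in> nat ` ?S"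
      by (rule imageI)
    then have "length w \<le> Max (nat ` ?S)"
      using functionalsD(4)[OF \<phi>] by (intro Max_ge finite_imageI) simp_all
    moreover have "(start x w, w) \<in> paths G"
      using w(1) good_subset by (auto simp: inj_words_def)
    then have "set w \<subseteq> arcs G"
      by (simp add: paths_iff awalk_def)
    ultimately show "set w \<subseteq> arcs G \<and> length w \<le> Max (nat ` ?S)"
      by simp
  qed
  then have "finite {w. inj_coord x \<phi> w \<noteq> 0}"
    by (rule finite_subset) (rule finite_lists_length_le[OF finite_arcs])
  then show ?thesis
    by (auto simp: finfuns_def inj_coord_def split: if_splits)
qed

lemma inj_coord_surj:
  assumes g: "g \<in> finfuns (inj_words x)"
  defines "\<phi> \<equiv> \<lambda>u\<in>D. \<Sum>w\<in>{w. g w \<noteq> 0}. nf u (start x w, w) * g w"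
  shows "\<phi> \<in> functionals x" "inj_coord x \<phi> = g"
proof -
  have fin: "finite {w. g w \<noteq> 0}"
    using g by (simp add: finfuns_def)
  show \<phi>: "\<phi> \<in> functionals x"
  proof (rule functionalsI)
    show "\<phi> (u \<oplus>\<^bsub>A\<^esub> v) = \<phi> u + \<phi> v" if "u \<in> D" "v \<in> D" for u v
      using that D_add[OF that] by (simp add: \<phi>_def nf_add D_carrier distrib_right sum.distrib)
    show "\<phi> (scalar A c \<otimes>\<^bsub>A\<^esub> u) = c * \<phi> u" if "u \<in> D" for c u
      using that D_scalar[OF that] by (simp add: \<phi>_def nf_scalar_mult D_carrier sum_distrib_left mult.assoc)
    show "finite ((\<lambda>w. int (length w)) ` {w. g w \<noteq> 0})"
      using fin by simp
    show "m \<in> (\<lambda>w. int (length w)) ` {w. g w \<noteq> 0}" if u: "u \<in> D" "u \<in> acomp A m" "\<phi> u \<noteq> 0" for m u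
    proof -
      have "(\<Sum>w\<in>{w. g w \<noteq> 0}. nf u (start x w, w) * g w) \<noteq> 0"
        using u by (simp add: \<phi>_def)
      then obtain w where w: "g w \<noteq> 0" "nf u (start x w, w) \<noteq> 0"
        by (metis (mono_tags, lifting) mem_Collect_eq mult_zero_left sum.neutral)
      then have "int (length (snd (start x w, w))) = m"
        using u(2) unfolding acomp_alg by blast
      with w(1) show ?thesis
        by force
    qed
  qed (simp add: \<phi>_def)
  show "inj_coord x \<phi> = g"
  proof
    fix w
    show "inj_coord x \<phi> w = g w"
    proof (cases "w \<in> inj_words x")
      case True
      have "inj_coord x \<phi> w = (\<Sum>w'\<in>{w. g w \<noteq> 0}. nf (basis x w) (start x w', w') * g w')"
        using True by (simp add: inj_coord_def \<phi>_def D_basis)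
      also have "\<dots> = (\<Sum>w'\<in>{w. g w \<noteq> 0}. if w' = w then g w else 0)"
        by (rule sum.cong) (auto simp: nf_basis True path_vec_def)
      also have "\<dots> = g w"
        using fin by simp
      finally show ?thesis .
    next
      case False
      then show ?thesis
        using finfuns_outside[OF g] by (simp add: inj_coord_def)
    qed
  qed
qed

lemma functional_ext:
  assumes "\<phi> \<in> functionals x" "\<psi> \<in> functionals x" "inj_coord x \<phi> = inj_coord x \<psi>"
  shows "\<phi> = \<psi>"
proof (rule extensionalityI)
  show "\<phi> \<in> extensional D" "\<psi> \<in> extensional D"
    using assms functionalsD(1) by blast+
  show "\<phi> u = \<psi> u" if "u \<in> D" for u
    unfolding functional_expansion[OF assms(1) that] functional_expansion[OF assms(2) that] assms(3) ..
qed

lemma functional_scale: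
  assumes \<phi>: "\<phi> \<in> functionals x"
  shows "(\<lambda>u\<in>D. \<phi> (u \<otimes>\<^bsub>A\<^esub> scalar A c)) \<in> functionals x"
proof -
  have eq: "(\<lambda>u\<in>D. \<phi> (u \<otimes>\<^bsub>A\<^esub> scalar A c)) = (\<lambda>u\<in>D. c * \<phi> u)"
    by (rule restrict_ext) (simp add: mult_scalar_commute D_carrier functionalsD(3)[OF \<phi>])
  show ?thesis
    unfolding eq
    by (rule functionalsI[OF _ _ _ functionalsD(4)[OF \<phi>]])
      (auto simp: functionalsD(2,3)[OF \<phi>] D_add D_scalar algebra_simps)
qed

lemma injective_action:
  fixes \<phi> :: "('v \<times> 'a list \<Rightarrow> 'k::field) set \<Rightarrow> 'k"
  assumes b: "b \<in> arcs G" and \<phi>: "\<phi> \<in> functionals x"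
  shows "arr b \<odot>\<^bsub>graded_injective A (idem x)\<^esub> \<phi> \<in> functionals x"
    and "inj_coord x (arr b \<odot>\<^bsub>graded_injective A (idem x)\<^esub> \<phi>) w = inj_coord x \<phi> (b # w)"
proof -
  let ?\<psi> = "\<lambda>u\<in>D. \<phi> (u \<otimes>\<^bsub>A\<^esub> arr b)"
  have eq: "arr b \<odot>\<^bsub>graded_injective A (idem x)\<^esub> \<phi> = ?\<psi>"
    by (simp add: injective_simps)
  have distr: "(u \<oplus>\<^bsub>A\<^esub> v) \<otimes>\<^bsub>A\<^esub> arr b = u \<otimes>\<^bsub>A\<^esub> arr b \<oplus>\<^bsub>A\<^esub> v \<otimes>\<^bsub>A\<^esub> arr b"
    if "u \<in> D" "v \<in> D" for u v :: "('v \<times> 'a list \<Rightarrow> 'k) set"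
    by (rule nf_inj)
      (simp_all add: that D_carrier alg_add_closed alg_mult_closed arr_closed b nf_add nf_mult mult_add_left keep_add)
  have assoc: "(scalar A c \<otimes>\<^bsub>A\<^esub> u) \<otimes>\<^bsub>A\<^esub> arr b = scalar A c \<otimes>\<^bsub>A\<^esub> (u \<otimes>\<^bsub>A\<^esub> arr b)"
    if "u \<in> D" for u :: "('v \<times> 'a list \<Rightarrow> 'k) set" and c
  proof (rule nf_inj)
    have u: "u \<in> carrier A"
      by (rule D_carrier[OF that])
    show "nf (scalar A c \<otimes>\<^bsub>A\<^esub> u \<otimes>\<^bsub>A\<^esub> arr b) = nf (scalar A c \<otimes>\<^bsub>A\<^esub> (u \<otimes>\<^bsub>A\<^esub> arr b))"
      by (simp add: u nf_mult[of _ "arr b"] nf_scalar_mult alg_mult_closed scalar_closed arr_closed b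
          mult_fscale_left keep_fscale)
  qed (simp_all add: alg_mult_closed scalar_closed arr_closed b D_carrier that)
  show "arr b \<odot>\<^bsub>graded_injective A (idem x)\<^esub> \<phi> \<in> functionals x"
    unfolding eq
  proof (rule functionalsI)
    show "?\<psi> (u \<oplus>\<^bsub>A\<^esub> v) = ?\<psi> u + ?\<psi> v" if "u \<in> D" "v \<in> D" for u v
      using that D_add[OF that] functionalsD(2)[OF \<phi> D_mult_arr[OF that(1) b] D_mult_arr[OF that(2) b]]
      by (simp add: distr)
    show "?\<psi> (scalar A c \<otimes>\<^bsub>A\<^esub> u) = c * ?\<psi> u" if "u \<in> D" for c u
      using that D_scalar[OF that, of c] functionalsD(3)[OF \<phi> D_mult_arr[OF that b]] by (simp add: assoc)
    show "finite ((\<lambda>m. m - 1) ` {m. \<exists>u \<in> D \<inter> acomp A m. \<phi> u \<noteq> 0})"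
      using functionalsD(4)[OF \<phi>] by simp
    show "m \<in> (\<lambda>m. m - 1) ` {m. \<exists>u \<in> D \<inter> acomp A m. \<phi> u \<noteq> 0}"
      if u: "u \<in> D" "u \<in> acomp A m" "?\<psi> u \<noteq> 0" for m u
    proof (rule image_eqI)
      have "\<phi> (u \<otimes>\<^bsub>A\<^esub> arr b) \<noteq> 0"
        using u by simp
      then show "m + 1 \<in> {m. \<exists>u \<in> D \<inter> acomp A m. \<phi> u \<noteq> 0}"
        using D_mult_arr[OF u(1) b] acomp_mult_arr[OF u(1) b u(2)] by blast
    qed simp
  qed simp
  show "inj_coord x (arr b \<odot>\<^bsub>graded_injective A (idem x)\<^esub> \<phi>) w = inj_coord x \<phi> (b # w)"
    unfolding eq inj_coord_def
    using Cons_inj_wordsD(1)[of b w x]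
    by (auto simp: basis_mult_arr[OF b] functional_zero[OF \<phi>] D_basis)
qed

lemma coordinates_injective:
  "coordinates (A :: (('v \<times> 'a list \<Rightarrow> 'k::field) set, 'k) graded_algebra)
    (graded_injective A (idem x)) (inj_words x) (\<lambda>w. - int (length w)) (inj_coord x)"
proof (unfold_locales, unfold injective_simps)
  show "bij_betw (inj_coord x) (functionals x :: (('v \<times> 'a list \<Rightarrow> 'k) set \<Rightarrow> 'k) set) (finfuns (inj_words x))"
  proof (rule bij_betw_imageI)
    show "inj_on (inj_coord x) (functionals x :: (('v \<times> 'a list \<Rightarrow> 'k) set \<Rightarrow> 'k) set)"
      using functional_ext by (rule inj_onI)
    show "inj_coord x ` functionals x = (finfuns (inj_words x) :: ('a list \<Rightarrow> 'k) set)"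
    proof (intro equalityI subsetI)
      fix g :: "'a list \<Rightarrow> 'k"
      assume g: "g \<in> finfuns (inj_words x)"
      show "g \<in> inj_coord x ` functionals x"
        using imageI[OF inj_coord_surj(1)[OF g], of "inj_coord x"] by (simp only: inj_coord_surj(2)[OF g])
    qed (use inj_coord_finfuns in blast)
  qed
  fix \<phi> \<psi> :: "('v \<times> 'a list \<Rightarrow> 'k) set \<Rightarrow> 'k"
  assume \<phi>: "\<phi> \<in> functionals x" and \<psi>: "\<psi> \<in> functionals x"
  show "(\<lambda>u\<in>D. \<phi> u + \<psi> u) \<in> functionals x"
    by (rule functionalsI[of _ _ "{m. \<exists>u \<in> D \<inter> acomp A m. \<phi> u \<noteq> 0} \<union> {m. \<exists>u \<in> D \<inter> acomp A m. \<psi> u \<noteq> 0}"])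
      (auto simp: functionalsD(2,3,4)[OF \<phi>] functionalsD(2,3,4)[OF \<psi>] D_add D_scalar algebra_simps)
  show "inj_coord x (\<lambda>u\<in>D. \<phi> u + \<psi> u) = inj_coord x \<phi> + inj_coord x \<psi>"
    by (auto simp: inj_coord_def fun_eq_iff D_basis)
next
  fix c and \<phi> :: "('v \<times> 'a list \<Rightarrow> 'k) set \<Rightarrow> 'k"
  assume \<phi>: "\<phi> \<in> functionals x"
  show "(\<lambda>u\<in>D. \<phi> (u \<otimes>\<^bsub>A\<^esub> scalar A c)) \<in> functionals x"
    by (rule functional_scale[OF \<phi>])
  show "inj_coord x (\<lambda>u\<in>D. \<phi> (u \<otimes>\<^bsub>A\<^esub> scalar A c)) = fscale c (inj_coord x \<phi>)"
    by (auto simp: inj_coord_def fun_eq_iff D_basis mult_scalar_commute basis_carrier functionalsD(3)[OF \<phi>])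
next
  show "(\<lambda>u\<in>D. 0) \<in> (functionals x :: (('v \<times> 'a list \<Rightarrow> 'k) set \<Rightarrow> 'k) set)"
    by (rule functionalsI[of _ _ "{}"]) (auto simp: D_add D_scalar)
  show "inj_coord x (\<lambda>u\<in>D. 0) = (0 :: 'a list \<Rightarrow> 'k)"
    by (auto simp: inj_coord_def fun_eq_iff D_basis)
next
  fix n
  have "(\<forall>m. m \<noteq> - n \<longrightarrow> (\<forall>u \<in> D \<inter> acomp A m. \<phi> u = 0)) \<longleftrightarrow>
      inj_coord x \<phi> \<in> finfuns (grade (inj_words x) (\<lambda>w. - int (length w)) n)"
    if \<phi>: "\<phi> \<in> functionals x" for \<phi> :: "('v \<times> 'a list \<Rightarrow> 'k) set \<Rightarrow> 'k"
  proof
    assume vanish: "\<forall>m. m \<noteq> - n \<longrightarrow> (\<forall>u \<in> D \<inter> acomp A m. \<phi> u = 0)"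
    have "- int (length w) = n" if "inj_coord x \<phi> w \<noteq> 0" for w
    proof -
      have w: "w \<in> inj_words x" "\<phi> (basis x w) \<noteq> 0"
        using that by (auto simp: inj_coord_def split: if_splits)
      then have "int (length w) = - n"
        using vanish D_basis[OF w(1)] basis_degree[OF w(1)] by blast
      then show ?thesis
        by simp
    qed
    then show "inj_coord x \<phi> \<in> finfuns (grade (inj_words x) (\<lambda>w. - int (length w)) n)"
      using inj_coord_finfuns[OF \<phi>] by (auto simp: finfuns_def grade_def)
  next
    assume grade: "inj_coord x \<phi> \<in> finfuns (grade (inj_words x) (\<lambda>w. - int (length w)) n)"
    show "\<forall>m. m \<noteq> - n \<longrightarrow> (\<forall>u \<in> D \<inter> acomp A m. \<phi> u = 0)"
    proof (intro allI impI ballI)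
      fix m and u :: "('v \<times> 'a list \<Rightarrow> 'k) set"
      assume m: "m \<noteq> - n" and u: "u \<in> D \<inter> acomp A m"
      have "nf u (start x w, w) * inj_coord x \<phi> w = 0" for w
      proof (cases "nf u (start x w, w) = 0")
        case False
        then have "int (length (snd (start x w, w))) = m"
          using u unfolding acomp_alg by blast
        then have "w \<notin> grade (inj_words x) (\<lambda>w. - int (length w)) n"
          using m by (auto simp: grade_def)
        then show ?thesis
          using finfuns_outside[OF grade] by simp
      qed simp
      then show "\<phi> u = 0"
        using functional_expansion[OF \<phi>, of u] u by (simp only: sum.neutral_const Int_iff)
    qed
  qed
  then show "{\<phi> \<in> functionals x. \<forall>m. m \<noteq> - n \<longrightarrow> (\<forall>u \<in> D \<inter> acomp A m. \<phi> u = 0)} =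
      {\<phi> \<in> functionals x. inj_coord x \<phi> \<in> (finfuns (grade (inj_words x) (\<lambda>w. - int (length w)) n) :: ('a list \<Rightarrow> 'k) set)}"
    by (intro Collect_cong conj_cong refl)
qed

end

end

section \<open>Finite direct sums and rationality\<close>

lemma coordinates_shift:
  assumes "coordinates A P X deg \<kappa>"
  shows "coordinates A (shift i P) X (\<lambda>x. i + deg x) \<kappa>"
proof -
  interpret coordinates A P X deg \<kappa> by fact
  have "grade X (\<lambda>x. i + deg x) m = grade X deg (m - i)" for m
    by (auto simp: grade_def)
  then show ?thesis
    by unfold_locales (simp_all add: shift_def bij add_closed coord_add scalar_closed coord_scalar
        zero_closed coord_zero mcomp_eq)
qed

definition sum_coord :: "nat \<Rightarrow> (nat \<Rightarrow> 'p \<Rightarrow> 'w \<Rightarrow> 'k::zero) \<Rightarrow> (nat \<Rightarrow> 'p) \<Rightarrow> nat \<times> 'w \<Rightarrow> 'k" where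
  "sum_coord J \<kappa> f = (\<lambda>(j, w). if j < J then \<kappa> j (f j) w else 0)"

lemma sum_coord_apply: "sum_coord J \<kappa> f (j, w) = (if j < J then \<kappa> j (f j) w else 0)"
  by (simp add: sum_coord_def)

lemma finfuns_pairs_iff:
  "F \<in> finfuns {(j, w). j < (J::nat) \<and> w \<in> X j} \<longleftrightarrow>
    (\<forall>j. (if j < J then (\<lambda>w. F (j, w)) \<in> finfuns (X j) else (\<forall>w. F (j, w) = 0)))"
    (is "?L \<longleftrightarrow> ?R")
proof
  assume F: ?L
  show ?R
  proof
    fix j
    show "if j < J then (\<lambda>w. F (j, w)) \<in> finfuns (X j) else (\<forall>w. F (j, w) = 0)"
    proof (cases "j < J")
      case True
      have "finite (snd ` {x. F x \<noteq> 0})"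
        using F by (simp add: finfuns_def)
      moreover have "{w. F (j, w) \<noteq> 0} \<subseteq> snd ` {x. F x \<noteq> 0}"
        by force
      moreover have "{w. F (j, w) \<noteq> 0} \<subseteq> X j"
        using finfuns_outside[OF F] by fastforce
      ultimately have "(\<lambda>w. F (j, w)) \<in> finfuns (X j)"
        unfolding finfuns_def by (blast intro: finite_subset)
      with True show ?thesis
        by simp
    next
      case False
      then show ?thesis
        using finfuns_outside[OF F] by simp
    qed
  qed
next
  assume F: ?R
  then have fin: "(\<lambda>w. F (j, w)) \<in> finfuns (X j)" if "j < J" for j
    using that by presburger
  have zero: "F (j, w) = 0" if "\<not> j < J" for j w
    using F that by presburger
  have "{x. F x \<noteq> 0} = (SIGMA j:{..<J}. {w. F (j, w) \<noteq> 0})"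
    using zero by force
  moreover have "finite (SIGMA j:{..<J}. {w. F (j, w) \<noteq> 0})"
    using fin by (intro finite_SigmaI) (auto simp: finfuns_def)
  moreover have "w \<in> X j" if "j < J" "F (j, w) \<noteq> 0" for j w
    using finfuns_outside[OF fin[OF that(1)], of w] that(2) by blast
  ultimately show ?L
    using zero unfolding finfuns_def by auto
qed

lemma coordinates_direct_sum:
  fixes A :: "('a, 'k::field) graded_algebra" and Ms :: "('a, 'p) graded_module list"
    and \<kappa> :: "nat \<Rightarrow> 'p \<Rightarrow> 'w \<Rightarrow> 'k"
  assumes coord: "\<And>j. j < length Ms \<Longrightarrow> coordinates A (Ms ! j) (X j) (deg j) (\<kappa> j)"
  shows "coordinates A (direct_sum Ms) {(j, w). j < length Ms \<and> w \<in> X j} (\<lambda>(j, w). deg j w)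
    (sum_coord (length Ms) \<kappa>)"
proof -
  let ?J = "length Ms" and ?S = "direct_sum Ms" and ?X = "{(j, w). j < length Ms \<and> w \<in> X j}"
  have carr: "f \<in> carrier ?S \<longleftrightarrow> (\<forall>j<?J. f j \<in> carrier (Ms ! j)) \<and> f \<in> extensional {..<?J}" for f
    by (auto simp: direct_sum_def Let_def PiE_def Pi_def)
  have sum_fin: "sum_coord ?J \<kappa> f \<in> finfuns ?X" if f: "f \<in> carrier ?S" for f
    unfolding finfuns_pairs_iff
    using f coordinates.coord_closed[OF coord] by (simp add: sum_coord_apply carr)
  show ?thesis
  proof
    show "bij_betw (sum_coord ?J \<kappa>) (carrier ?S) (finfuns ?X)"
    proof (rule bij_betw_imageI)
      show "inj_on (sum_coord ?J \<kappa>) (carrier ?S)"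
      proof (rule inj_onI)
        fix f g assume f: "f \<in> carrier ?S" and g: "g \<in> carrier ?S"
          and eq: "sum_coord ?J \<kappa> f = sum_coord ?J \<kappa> g"
        show "f = g"
        proof (rule extensionalityI)
          show "f \<in> extensional {..<?J}" "g \<in> extensional {..<?J}"
            using f g by (simp_all add: carr)
          fix j assume "j \<in> {..<?J}"
          then have j: "j < ?J"
            by simp
          have "\<kappa> j (f j) = \<kappa> j (g j)"
          proof
            show "\<kappa> j (f j) w = \<kappa> j (g j) w" for w
              using fun_cong[OF eq, of "(j, w)"] j by (simp add: sum_coord_apply)
          qed
          then show "f j = g j"
            using coordinates.coord_inj[OF coord[OF j]] f g j by (auto simp: carr)
        qed
      qed
      show "sum_coord ?J \<kappa> ` carrier ?S = finfuns ?X"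
      proof (intro equalityI subsetI)
        fix F :: "nat \<times> 'w \<Rightarrow> 'k"
        assume F: "F \<in> finfuns ?X"
        define f where "f = (\<lambda>j\<in>{..<?J}. coordinates.of_coord (Ms ! j) (\<kappa> j) (\<lambda>w. F (j, w)))"
        have comp: "(\<lambda>w. F (j, w)) \<in> finfuns (X j)" if "j < ?J" for j
          using F that unfolding finfuns_pairs_iff by presburger
        have "f \<in> carrier ?S"
          using coordinates.of_coord_closed[OF coord comp] by (simp add: carr f_def)
        moreover have "sum_coord ?J \<kappa> f = F"
        proof
          fix x :: "nat \<times> 'w"
          obtain j w where x: "x = (j, w)" by (cases x)
          show "sum_coord ?J \<kappa> f x = F x"
          proof (cases "j < ?J")
            case True
            then show ?thesis
              using coordinates.coord_of_coord[OF coord comp, OF True True] by (simp add: x sum_coord_apply f_def)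
          next
            case False
            then show ?thesis
              using finfuns_outside[OF F, of x] by (simp add: x sum_coord_apply)
          qed
        qed
        ultimately show "F \<in> sum_coord ?J \<kappa> ` carrier ?S"
          by blast
      qed (use sum_fin in blast)
    qed
    fix f g assume f: "f \<in> carrier ?S" and g: "g \<in> carrier ?S"
    have add: "f \<oplus>\<^bsub>?S\<^esub> g = (\<lambda>j\<in>{..<?J}. f j \<oplus>\<^bsub>Ms ! j\<^esub> g j)"
      by (simp add: direct_sum_def Let_def)
    show "f \<oplus>\<^bsub>?S\<^esub> g \<in> carrier ?S"
      unfolding add carr using f g coordinates.add_closed[OF coord] by (simp add: carr)
    show "sum_coord ?J \<kappa> (f \<oplus>\<^bsub>?S\<^esub> g) = sum_coord ?J \<kappa> f + sum_coord ?J \<kappa> g"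
      unfolding add using f g coordinates.coord_add[OF coord]
      by (auto simp: fun_eq_iff sum_coord_apply carr)
  next
    fix c f assume f: "f \<in> carrier ?S"
    have smult: "scalar A c \<odot>\<^bsub>?S\<^esub> f = (\<lambda>j\<in>{..<?J}. scalar A c \<odot>\<^bsub>Ms ! j\<^esub> f j)"
      by (simp add: direct_sum_def Let_def)
    show "scalar A c \<odot>\<^bsub>?S\<^esub> f \<in> carrier ?S"
      unfolding smult carr using f coordinates.scalar_closed[OF coord] by (simp add: carr)
    show "sum_coord ?J \<kappa> (scalar A c \<odot>\<^bsub>?S\<^esub> f) = fscale c (sum_coord ?J \<kappa> f)"
      unfolding smult using f coordinates.coord_scalar[OF coord]
      by (auto simp: fun_eq_iff sum_coord_apply carr)
  next
    have zero: "\<zero>\<^bsub>?S\<^esub> = (\<lambda>j\<in>{..<?J}. \<zero>\<^bsub>Ms ! j\<^esub>)"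
      by (simp add: direct_sum_def Let_def)
    show "\<zero>\<^bsub>?S\<^esub> \<in> carrier ?S"
      unfolding zero carr using coordinates.zero_closed[OF coord] by simp
    show "sum_coord ?J \<kappa> \<zero>\<^bsub>?S\<^esub> = 0"
      unfolding zero using coordinates.coord_zero[OF coord] by (auto simp: fun_eq_iff sum_coord_apply)
  next
    fix m
    have grade: "grade ?X (\<lambda>(j, w). deg j w) m = {(j, w). j < ?J \<and> w \<in> grade (X j) (deg j) m}"
      by (auto simp: grade_def)
    have "f \<in> mcomp ?S m \<longleftrightarrow> f \<in> carrier ?S \<and> sum_coord ?J \<kappa> f \<in> finfuns (grade ?X (\<lambda>(j, w). deg j w) m)" for f
    proof -
      have "f \<in> mcomp ?S m \<longleftrightarrow> (\<forall>j<?J. f j \<in> mcomp (Ms ! j) m) \<and> f \<in> extensional {..<?J}"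
        by (auto simp: direct_sum_def Let_def PiE_def Pi_def)
      also have "\<dots> \<longleftrightarrow> (\<forall>j<?J. f j \<in> carrier (Ms ! j) \<and> \<kappa> j (f j) \<in> finfuns (grade (X j) (deg j) m)) \<and>
          f \<in> extensional {..<?J}"
        using coordinates.mcomp_eq[OF coord] by auto
      also have "\<dots> \<longleftrightarrow> f \<in> carrier ?S \<and> sum_coord ?J \<kappa> f \<in> finfuns (grade ?X (\<lambda>(j, w). deg j w) m)"
        unfolding carr grade finfuns_pairs_iff by (auto simp: sum_coord_apply)
      finally show ?thesis .
    qed
    then show "mcomp ?S m = {p \<in> carrier ?S. sum_coord ?J \<kappa> p \<in> finfuns (grade ?X (\<lambda>(j, w). deg j w) m)}"
      by blast
  qed
qed

context monomial_algebra begin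

definition follows_proj :: "'a \<Rightarrow> 'a \<Rightarrow> bool" where
  "follows_proj b c \<longleftrightarrow> b \<in> arcs G \<and> c \<in> arcs G \<and> head G c = tail G b \<and> \<not> T c b"

definition precedes_inj :: "'a \<Rightarrow> 'a \<Rightarrow> bool" where
  "precedes_inj b c \<longleftrightarrow> b \<in> arcs G \<and> c \<in> arcs G \<and> head G b = tail G c \<and> \<not> T b c"

lemma word_system_proj: "word_system (arcs G) follows_proj J (\<lambda>j. proj_words (v j))"
proof
  show "finite (arcs G)"
    by (rule finite_arcs)
  show "set w \<subseteq> arcs G" if "w \<in> proj_words (v j)" for j w
    using that by (auto simp: proj_words_def good_paths_def paths_iff awalk_def)
  show "b # c # w \<in> proj_words (v j) \<longleftrightarrow> follows_proj b c \<and> c # w \<in> proj_words (v j)" for j b c w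
  proof -
    have "awlast (v j) (rev w @ [c]) = head G c"
      unfolding awlast_append by simp
    then have "(v j, (rev w @ [c]) @ [b]) \<in> paths G \<longleftrightarrow>
        (v j, rev w @ [c]) \<in> paths G \<and> b \<in> arcs G \<and> head G c = tail G b"
      unfolding paths_append_iff[of _ "rev w @ [c]"] by (auto simp: paths_iff awalk_Cons_iff awalk_Nil_iff)
    moreover have "c \<in> arcs G" if "(v j, rev w @ [c]) \<in> paths G"
      using that by (auto simp: paths_iff awalk_def)
    ultimately show ?thesis
      by (auto simp: proj_words_def good_paths_def follows_proj_def successively_append_iff)
  qed
  show "w \<in> proj_words (v j)" if "b # w \<in> proj_words (v j)" for j b w
    using that good_paths_append(1)[of "v j" "rev w" "[b]" T] by (simp add: proj_words_def)
qed

lemma word_system_inj: "word_system (arcs G) precedes_inj J (\<lambda>j. inj_words (v j))"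
proof
  show "finite (arcs G)"
    by (rule finite_arcs)
  show "set w \<subseteq> arcs G" if "w \<in> inj_words (v j)" for j w
    using that by (auto simp: inj_words_def good_paths_def paths_iff awalk_def)
  show "b # c # w \<in> inj_words (v j) \<longleftrightarrow> precedes_inj b c \<and> c # w \<in> inj_words (v j)" for j b c w
  proof -
    have "awlast (tail G b) ([b] @ (c # w)) = awlast (tail G c) (c # w)"
      unfolding awlast_append by simp
    moreover have "(tail G b, [b] @ (c # w)) \<in> paths G \<longleftrightarrow>
        b \<in> arcs G \<and> head G b = tail G c \<and> (tail G c, c # w) \<in> paths G"
      unfolding paths_append_iff[of _ "[b]"] by (auto simp: paths_iff awalk_Cons_iff awalk_Nil_iff)
    moreover have "c \<in> arcs G" if "(tail G c, c # w) \<in> paths G"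
      using that by (auto simp: paths_iff awalk_def)
    ultimately show ?thesis
      by (auto simp: inj_words_def start_def good_paths_def precedes_inj_def)
  qed
  show "w \<in> inj_words (v j)" if "b # w \<in> inj_words (v j)" for j b w
    by (rule Cons_inj_wordsD(1)[OF that])
qed

definition proj_sum :: "('v \<times> int) list \<Rightarrow> (('v \<times> 'a list \<Rightarrow> 'k::field) set, nat \<Rightarrow> ('v \<times> 'a list \<Rightarrow> 'k) set) graded_module" where
  "proj_sum xs = direct_sum (map (\<lambda>(x, i). shift i (graded_projective A (idem x))) xs)"

definition inj_sum :: "('v \<times> int) list \<Rightarrow> (('v \<times> 'a list \<Rightarrow> 'k::field) set, nat \<Rightarrow> ('v \<times> 'a list \<Rightarrow> 'k) set \<Rightarrow> 'k) graded_module" where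
  "inj_sum xs = direct_sum (map (\<lambda>(x, i). shift i (graded_injective A (idem x))) xs)"

lemma coordinates_proj_sum:
  assumes xs: "set (map fst xs) \<subseteq> verts G"
  shows "coordinates (A :: (('v \<times> 'a list \<Rightarrow> 'k::field) set, 'k) graded_algebra) (proj_sum xs)
    (word_system.total (length xs) (\<lambda>j. proj_words (fst (xs ! j)))) (proj_degree (\<lambda>j. snd (xs ! j)))
    (sum_coord (length xs) (\<lambda>j. proj_coord (fst (xs ! j))))"
proof -
  let ?Ms = "map (\<lambda>(x, i). shift i (graded_projective (A :: (('v \<times> 'a list \<Rightarrow> 'k) set, 'k) graded_algebra) (idem x))) xs"
  have "coordinates A (?Ms ! j) (proj_words (fst (xs ! j))) (\<lambda>w. snd (xs ! j) + int (length w)) (proj_coord (fst (xs ! j)))"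
    if "j < length ?Ms" for j
  proof -
    have "fst (xs ! j) \<in> verts G"
      using xs that by auto
    then show ?thesis
      using coordinates_shift[OF coordinates_projective, of "fst (xs ! j)" "snd (xs ! j)"] that
      by (simp add: case_prod_unfold)
  qed
  then have "coordinates A (direct_sum ?Ms) {(j, w). j < length ?Ms \<and> w \<in> proj_words (fst (xs ! j))}
      (\<lambda>(j, w). snd (xs ! j) + int (length w)) (sum_coord (length ?Ms) (\<lambda>j. proj_coord (fst (xs ! j))))"
    by (rule coordinates_direct_sum)
  then show ?thesis
    by (simp add: proj_sum_def proj_degree_def word_system.total_def[OF word_system_proj])
qed

lemma coordinates_inj_sum:
  assumes xs: "set (map fst xs) \<subseteq> verts G"
  shows "coordinates (A :: (('v \<times> 'a list \<Rightarrow> 'k::field) set, 'k) graded_algebra) (inj_sum xs)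
    (word_system.total (length xs) (\<lambda>j. inj_words (fst (xs ! j)))) (inj_degree (\<lambda>j. snd (xs ! j)))
    (sum_coord (length xs) (\<lambda>j. inj_coord (fst (xs ! j))))"
proof -
  let ?Ms = "map (\<lambda>(x, i). shift i (graded_injective (A :: (('v \<times> 'a list \<Rightarrow> 'k) set, 'k) graded_algebra) (idem x))) xs"
  have "coordinates A (?Ms ! j) (inj_words (fst (xs ! j))) (\<lambda>w. snd (xs ! j) + - int (length w)) (inj_coord (fst (xs ! j)))"
    if "j < length ?Ms" for j
  proof -
    have "fst (xs ! j) \<in> verts G"
      using xs that by auto
    then show ?thesis
      using coordinates_shift[OF coordinates_injective, of "fst (xs ! j)" "snd (xs ! j)"] that
      by (simp add: case_prod_unfold)
  qed
  then have "coordinates A (direct_sum ?Ms) {(j, w). j < length ?Ms \<and> w \<in> inj_words (fst (xs ! j))}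
      (\<lambda>(j, w). snd (xs ! j) + - int (length w)) (sum_coord (length ?Ms) (\<lambda>j. inj_coord (fst (xs ! j))))"
    by (rule coordinates_direct_sum)
  then show ?thesis
    by (simp add: inj_sum_def inj_degree_def word_system.total_def[OF word_system_inj])
qed

lemma proj_sum_action:
  assumes xs: "set (map fst xs) \<subseteq> verts G" and b: "b \<in> arcs G" and f: "f \<in> carrier (proj_sum xs)"
  shows "arr b \<odot>\<^bsub>proj_sum xs\<^esub> f \<in> carrier (proj_sum xs) \<and>
    sum_coord (length xs) (\<lambda>j. proj_coord (fst (xs ! j))) (arr b \<odot>\<^bsub>proj_sum xs\<^esub> f) =
    word_system.push (length xs) (\<lambda>j. proj_words (fst (xs ! j))) b
      (sum_coord (length xs) (\<lambda>j. proj_coord (fst (xs ! j))) f)"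
proof -
  have vert: "fst (xs ! j) \<in> verts G" if "j < length xs" for j
    using xs that by auto
  let ?P = "\<lambda>j. graded_projective A (idem (fst (xs ! j)))"
  have carr: "g \<in> carrier (proj_sum xs) \<longleftrightarrow>
      (\<forall>j<length xs. g j \<in> carrier (?P j)) \<and> g \<in> extensional {..<length xs}" for g
    by (auto simp: proj_sum_def direct_sum_def Let_def PiE_def Pi_def shift_def case_prod_unfold)
  have act: "arr b \<odot>\<^bsub>proj_sum xs\<^esub> f = (\<lambda>j\<in>{..<length xs}. arr b \<odot>\<^bsub>?P j\<^esub> f j)"
    by (auto simp: proj_sum_def direct_sum_def Let_def shift_def case_prod_unfold fun_eq_iff)
  have fj: "f j \<in> carrier (?P j)" if "j < length xs" for j
    using f that by (simp add: carr)
  show ?thesis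
  proof (intro conjI ext)
    show "arr b \<odot>\<^bsub>proj_sum xs\<^esub> f \<in> carrier (proj_sum xs)"
      unfolding act carr using projective_action(1)[OF vert b fj] by simp
    fix p :: "nat \<times> 'a list"
    obtain j w where p: "p = (j, w)" by (cases p)
    show "sum_coord (length xs) (\<lambda>j. proj_coord (fst (xs ! j))) (arr b \<odot>\<^bsub>proj_sum xs\<^esub> f) p =
      word_system.push (length xs) (\<lambda>j. proj_words (fst (xs ! j))) b
        (sum_coord (length xs) (\<lambda>j. proj_coord (fst (xs ! j))) f) p"
      unfolding act p word_system.push_def[OF word_system_proj] word_system.total_def[OF word_system_proj]
      using projective_action(2)[OF vert b fj] by (simp add: sum_coord_apply)
  qed
qed

lemma inj_sum_action:
  assumes xs: "set (map fst xs) \<subseteq> verts G" and b: "b \<in> arcs G" and f: "f \<in> carrier (inj_sum xs)"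
  shows "arr b \<odot>\<^bsub>inj_sum xs\<^esub> f \<in> carrier (inj_sum xs) \<and>
    sum_coord (length xs) (\<lambda>j. inj_coord (fst (xs ! j))) (arr b \<odot>\<^bsub>inj_sum xs\<^esub> f) =
    after b (sum_coord (length xs) (\<lambda>j. inj_coord (fst (xs ! j))) f)"
proof -
  have vert: "fst (xs ! j) \<in> verts G" if "j < length xs" for j
    using xs that by auto
  let ?P = "\<lambda>j. graded_injective A (idem (fst (xs ! j)))"
  have carr: "g \<in> carrier (inj_sum xs) \<longleftrightarrow>
      (\<forall>j<length xs. g j \<in> functionals (fst (xs ! j))) \<and> g \<in> extensional {..<length xs}" for g
    by (auto simp: inj_sum_def direct_sum_def Let_def PiE_def Pi_def shift_def case_prod_unfold injective_simps)
  have act: "arr b \<odot>\<^bsub>inj_sum xs\<^esub> f = (\<lambda>j\<in>{..<length xs}. arr b \<odot>\<^bsub>?P j\<^esub> f j)"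
    by (auto simp: inj_sum_def direct_sum_def Let_def shift_def case_prod_unfold fun_eq_iff)
  have fj: "f j \<in> functionals (fst (xs ! j))" if "j < length xs" for j
    using f that by (simp add: carr)
  show ?thesis
  proof (intro conjI ext)
    show "arr b \<odot>\<^bsub>inj_sum xs\<^esub> f \<in> carrier (inj_sum xs)"
      unfolding act carr using injective_action(1)[OF vert b fj] by simp
    fix p :: "nat \<times> 'a list"
    obtain j w where p: "p = (j, w)" by (cases p)
    show "sum_coord (length xs) (\<lambda>j. inj_coord (fst (xs ! j))) (arr b \<odot>\<^bsub>inj_sum xs\<^esub> f) p =
        after b (sum_coord (length xs) (\<lambda>j. inj_coord (fst (xs ! j))) f) p"
      unfolding act p using injective_action(2)[OF vert b fj] by (simp add: sum_coord_apply)
  qed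
qed

theorem presented_over_monomial_algebra:
  assumes M: "graded_left_module A M"
    and xs: "set (map fst xs) \<subseteq> verts G" and ys: "set (map fst ys) \<subseteq> verts G"
    and d: "d \<in> graded_hom A (proj_sum xs) (proj_sum ys)" and \<epsilon>: "\<epsilon> \<in> graded_hom A (proj_sum ys) M"
    and exact: "d ` carrier (proj_sum xs) = {p \<in> carrier (proj_sum ys). \<epsilon> p = \<zero>\<^bsub>M\<^esub>}"
    and surj: "\<epsilon> ` carrier (proj_sum ys) = carrier M"
  shows "rational_in_t (comp_dim A M)"
  by (rule presented_rational[OF scalar_module.intro[OF scalar_algebra_alg M] word_system_proj word_system_proj
      coordinates_proj_sum[OF xs] coordinates_proj_sum[OF ys] arr_closed
      proj_sum_action[OF xs] proj_sum_action[OF ys] d \<epsilon> exact surj])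

theorem copresented_over_monomial_algebra:
  assumes M: "graded_left_module A M"
    and xs: "set (map fst xs) \<subseteq> verts G" and ys: "set (map fst ys) \<subseteq> verts G"
    and \<iota>: "\<iota> \<in> graded_hom A M (inj_sum xs)" and d: "d \<in> graded_hom A (inj_sum xs) (inj_sum ys)"
    and inj: "inj_on \<iota> (carrier M)"
    and exact: "\<iota> ` carrier M = {p \<in> carrier (inj_sum xs). d p = \<zero>\<^bsub>inj_sum ys\<^esub>}"
  shows "rational_in_t_inverse (comp_dim A M)"
  by (rule copresented_rational[OF scalar_module.intro[OF scalar_algebra_alg M] word_system_inj word_system_inj
      coordinates_inj_sum[OF xs] coordinates_inj_sum[OF ys] arr_closed
      inj_sum_action[OF xs] inj_sum_action[OF ys] \<iota> d inj exact])

end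

lemma fin_digraph_opposite_quiver:
  assumes "fin_digraph Q"
  shows "fin_digraph (opposite_quiver Q)"
proof -
  interpret fin_digraph Q by fact
  show ?thesis
    by unfold_locales (auto simp: opposite_quiver_def)
qed

text \<open>
  Passing to the opposite quiver reverses the order of traversal, whence the exchanged arguments.
\<close>

lemma quadratic_dual_ideal_eq:
  assumes "fin_digraph Q"
  shows "quadratic_dual_ideal Q I =
    fin_digraph.monomial_ideal (opposite_quiver Q) (\<lambda>b a. path_vec (tail Q a, [a, b]) \<notin> I)"
proof -
  interpret fin_digraph "opposite_quiver Q"
    by (rule fin_digraph_opposite_quiver[OF assms])
  show ?thesis
    unfolding genideal_quadratic_monomials[symmetric] quadratic_dual_ideal_def
  proof (intro arg_cong[where f = "genideal (path_algebra (opposite_quiver Q))"] Collect_cong iffI;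
      elim exE conjE)
    fix f a b
    assume "f = path_vec (head Q b, [b, a])" "a \<in> arcs Q" "b \<in> arcs Q" "head Q a = tail Q b"
      "path_vec (tail Q a, [a, b]) \<notin> I"
    then show "\<exists>b a. f = path_vec (tail (opposite_quiver Q) b, [b, a]) \<and>
        b \<in> arcs (opposite_quiver Q) \<and> a \<in> arcs (opposite_quiver Q) \<and>
        head (opposite_quiver Q) b = tail (opposite_quiver Q) a \<and> path_vec (tail Q a, [a, b]) \<notin> I"
      by (intro exI[of _ b] exI[of _ a]) (simp add: opposite_quiver_def)
  next
    fix f b a
    assume "f = path_vec (tail (opposite_quiver Q) b, [b, a])"
      "b \<in> arcs (opposite_quiver Q)" "a \<in> arcs (opposite_quiver Q)"
      "head (opposite_quiver Q) b = tail (opposite_quiver Q) a" "path_vec (tail Q a, [a, b]) \<notin> I"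
    then show "\<exists>a b. f = path_vec (head Q b, [b, a]) \<and> a \<in> arcs Q \<and> b \<in> arcs Q \<and>
        head Q a = tail Q b \<and> path_vec (tail Q a, [a, b]) \<notin> I"
      by (intro exI[of _ a] exI[of _ b]) (simp add: opposite_quiver_def)
  qed
qed

theorem corollary3p13:
  fixes Q :: "('v, 'a) pre_digraph"
    and I :: "(('v, 'a) path \<Rightarrow> 'k::field) set"
    and M :: "((('v, 'a) path \<Rightarrow> 'k) set, 'm) graded_module"
  assumes "fin_digraph Q"
    and "quadratic_monomial_ideal Q I"
    and "admissible_ideal Q I"
    and "graded_left_module (quadratic_dual Q I) M"
  shows "(finitely_copresented Q I M \<longrightarrow> rational_in_t_inverse (comp_dim (quadratic_dual Q I) M)) \<and>
         (finitely_presented Q I M \<longrightarrow> rational_in_t (comp_dim (quadratic_dual Q I) M))"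
proof -
  let ?T = "\<lambda>b a. path_vec (tail Q a, [a, b]) \<notin> I"
  interpret monomial_algebra "opposite_quiver Q" ?T
    using fin_digraph_opposite_quiver[OF assms(1)] by (simp add: monomial_algebra_def)
  have dual: "quadratic_dual Q I = alg"
    by (simp add: quadratic_dual_def quadratic_dual_ideal_eq[OF assms(1)])
  have idem: "dual_idem Q I x = idem x" for x
    by (simp add: dual_idem_def idem_def cls_def quadratic_dual_ideal_eq[OF assms(1)])
  have projs: "dual_proj_sum Q I = proj_sum" and injs: "dual_inj_sum Q I = inj_sum"
    by (auto simp: fun_eq_iff dual_proj_sum_def proj_sum_def dual_inj_sum_def inj_sum_def dual idem)
  have verts: "verts (opposite_quiver Q) = verts Q"
    by (simp add: opposite_quiver_def)
  have M: "graded_left_module alg M"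
    using assms(4) by (simp add: dual)
  show ?thesis
    unfolding dual
  proof (intro conjI impI)
    assume "finitely_copresented Q I M"
    then obtain xs ys \<iota> d where
      "set (map fst xs) \<subseteq> verts Q" "set (map fst ys) \<subseteq> verts Q"
      "\<iota> \<in> graded_hom alg M (inj_sum xs)" "d \<in> graded_hom alg (inj_sum xs) (inj_sum ys)"
      "inj_on \<iota> (carrier M)"
      "\<iota> ` carrier M = {p \<in> carrier (inj_sum xs). d p = \<zero>\<^bsub>inj_sum ys\<^esub>}"
      unfolding finitely_copresented_def dual injs by (elim exE conjE)
    then show "rational_in_t_inverse (comp_dim alg M)"
      unfolding verts[symmetric] by (rule copresented_over_monomial_algebra[OF M])
  next
    assume "finitely_presented Q I M"
    then obtain xs ys d \<epsilon> where
      "set (map fst xs) \<subseteq> verts Q" "set (map fst ys) \<subseteq> verts Q"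
      "d \<in> graded_hom alg (proj_sum xs) (proj_sum ys)" "\<epsilon> \<in> graded_hom alg (proj_sum ys) M"
      "d ` carrier (proj_sum xs) = {p \<in> carrier (proj_sum ys). \<epsilon> p = \<zero>\<^bsub>M\<^esub>}"
      "\<epsilon> ` carrier (proj_sum ys) = carrier M"
      unfolding finitely_presented_def dual projs by (elim exE conjE)
    then show "rational_in_t (comp_dim alg M)"
      unfolding verts[symmetric] by (rule presented_over_monomial_algebra[OF M])
  qed
qed

end
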